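(* Let $G_0\subset PSL(2,\mathbf Z)$ be a subgroup of finite index, let $G\subset GL(2,\mathbf Z)$ be the subgroup generated by the preimage of $G_0$ in $SL(2,\mathbf Z)$ and $\begin{pmatrix}-1&0\\0&1\end{pmatrix}$, and let $\mathbf P_0=GL(2,\mathbf Z)/G$ with its left $GL(2,\mathbf Z)$-action. Assume that $\mathrm{Red}(t)=\mathbf P_0$ for each $t\in\mathbf P_0$. Then the limiting modular symbol converges weakly to zero, in the following sense: the sequence of $H_1(X_{G_0},\mathbf R)$-valued functions of $\beta\in[0,1]$ $$\beta\mapsto \frac1n\sum_{i=1}^n\left\{\frac{p_{i-1}(\beta)}{q_{i-1}(\beta)},\frac{p_i(\beta)}{q_i(\beta)}\right\}_{G_0}$$ converges weakly to $0$ in the $L^2$-sense; in particular for every measurable set $E\subset[0,1]$ $$\lim_{n\to\infty}\frac1n\int_E\ \sum_{i=1}^n\left\{\frac{p_{i-1}(\beta)}{q_{i-1}(\beta)},\frac{p_i(\beta)}{q_i(\beta)}\right\}_{G_0}d\beta=0 .$$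
   Context: $H$ is the upper half-plane, $\overline H=H\cup\mathbf P^1(\mathbf Q)$, $X_{G_0}=G_0\backslash\overline H$ is the compactified modular curve, and $\varphi:\overline H\to X_{G_0}$ is the projection. For $\alpha,\beta\in\overline H$ the modular symbol $\{\alpha,\beta\}_{G_0}\in H_1(X_{G_0},\mathbf R)$ is the real homology class defined by $$\int_{\{\alpha,\beta\}_{G_0}}\omega=\int_\alpha^\beta\varphi^*(\omega)$$ for all holomorphic differentials $\omega$ on $X_{G_0}$, the integral on the right being along the geodesic from $\alpha$ to $\beta$ (real homology is identified with the space of complex-linear functionals on holomorphic differentials). For irrational $\beta\in(0,1)$, $p_n(\beta)/q_n(\beta)$ denote the convergents of the continued fraction $\beta=\cfrac1{k_1+\cfrac1{k_2+\cdots}}$, with $p_0/q_0=0/1$, $p_1/q_1=1/k_1$. The set of reduced matrices is $\mathrm{Red}=\bigcup_{n\ge1}\mathrm{Red}_n$, $\mathrm{Red}_n=\left\{\begin{pmatrix}0&1\\1&k_1\end{pmatrix}\cdots\begin{pmatrix}0&1\\1&k_n\end{pmatrix}\,\middle|\,k_i\ge1,\ k_i\in\mathbf Z\right\}\subset GL(2,\mathbf Z)$, and $\mathrm{Red}(t)=\{gt\mid g\in\mathrm{Red}\}$. Background: the limiting modular symbol is $\{\{*,\beta\}\}_{G_0}=\lim \frac{1}{T(x,y)}\{x,y\}_{G_0}$, with $x,y\in H$ on a geodesic ending at $\beta$, $x$ fixed, $y\to\beta$, and $T(x,y)$ the hyperbolic distance. For almost all $\beta$ it is replaced by the limit of $\frac{1}{2C}$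 times the displayed average (plus a bounded term divided by $n$), with $C=\pi^2/(12\log2)$. *)

theory Defs
  imports "HOL-Complex_Analysis.Complex_Analysis" "HOL-Algebra.Generated_Groups"
    "HOL-Algebra.Left_Coset"
begin

definition mat2 :: "'a::zero \<Rightarrow> 'a \<Rightarrow> 'a \<Rightarrow> 'a \<Rightarrow> 'a^2^2" where
  "mat2 a b c d = vector [vector [a, b], vector [c, d]]"

definition GL2Z :: "(int^2^2) monoid" where
  "GL2Z = \<lparr>carrier = {A. det A = 1 \<or> det A = -1}, mult = (**), one = mat 1\<rparr>"

definition SL2Z :: "(int^2^2) monoid" where
  "SL2Z = \<lparr>carrier = {A. det A = 1}, mult = (**), one = mat 1\<rparr>"

definition PSL2Z :: "(int^2^2) set monoid" where
  "PSL2Z = SL2Z Mod {mat 1, - mat 1}"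

definition SL2Z_preimage :: "(int^2^2) set set \<Rightarrow> (int^2^2) set" where
  "SL2Z_preimage G0 = {A \<in> carrier SL2Z. {mat 1, - mat 1} #>\<^bsub>SL2Z\<^esub> A \<in> G0}"

definition GL2Z_extension :: "(int^2^2) set set \<Rightarrow> (int^2^2) set" where
  "GL2Z_extension G0 = generate GL2Z (insert (mat2 (-1) 0 0 1) (SL2Z_preimage G0))"

definition P0 :: "(int^2^2) set set \<Rightarrow> (int^2^2) set set" where
  "P0 G0 = lcosets\<^bsub>GL2Z\<^esub> (GL2Z_extension G0)"

definition Red_n :: "nat \<Rightarrow> (int^2^2) set" where
  "Red_n n = {foldr (\<lambda>k A. mat2 0 1 1 k ** A) ks (mat 1) | ks :: int list.
                length ks = n \<and> (\<forall>k\<in>set ks. k \<ge> 1)}"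

definition Red :: "(int^2^2) set" where
  "Red = (\<Union>n\<in>{1..}. Red_n n)"

definition Red_orbit :: "(int^2^2) set \<Rightarrow> (int^2^2) set set" where
  "Red_orbit t = {g <#\<^bsub>GL2Z\<^esub> t | g. g \<in> Red}"

text \<open>At rational points, a null set, the following functions take irrelevant values.\<close>

definition gauss_map :: "real \<Rightarrow> real" where
  "gauss_map x = frac (1 / x)"

text \<open>The partial quotients are numbered from 1.\<close>

definition cf_digit :: "nat \<Rightarrow> real \<Rightarrow> int" where
  "cf_digit n \<beta> = \<lfloor>1 / (gauss_map ^^ (n - 1)) \<beta>\<rfloor>"

fun cf_p :: "nat \<Rightarrow> real \<Rightarrow> int" where
  "cf_p 0 \<beta> = 0"
| "cf_p (Suc 0) \<beta> = 1"
| "cf_p (Suc (Suc n)) \<beta> = cf_digit (Suc (Suc n)) \<beta> * cf_p (Suc n) \<beta> + cf_p n \<beta>"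

fun cf_q :: "nat \<Rightarrow> real \<Rightarrow> int" where
  "cf_q 0 \<beta> = 1"
| "cf_q (Suc 0) \<beta> = cf_digit 1 \<beta>"
| "cf_q (Suc (Suc n)) \<beta> = cf_digit (Suc (Suc n)) \<beta> * cf_q (Suc n) \<beta> + cf_q n \<beta>"

text \<open>A chart is a pair of its domain and a coordinate, set to 0 off the domain.  A holomorphic
  differential is the family of its coefficients: in the chart (U,c) it reads
  \<omega> (U, c) (s) ds with s = c x.  Setting the irrelevant values to 0 makes the family unique.\<close>

type_synonym 'a chart = "'a set \<times> ('a \<Rightarrow> complex)"
type_synonym 'a differential = "'a chart \<Rightarrow> complex \<Rightarrow> complex"

definition holomorphic_differentials :: "'a chart set \<Rightarrow> 'a differential set" where
  "holomorphic_differentials \<A> = {\<omega>.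
     (\<forall>(U, c)\<in>\<A>. \<omega> (U, c) holomorphic_on (c ` U) \<and> (\<forall>s. s \<notin> c ` U \<longrightarrow> \<omega> (U, c) s = 0)) \<and>
     (\<forall>C. C \<notin> \<A> \<longrightarrow> \<omega> C = (\<lambda>s. 0)) \<and>
     (\<forall>(U, c)\<in>\<A>. \<forall>(V, d)\<in>\<A>. \<forall>x\<in>U \<inter> V.
        \<omega> (U, c) (c x) = \<omega> (V, d) (d x) * deriv (\<lambda>s. d (inv_into U c s)) (c x))}"

text \<open>The function f such that the pullback of \<omega> along p is f(z) dz.
  By the compatibility condition it does not depend on the chosen chart.\<close>

definition pullback_coeff ::
    "'a chart set \<Rightarrow> (complex \<Rightarrow> 'a) \<Rightarrow> 'a differential \<Rightarrow> complex \<Rightarrow> complex" where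
  "pullback_coeff \<A> p \<omega> z =
     (let (U, c) = (SOME C. C \<in> \<A> \<and> p z \<in> fst C)
      in \<omega> (U, c) (c (p z)) * deriv (\<lambda>w. c (p w)) z)"

text \<open>The Riemann sphere is \<^typ>\<open>complex option\<close>, with \<^term>\<open>None\<close> the point at infinity.\<close>

fun moebius :: "complex^2^2 \<Rightarrow> complex option \<Rightarrow> complex option" where
  "moebius A None = (if A$2$1 = 0 then None else Some (A$1$1 / A$2$1))"
| "moebius A (Some z) =
     (if A$2$1 * z + A$2$2 = 0 then None
      else Some ((A$1$1 * z + A$1$2) / (A$2$1 * z + A$2$2)))"

definition act :: "int^2^2 \<Rightarrow> complex option \<Rightarrow> complex option" where
  "act A = moebius (map_matrix of_int A)"

definition Hbar :: "complex option set" where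
  "Hbar = {Some z | z. Im z > 0} \<union> range (\<lambda>r::rat. Some (of_rat r)) \<union> {None}"

definition orbit_map ::
    "(int^2^2) set set \<Rightarrow> complex option \<Rightarrow> complex option set" where
  "orbit_map G0 x = (\<lambda>A. act A x) ` SL2Z_preimage G0"

text \<open>The quotient \<open>orbit_map G0 ` Hbar\<close> is the modular curve; its charts are obtained from
  a neighbourhood N of a point x of \<^term>\<open>Hbar\<close> such that only elements of the stabilizer of x
  map a point of N into N, and a function t on N that is a coordinate modulo this stabilizer.\<close>

definition chart_from ::
    "(int^2^2) set set \<Rightarrow> complex option \<Rightarrow> complex option set \<Rightarrow> (complex option \<Rightarrow> complex) \<Rightarrow>
     (complex option set) chart \<Rightarrow> bool" where
  "chart_from G0 x N t C \<longleftrightarrow>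
     (\<forall>A\<in>SL2Z_preimage G0. \<forall>y\<in>N. act A y \<in> N \<longrightarrow> act A x = x) \<and>
     fst C = orbit_map G0 ` N \<and>
     (\<forall>y\<in>N. snd C (orbit_map G0 y) = t y) \<and>
     (\<forall>u. u \<notin> fst C \<longrightarrow> snd C u = 0)"

text \<open>At a point z0 of the upper half-plane whose stabilizer in \<^term>\<open>G0\<close> has order e
  (so e = 1 if z0 is not elliptic) the coordinate is
  \<open>((z - z0) / (z - cnj z0)) ^ e\<close> on a hyperbolic disc.\<close>

definition stabilizer_order :: "(int^2^2) set set \<Rightarrow> complex \<Rightarrow> nat" where
  "stabilizer_order G0 z0 = card {C \<in> G0. \<forall>A\<in>C. act A (Some z0) = Some z0}"

definition interior_charts :: "(int^2^2) set set \<Rightarrow> (complex option set) chart set" where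
  "interior_charts G0 = {C. \<exists>z0 r. Im z0 > 0 \<and> r > 0 \<and>
     chart_from G0 (Some z0)
       {Some z | z. Im z > 0 \<and> cmod ((z - z0) / (z - cnj z0)) < r}
       (\<lambda>y. ((the y - z0) / (the y - cnj z0)) ^ stabilizer_order G0 z0) C}"

text \<open>At the cusp \<open>\<sigma>(\<infinity>)\<close> of width h the coordinate of \<open>\<sigma>(z)\<close> is
  \<open>exp (2 \<pi> \<i> z / h)\<close>, on a horoball together with the cusp.\<close>

definition cusp_width :: "(int^2^2) set set \<Rightarrow> int^2^2 \<Rightarrow> nat" where
  "cusp_width G0 \<sigma> =
     (LEAST h. h > 0 \<and> (\<exists>B\<in>SL2Z_preimage G0. B ** \<sigma> = \<sigma> ** mat2 1 (int h) 0 1))"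

definition cusp_charts :: "(int^2^2) set set \<Rightarrow> (complex option set) chart set" where
  "cusp_charts G0 = {C. \<exists>\<sigma>\<in>carrier SL2Z. \<exists>r>0. \<exists>t.
     t (act \<sigma> None) = 0 \<and>
     (\<forall>z. Im z > r \<longrightarrow>
        t (act \<sigma> (Some z)) = exp (2 * of_real pi * \<i> * z / of_nat (cusp_width G0 \<sigma>))) \<and>
     chart_from G0 (act \<sigma> None) (act \<sigma> ` insert None {Some z | z. Im z > r}) t C}"

definition modular_curve_atlas :: "(int^2^2) set set \<Rightarrow> (complex option set) chart set" where
  "modular_curve_atlas G0 = interior_charts G0 \<union> cusp_charts G0"

abbreviation modular_differentials ::
    "(int^2^2) set set \<Rightarrow> (complex option set) differential set" where
  "modular_differentials G0 \<equiv> holomorphic_differentials (modular_curve_atlas G0)"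

text \<open>The oriented hyperbolic geodesics are the curves \<open>s \<mapsto> \<sigma>(i exp s)\<close>, with \<open>\<sigma>\<close> in SL(2,R),
  parametrized by arc length.  A geodesic arc is such a curve restricted to an interval [a,b],
  where the infinite end points correspond to the end points of the geodesic.\<close>

definition imaginary_axis :: "ereal \<Rightarrow> complex option" where
  "imaginary_axis s =
     (case s of ereal r \<Rightarrow> Some (\<i> * of_real (exp r)) | PInfty \<Rightarrow> None | MInfty \<Rightarrow> Some 0)"

definition geodesic_point :: "real^2^2 \<Rightarrow> ereal \<Rightarrow> complex option" where
  "geodesic_point \<sigma> s = moebius (map_matrix of_real \<sigma>) (imaginary_axis s)"

definition geodesic_arc ::
    "complex option \<Rightarrow> complex option \<Rightarrow> (real^2^2) \<times> ereal \<times> ereal \<Rightarrow> bool" where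
  "geodesic_arc \<alpha> \<beta> = (\<lambda>(\<sigma>, a, b). det \<sigma> = 1 \<and> a \<le> b \<and>
     geodesic_point \<sigma> a = \<alpha> \<and> geodesic_point \<sigma> b = \<beta>)"

definition geodesic_integral ::
    "(complex \<Rightarrow> complex) \<Rightarrow> complex option \<Rightarrow> complex option \<Rightarrow> complex" where
  "geodesic_integral f \<alpha> \<beta> =
     (let (\<sigma>, a, b) = (SOME g. geodesic_arc \<alpha> \<beta> g);
          \<gamma> = (\<lambda>s::real. the (geodesic_point \<sigma> (ereal s)))
      in LBINT s=a..b. f (\<gamma> s) * vector_derivative \<gamma> (at s))"

text \<open>Real homology classes of the modular curve are complex-linear functionals on its
  holomorphic differentials.\<close>

definition modular_symbol ::
    "(int^2^2) set set \<Rightarrow> complex option \<Rightarrow> complex option \<Rightarrow>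
     (complex option set) differential \<Rightarrow> complex" where
  "modular_symbol G0 \<alpha> \<beta> = (\<lambda>\<omega>\<in>modular_differentials G0.
     geodesic_integral
       (pullback_coeff (modular_curve_atlas G0) (\<lambda>z. orbit_map G0 (Some z)) \<omega>) \<alpha> \<beta>)"

definition convergent_point :: "nat \<Rightarrow> real \<Rightarrow> complex option" where
  "convergent_point n \<beta> = Some (of_int (cf_p n \<beta>) / of_int (cf_q n \<beta>))"

definition symbol_average ::
    "(int^2^2) set set \<Rightarrow> nat \<Rightarrow> real \<Rightarrow> (complex option set) differential \<Rightarrow> complex" where
  "symbol_average G0 n \<beta> \<omega> =
     (1 / of_nat n) * (\<Sum>i=1..n.
        modular_symbol G0 (convergent_point (i - 1) \<beta>) (convergent_point i \<beta>) \<omega>)"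

definition L2_unit :: "(real \<Rightarrow> 'b::real_normed_vector) set" where
  "L2_unit = {f. f \<in> borel_measurable (lebesgue_on {0..1}) \<and>
                 integrable (lebesgue_on {0..1}) (\<lambda>x. (norm (f x))\<^sup>2)}"

text \<open>Weak convergence to 0 in the L2-space of functions on [0,1] with values in a
  finite-dimensional space V of functionals on W, spelled out on the coordinates given by
  evaluation at the elements of W (these span the dual of V).\<close>

definition weakly_L2_to_zero :: "'w set \<Rightarrow> (nat \<Rightarrow> real \<Rightarrow> 'w \<Rightarrow> complex) \<Rightarrow> bool" where
  "weakly_L2_to_zero W F \<longleftrightarrow>
     (\<forall>n. \<forall>\<omega>\<in>W. (\<lambda>\<beta>. F n \<beta> \<omega>) \<in> L2_unit) \<and>
     (\<forall>h\<in>(L2_unit :: (real \<Rightarrow> complex) set). \<forall>\<omega>\<in>W.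
        (\<lambda>n. LINT \<beta>|lebesgue_on {0..1}. F n \<beta> \<omega> * h \<beta>) \<longlonglongrightarrow> 0)"

end

theory Submission
  imports Defs "HOL-Real_Asymp.Real_Asymp"
begin

text \<open>
  Write \<open>\<Gamma>\<close> for the preimage of \<open>G0\<close> in SL(2,Z).  The symbol attached to the i-th pair of convergents is
  \<open>{g \<infinity>, g 0}\<close>, where g is the product of the matrices (0, 1; 1, k) over the first i partial
  quotients.  Evaluated on a fixed differential it depends only on the coset \<open>\<Gamma> g\<close>, so it is a function F of
  a state which moves in a finite set, each partial quotient k acting by the permutation
  \<open>\<Gamma> g \<mapsto> \<Gamma> g (0, 1; 1, k)\<close> (\<open>modular_symbol_eq_coset_symbol\<close>).  Right multiplication by
  (0, 1; 1, 0) exchanges \<open>\<infinity>\<close> and 0, hence changes the sign of the symbol, and it permutes the states that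
  occur.  So the sum of F over these states is 0 (\<open>sum_coset_symbol\<close>).

  The rest is a statement about continued fractions and such an F (\<open>F_average_weakly_0\<close>).  Given the
  first n partial quotients, the remainder \<open>y = gauss_map^n \<beta>\<close> has density \<open>(1 + s) / (1 + s y)^2\<close> on [0,1]
  with \<open>s = q_(n-1) / q_n\<close>, and the next partial quotient is k with a probability \<open>p_k(s)\<close>, after which s becomes
  \<open>1 / (k + s)\<close>.  Thus (s, state) is a Markov chain.  Let \<open>u_i(s, x)\<close> be the expected value of F after i
  steps from (s, x).  The \<open>u_i\<close> are uniformly Lipschitz in s, so by the theorem of Arzela and Ascoli every
  subsequence of their Cesaro means has a subsequence with a continuous limit v, and v is harmonic for the chain.  By
  the maximum principle the set of points where v is maximal is closed under all steps of the chain.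
  Every state can be reached, and repeating the partial quotient 1 moves s to the golden ratio conjugate
  while the state returns periodically; so v takes its maximum at this value of s for every state, and likewise its minimum.
  Hence v is constant (\<open>harmonic_eq_0\<close>).  Since the steps permute the states, the sum of v over the
  states is 0, so \<open>v = 0\<close>.

  This is the convergence for the densities above.  Restricting them to an interval with an end point c
  and splitting off the first partial quotient reproduces the same problem for the interval with end point
  \<open>gauss_map c\<close>, with a factor of at most 1/2 (\<open>cesaro_from_recursion\<close>); so the convergence also holds on
  intervals, hence on measurable sets and against all integrable functions (\<open>averages_to_0_integrable\<close>).

  On the geometric side, no convergence of integrals is needed: an oriented geodesic between two distinct cusps is
  unique up to a shift of its parameter, and the two properties of the symbol used above, its dependence on the
  coset only and its change of sign, compare integrals that agree up to a substitution.  The pullback f(z) dz of a differential is invariant under \<open>\<Gamma>\<close>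
  at every non-elliptic point (\<open>pullback_automorphic\<close>), and a geodesic meets only countably many elliptic
  points.
\<close>

(* The symbol denotes the entries of matrices only. *)
no_notation fps_nth (infixl "$" 75)

section \<open>Densities of the remainder of a continued fraction\<close>

lemma gauss_map_measurable [measurable]: "gauss_map \<in> borel_measurable borel"
  unfolding gauss_map_def frac_def by measurable

lemma first_digit_measurable [measurable]:
  "(\<lambda>y::real. \<lfloor>1 / y\<rfloor>) \<in> measurable borel (count_space UNIV)"
proof -
  have "(\<lambda>y::real. real_of_int \<lfloor>1 / y\<rfloor>) \<in> borel_measurable borel"
    by measurable
  then have "(\<lambda>y::real. real_of_int \<lfloor>1 / y\<rfloor>) -` {real_of_int k} \<inter> space borel \<in> sets borel" for k
    by (rule measurable_sets) auto
  moreover have "(\<lambda>y::real. real_of_int \<lfloor>1 / y\<rfloor>) -` {real_of_int k} = (\<lambda>y. \<lfloor>1 / y\<rfloor>) -` {k}" for k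
    by auto
  ultimately have "(\<lambda>y::real. \<lfloor>1 / y\<rfloor>) -` {k} \<inter> space borel \<in> sets borel" for k
    by metis
  then show ?thesis
    by (subst measurable_count_space_eq_countable) auto
qed

text \<open>The density, on [0,1], of the remainder of a random number whose first partial quotients are given;
  the parameter s is the quotient of the last two denominators of the convergents.\<close>

definition tail_density :: "real \<Rightarrow> real \<Rightarrow> real" where
  "tail_density s y = (1 + s) / (1 + s * y)\<^sup>2"

lemma tail_density_0 [simp]: "tail_density 0 y = 1"
  by (simp add: tail_density_def)

lemma tail_density_measurable [measurable]: "tail_density s \<in> borel_measurable borel"
  unfolding tail_density_def by measurable

lemma tail_density_bounds:
  assumes "0 \<le> s" "s \<le> 1" "0 \<le> y"
  shows "0 \<le> tail_density s y" "tail_density s y \<le> 2"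
proof -
  have "1 \<le> (1 + s * y)\<^sup>2"
    using assms by (simp add: power2_eq_square algebra_simps)
  then have "(1 + s) / (1 + s * y)\<^sup>2 \<le> (1 + s) / 1"
    using assms by (intro divide_left_mono) (linarith | simp)+
  also have "(1 + s) / 1 \<le> 2" using assms by simp
  finally show "tail_density s y \<le> 2" by (simp add: tail_density_def)
  show "0 \<le> tail_density s y" using assms by (simp add: tail_density_def)
qed

lemma tail_density_lipschitz:
  assumes s: "0 \<le> s" "s \<le> 1" and t: "0 \<le> t" "t \<le> 1" and y: "0 \<le> y" "y \<le> 1"
  shows "\<bar>tail_density s y - tail_density t y\<bar> \<le> 4 * \<bar>s - t\<bar>"
proof -
  have ge1: "1 \<le> 1 + u * y" if "0 \<le> u" for u
    using that y by simp
  have sq1: "1 \<le> (1 + u * y)\<^sup>2" if "0 \<le> u" for u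
    using ge1[OF that] by (simp add: one_le_power)
  have "tail_density s y - tail_density t y
      = ((1 + s) * (1 + t * y)\<^sup>2 - (1 + t) * (1 + s * y)\<^sup>2) / ((1 + s * y)\<^sup>2 * (1 + t * y)\<^sup>2)"
    using sq1[OF s(1)] sq1[OF t(1)] unfolding tail_density_def by (subst diff_frac_eq) auto
  also have "(1 + s) * (1 + t * y)\<^sup>2 - (1 + t) * (1 + s * y)\<^sup>2
      = (s - t) * (1 - 2 * y - y\<^sup>2 * (s + t + s * t))"
    by (simp add: power2_eq_square algebra_simps)
  finally have eq: "\<bar>tail_density s y - tail_density t y\<bar> = \<bar>s - t\<bar> * \<bar>1 - 2 * y - y\<^sup>2 * (s + t + s * t)\<bar>
      / ((1 + s * y)\<^sup>2 * (1 + t * y)\<^sup>2)"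
    by (simp add: abs_mult)
  have "s * t \<le> 1" using s t by (simp add: mult_le_one)
  then have "y\<^sup>2 * (s + t + s * t) \<le> 1 * 3"
    using s t y by (intro mult_mono power_le_one) auto
  moreover have "0 \<le> y\<^sup>2 * (s + t + s * t)" using s t by simp
  ultimately have "\<bar>1 - 2 * y - y\<^sup>2 * (s + t + s * t)\<bar> \<le> 4" using y by linarith
  then have num: "\<bar>s - t\<bar> * \<bar>1 - 2 * y - y\<^sup>2 * (s + t + s * t)\<bar> \<le> \<bar>s - t\<bar> * 4"
    by (intro mult_left_mono) auto
  have den: "1 \<le> (1 + s * y)\<^sup>2 * (1 + t * y)\<^sup>2"
    using mult_mono[OF sq1[OF s(1)] sq1[OF t(1)]] by simp
  have "\<bar>tail_density s y - tail_density t y\<bar> \<le> \<bar>s - t\<bar> * \<bar>1 - 2 * y - y\<^sup>2 * (s + t + s * t)\<bar> / 1"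
    unfolding eq using den by (intro divide_left_mono) auto
  then show ?thesis using num by simp
qed

text \<open>The probability that the next partial quotient is k when the remainder has density
  \<^term>\<open>tail_density s\<close>.\<close>

definition digit_prob :: "nat \<Rightarrow> real \<Rightarrow> real" where
  "digit_prob k s = (1 + s) / ((real k + s) * (real k + 1 + s))"

lemma digit_prob_pos: "1 \<le> k \<Longrightarrow> 0 \<le> s \<Longrightarrow> 0 < digit_prob k s"
  unfolding digit_prob_def by (auto intro!: divide_pos_pos mult_pos_pos)

lemma digit_prob_le_half:
  assumes "1 \<le> k" "0 \<le> s"
  shows "digit_prob k s \<le> 1 / 2"
proof -
  have "(1 + s) * 2 \<le> (real k + s) * (real k + 1 + s)"
    using assms by (intro mult_mono) auto
  moreover have "0 < (real k + s) * (real k + 1 + s)"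
    using assms by (intro mult_pos_pos) auto
  ultimately show ?thesis by (simp add: digit_prob_def field_simps)
qed

lemma sum_digit_prob:
  assumes "0 \<le> s"
  shows "(\<Sum>k=1..K. digit_prob k s) = 1 - (1 + s) / (real K + 1 + s)"
proof (induction K)
  case 0
  show ?case using assms by simp
next
  case (Suc K)
  define a where "a = real K + 1 + s"
  have a: "a > 0" "a + 1 > 0" using assms by (auto simp: a_def)
  have "(\<Sum>k=1..Suc K. digit_prob k s) = 1 - (1 + s) / a + (1 + s) / (a * (a + 1))"
    using Suc by (simp add: digit_prob_def a_def algebra_simps)
  also have "\<dots> = 1 - (1 + s) / (a + 1)"
    using a by (simp add: divide_simps) (simp add: algebra_simps)
  finally show ?case by (simp add: a_def algebra_simps)
qed

lemma emeasure_Ioo_finite: "emeasure lborel {a<..<b::real} < \<infinity>"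
  using emeasure_bounded_finite[of "box a b"] by (simp add: box_real)

lemma set_integrable_bounded_interval:
  fixes f :: "real \<Rightarrow> real"
  assumes "f \<in> borel_measurable borel" "\<And>y. \<bar>f y\<bar> \<le> M"
  shows "set_integrable lborel {a<..<b} f"
  unfolding set_integrable_def
  by (rule integrableI_bounded_set_indicator[where B = M])
     (use assms emeasure_Ioo_finite in auto)

lemma digit_branch_substitution:
  fixes f :: "real \<Rightarrow> real"
  assumes k: "1 \<le> k" and ab: "0 \<le> a" "a \<le> b"
    and f: "f \<in> borel_measurable borel" "\<And>y. \<bar>f y\<bar> \<le> M"
  shows "(LBINT y=1/(real k + b)..1/(real k + a). f y)
       = (LBINT y=a..b. f (1 / (real k + y)) / (real k + y)\<^sup>2)"
proof -
  let ?S = "{a<..<b}" and ?g = "\<lambda>y. 1 / (real k + y)" and ?g' = "\<lambda>y. - 1 / (real k + y)\<^sup>2"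
  have pos: "0 < real k + y" if "a \<le> y" for y
    using that k ab by linarith
  have le: "1 / (real k + b) \<le> 1 / (real k + a)"
    using pos[of a] pos[of b] ab by (simp add: frac_le)
  have img: "?g ` ?S = {1/(real k + b)<..<1/(real k + a)}"
  proof (intro equalityI subsetI)
    fix x assume "x \<in> ?g ` ?S"
    then obtain y where "a < y" "y < b" "x = ?g y" by auto
    then show "x \<in> {1/(real k + b)<..<1/(real k + a)}"
      using pos[of a] pos[of y] by (auto intro!: divide_strict_left_mono)
  next
    fix x assume x: "x \<in> {1/(real k + b)<..<1/(real k + a)}"
    have x0: "0 < x" using x pos[of b] ab by (auto intro: less_trans[of 0 "1 / (real k + b)"])
    have "1 / x - real k \<in> ?S"
      using x x0 pos[of a] pos[of b] ab by (auto simp: field_simps)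
    moreover have "x = ?g (1 / x - real k)" using x0 by simp
    ultimately show "x \<in> ?g ` ?S" by blast
  qed
  have inj: "inj_on ?g ?S"
    using pos by (auto simp: inj_on_def)
  have der: "(?g has_real_derivative ?g' x) (at x within ?S)" if "x \<in> ?S" for x
    using pos[of x] that by (auto intro!: derivative_eq_intros simp: power2_eq_square)
  have intf: "set_integrable lborel (?g ` ?S) f"
    unfolding img using f by (rule set_integrable_bounded_interval)
  have "f absolutely_integrable_on (?g ` ?S)"
    using intf unfolding set_integrable_def by (rule integrable_completion[THEN iffD2, rotated])
      (use intf in \<open>auto simp: set_integrable_def\<close>)
  then have *: "(\<lambda>x. \<bar>?g' x\<bar> * f (?g x)) absolutely_integrable_on ?S \<and>
     integral ?S (\<lambda>x. \<bar>?g' x\<bar> * f (?g x)) = integral (?g ` ?S) f"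
    by (subst has_absolute_integral_change_of_variables_1'[OF _ der inj]) auto
  have g'eq: "\<bar>?g' x\<bar> * f (?g x) = f (?g x) / (real k + x)\<^sup>2" for x
    by simp
  have meas: "(\<lambda>y. f (1 / (real k + y)) / (real k + y)\<^sup>2) \<in> borel_measurable borel"
    using f(1) by measurable
  have "set_integrable lborel ?S (\<lambda>y. f (1 / (real k + y)) / (real k + y)\<^sup>2)"
  proof -
    have "(\<lambda>y. indicator ?S y *\<^sub>R (f (1 / (real k + y)) / (real k + y)\<^sup>2)) \<in> borel_measurable borel"
      using meas by measurable
    then show ?thesis
      using *[THEN conjunct1] unfolding g'eq set_integrable_def
      by (subst (asm) integrable_completion) (auto simp del: scaleR_conv_of_real real_scaleR_def)
  qed
  then have "(LBINT y:?S. f (1 / (real k + y)) / (real k + y)\<^sup>2) = integral (?g ` ?S) f"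
    using *[THEN conjunct2] unfolding g'eq by (simp add: set_borel_integral_eq_integral)
  also have "\<dots> = (LBINT y:?g ` ?S. f y)"
    using intf by (simp add: set_borel_integral_eq_integral)
  finally show ?thesis
    unfolding img using le ab
    by (simp add: interval_integral_Ioo)
qed

section \<open>A finite set of states driven by the digits\<close>

text \<open>A finite set of states on which the partial quotients act by permutations.  The action is
  irreducible: no proper nonempty set of states is preserved by all partial quotients.  The function F of
  the state has mean value 0.\<close>

locale digit_action =
  fixes X :: "'x set" and T :: "int \<Rightarrow> 'x \<Rightarrow> 'x" and F :: "'x \<Rightarrow> real"
  assumes finite_X: "finite X" and X_nonempty: "X \<noteq> {}"
    and bij_T: "\<And>k. bij_betw (T k) X X"
    and irreducible: "\<And>A. A \<subseteq> X \<Longrightarrow> A \<noteq> {} \<Longrightarrow> (\<And>k x. 1 \<le> k \<Longrightarrow> x \<in> A \<Longrightarrow> T k x \<in> A) \<Longrightarrow> A = X"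
    and sum_F: "sum F X = 0"
begin

lemma T_in_X: "x \<in> X \<Longrightarrow> T k x \<in> X"
  using bij_T bij_betwE by metis

text \<open>The state reached from x after the first n partial quotients of y have acted, in their order.\<close>

primrec digit_state :: "nat \<Rightarrow> 'x \<Rightarrow> real \<Rightarrow> 'x" where
  "digit_state 0 x y = x"
| "digit_state (Suc n) x y = digit_state n (T \<lfloor>1 / y\<rfloor> x) (gauss_map y)"

lemma digit_state_in_X: "x \<in> X \<Longrightarrow> digit_state n x y \<in> X"
  by (induction n arbitrary: x y) (auto intro: T_in_X)

lemma bij_digit_state: "bij_betw (\<lambda>x. digit_state n x y) X X"
proof (induction n arbitrary: y)
  case 0
  show ?case by (simp add: bij_betw_id[unfolded id_def])
next
  case (Suc n)
  show ?case using bij_betw_trans[OF bij_T Suc] by (simp add: o_def)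
qed

text \<open>A crude bound for the absolute value of F on the states.\<close>

definition F_bound :: real where "F_bound = (\<Sum>x\<in>X. \<bar>F x\<bar>)"

lemma F_le_bound: "x \<in> X \<Longrightarrow> \<bar>F x\<bar> \<le> F_bound"
  unfolding F_bound_def using finite_X by (intro member_le_sum) auto

lemma F_bound_nonneg: "0 \<le> F_bound"
  unfolding F_bound_def by (intro sum_nonneg) auto

lemma digit_state_measurable:
  "x \<in> X \<Longrightarrow> (\<lambda>y. F (digit_state n x y)) \<in> borel_measurable borel"
proof (induction n arbitrary: x)
  case 0
  show ?case by simp
next
  case (Suc n)
  have IH [measurable]: "(\<lambda>y. F (digit_state n z y)) \<in> borel_measurable borel" if "z \<in> X" for z
    using Suc.IH that .
  have eq: "F (digit_state (Suc n) x y)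
      = (\<Sum>z\<in>X. if T \<lfloor>1 / y\<rfloor> x = z then F (digit_state n z (gauss_map y)) else 0)" for y
    using finite_X T_in_X[OF Suc.prems] by (simp add: sum.delta')
  have "(\<lambda>y. if T \<lfloor>1 / y\<rfloor> x = z then F (digit_state n z (gauss_map y)) else 0) \<in> borel_measurable borel"
    if "z \<in> X" for z
  proof -
    note IH[OF that, measurable]
    have [measurable]: "(\<lambda>y::real. T \<lfloor>1 / y\<rfloor> x = z) \<in> measurable borel (count_space UNIV)"
      by (rule measurable_compose[OF first_digit_measurable, of "\<lambda>k. T k x = z"]) simp
    show ?thesis by measurable
  qed
  then show ?case unfolding eq by (intro borel_measurable_sum)
qed

text \<open>The value of F after n partial quotients, integrated against the density with parameter s over an
  interval.  For the interval [0,1] it is the expectation \<open>u_n(s, x)\<close>.\<close>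

definition weighted_int :: "nat \<Rightarrow> real \<Rightarrow> 'x \<Rightarrow> real \<Rightarrow> real \<Rightarrow> real" where
  "weighted_int n s x a b = (LBINT y=a..b. F (digit_state n x y) * tail_density s y)"

lemma weighted_int_integrable:
  assumes "x \<in> X" "0 \<le> s" "s \<le> 1" "0 \<le> a"
  shows "set_integrable lborel {a<..<b} (\<lambda>y. F (digit_state n x y) * tail_density s y)"
  unfolding set_integrable_def
proof (rule integrableI_bounded_set_indicator[where B = "F_bound * 2"])
  show "(\<lambda>y. F (digit_state n x y) * tail_density s y) \<in> borel_measurable lborel"
    using digit_state_measurable[OF assms(1), of n] by simp
  show "AE y in lborel. y \<in> {a<..<b} \<longrightarrow> norm (F (digit_state n x y) * tail_density s y) \<le> F_bound * 2"
    using F_le_bound[OF digit_state_in_X[OF assms(1)]] tail_density_bounds[of s] F_bound_nonneg assms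
    by (auto simp: abs_mult intro!: mult_mono)
qed (use emeasure_Ioo_finite in auto)

lemma weighted_int_eq: "a \<le> b \<Longrightarrow> weighted_int n s x a b = (LBINT y:{a<..<b}. F (digit_state n x y) * tail_density s y)"
  unfolding weighted_int_def by (simp add: interval_integral_Ioo)

lemma weighted_int_add:
  assumes "x \<in> X" "0 \<le> s" "s \<le> 1" "0 \<le> a" "a \<le> b" "b \<le> c"
  shows "weighted_int n s x a c = weighted_int n s x a b + weighted_int n s x b c"
  unfolding weighted_int_def
  by (rule interval_integral_sum[symmetric])
     (use assms weighted_int_integrable[OF assms(1-4), of c] in
       \<open>simp add: interval_lebesgue_integrable_def einterval_eq min_def max_def\<close>)

lemma weighted_int_bound:
  assumes "x \<in> X" "0 \<le> s" "s \<le> 1" "0 \<le> a" "a \<le> b"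
  shows "\<bar>weighted_int n s x a b\<bar> \<le> 2 * F_bound * (b - a)"
proof -
  have "\<bar>weighted_int n s x a b\<bar> \<le> (LBINT y:{a<..<b}. \<bar>F (digit_state n x y) * tail_density s y\<bar>)"
    unfolding weighted_int_eq[OF assms(5)] set_lebesgue_integral_def
    by (rule order_trans[OF integral_abs_bound]) (simp add: abs_mult)
  also have "\<dots> \<le> (LBINT y:{a<..<b}. F_bound * 2)"
  proof (intro set_integral_mono set_integrable_abs weighted_int_integrable assms)
    show "set_integrable lborel {a<..<b} (\<lambda>y::real. F_bound * 2)"
      by (rule set_integrable_bounded_interval) auto
    show "\<bar>F (digit_state n x y) * tail_density s y\<bar> \<le> F_bound * 2" if "y \<in> {a<..<b}" for y
      using F_le_bound[OF digit_state_in_X[OF assms(1)]] tail_density_bounds[of s y] F_bound_nonneg assms that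
      by (auto simp: abs_mult intro!: mult_mono)
  qed
  also have "\<dots> = 2 * F_bound * (b - a)"
    using assms by (simp add: set_lebesgue_integral_def)
  finally show ?thesis .
qed

lemma weighted_int_lipschitz:
  assumes "x \<in> X" "0 \<le> s" "s \<le> 1" "0 \<le> t" "t \<le> 1"
  shows "\<bar>weighted_int n s x 0 1 - weighted_int n t x 0 1\<bar> \<le> 4 * F_bound * \<bar>s - t\<bar>"
proof -
  have i: "set_integrable lborel {0<..<1} (\<lambda>y. F (digit_state n x y) * tail_density s y)"
          "set_integrable lborel {0<..<1} (\<lambda>y. F (digit_state n x y) * tail_density t y)"
    using assms by (auto intro: weighted_int_integrable)
  have "weighted_int n s x 0 1 - weighted_int n t x 0 1
      = (LBINT y:{0<..<1}. F (digit_state n x y) * tail_density s y - F (digit_state n x y) * tail_density t y)"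
    using i by (simp add: weighted_int_eq set_integral_diff)
  also have "\<bar>\<dots>\<bar> \<le> (LBINT y:{0<..<1}. \<bar>F (digit_state n x y) * tail_density s y - F (digit_state n x y) * tail_density t y\<bar>)"
    unfolding set_lebesgue_integral_def
    by (rule order_trans[OF integral_abs_bound]) (simp add: abs_mult)
  also have "\<dots> \<le> (LBINT y:{0<..<1::real}. F_bound * (4 * \<bar>s - t\<bar>))"
  proof (intro set_integral_mono set_integrable_abs set_integral_diff i)
    show "set_integrable lborel {0<..<1} (\<lambda>y::real. F_bound * (4 * \<bar>s - t\<bar>))"
      by (rule set_integrable_bounded_interval) auto
    fix y :: real assume y: "y \<in> {0<..<1}"
    have "\<bar>F (digit_state n x y) * tail_density s y - F (digit_state n x y) * tail_density t y\<bar> = \<bar>F (digit_state n x y)\<bar> * \<bar>tail_density s y - tail_density t y\<bar>"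
      by (simp add: abs_mult flip: right_diff_distrib)
    also have "\<dots> \<le> F_bound * (4 * \<bar>s - t\<bar>)"
      using F_le_bound[OF digit_state_in_X[OF assms(1)]] tail_density_lipschitz[of s t y] y F_bound_nonneg assms
      by (intro mult_mono) auto
    finally show "\<bar>F (digit_state n x y) * tail_density s y - F (digit_state n x y) * tail_density t y\<bar> \<le> F_bound * (4 * \<bar>s - t\<bar>)" .
  qed
  also have "\<dots> = 4 * F_bound * \<bar>s - t\<bar>"
    by (simp add: set_lebesgue_integral_def)
  finally show ?thesis .
qed

lemma sum_weighted_int:
  assumes "0 \<le> s" "s \<le> 1"
  shows "(\<Sum>x\<in>X. weighted_int n s x 0 1) = 0"
proof -
  have "(\<Sum>x\<in>X. weighted_int n s x 0 1) = (LBINT y:{0<..<1}. \<Sum>x\<in>X. F (digit_state n x y) * tail_density s y)"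
    using assms weighted_int_integrable[of _ s 0 1 n] unfolding weighted_int_eq[of 0 1, simplified]
      set_lebesgue_integral_def set_integrable_def scaleR_sum_right
    by (subst Bochner_Integration.integral_sum) auto
  also have "(\<lambda>y. \<Sum>x\<in>X. F (digit_state n x y) * tail_density s y) = (\<lambda>y. 0)"
    using sum.reindex_bij_betw[OF bij_digit_state, of F n] sum_F by (simp flip: sum_distrib_right)
  finally show ?thesis by simp
qed

text \<open>The substitution \<open>y \<mapsto> 1 / (k + y)\<close> maps [a,b] onto an interval of numbers with first partial quotient k.
  It turns the density with parameter s into a multiple of the one with parameter \<open>1 / (k + s)\<close>.\<close>

lemma weighted_int_branch:
  assumes x: "x \<in> X" and s: "0 \<le> s" "s \<le> 1" and k: "1 \<le> k" and ab: "0 \<le> a" "a \<le> b" "b \<le> 1"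
  shows "weighted_int (Suc n) s x (1 / (real k + b)) (1 / (real k + a))
       = digit_prob k s * weighted_int n (1 / (real k + s)) (T (int k) x) a b"
proof -
  let ?f = "\<lambda>y. indicator {0..1} y * (F (digit_state (Suc n) x y) * tail_density s y)"
  have pos: "0 < real k + y" "1 \<le> real k + y" if "0 \<le> y" for y
    using that k by linarith+
  have le: "1 / (real k + b) \<le> 1 / (real k + a)"
    using pos(1)[of a] pos(1)[of b] ab by (simp add: frac_le)
  have le1: "1 / (real k + a) \<le> 1" "0 \<le> 1 / (real k + b)"
    using pos(1)[of b] pos(2)[of a] ab by auto
  have meas: "?f \<in> borel_measurable borel"
    using digit_state_measurable[OF x, of "Suc n"] by measurable
  have bnd: "\<bar>?f y\<bar> \<le> F_bound * 2" for y
    using F_le_bound[OF digit_state_in_X[OF x], of "Suc n" y] tail_density_bounds[of s y] F_bound_nonneg s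
    by (auto simp: indicator_def abs_mult simp del: digit_state.simps intro!: mult_mono)
  have unit: "y \<in> {0..1}" if "1 / (real k + b) < y" "y < 1 / (real k + a)" for y
    unfolding atLeastAtMost_iff using that le1 by linarith
  have "weighted_int (Suc n) s x (1 / (real k + b)) (1 / (real k + a))
      = (LBINT y=1/(real k + b)..1/(real k + a). ?f y)"
    unfolding weighted_int_def using le unit
    by (intro interval_integral_cong)
       (auto simp: einterval_eq min_def max_def simp del: digit_state.simps atLeastAtMost_iff)
  also have "\<dots> = (LBINT y=a..b. ?f (1 / (real k + y)) / (real k + y)\<^sup>2)"
    by (rule digit_branch_substitution[OF k ab(1,2) meas bnd])
  also have "\<dots> = (LBINT y=a..b. digit_prob k s * (F (digit_state n (T (int k) x) y) * tail_density (1 / (real k + s)) y))"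
  proof (rule interval_integral_cong)
    fix y assume "y \<in> einterval (min (ereal a) (ereal b)) (max (ereal a) (ereal b))"
    then have y: "a < y" "y < b" using ab by (auto simp: einterval_eq min_def max_def split: if_splits)
    then have y01: "0 < y" "y < 1" using ab by auto
    have fl: "\<lfloor>real k + y\<rfloor> = int k" using y01 by (simp add: floor_unique)
    have g: "gauss_map (1 / (real k + y)) = y" using y01 fl by (simp add: gauss_map_def frac_def)
    define u where "u = real k + s" define w where "w = real k + y"
    have u: "u > 0" and w: "w > 0" using pos(1) s y01 unfolding u_def w_def by auto
    have uw: "w + s > 0" using w s by simp
    have 1: "tail_density s (1 / w) / w\<^sup>2 = (1 + s) / (w + s)\<^sup>2"
      using w uw unfolding tail_density_def by (simp add: field_simps)
    have ws: "u + y = w + s" by (simp add: u_def w_def)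
    have "1 + (1 / u) * y = (w + s) / u" unfolding ws[symmetric] using u by (simp add: field_simps)
    then have 2: "tail_density (1 / u) y = ((u + 1) / u) / ((w + s) / u)\<^sup>2"
      using u by (simp add: tail_density_def field_simps)
    have "digit_prob k s * tail_density (1 / u) y = (1 + s) / (w + s)\<^sup>2"
    proof -
      have dp: "digit_prob k s = (1 + s) / (u * (u + 1))"
        by (simp add: digit_prob_def u_def algebra_simps)
      have "u + 1 \<noteq> 0" using u by simp
      then show ?thesis unfolding 2 dp using u uw by (simp add: power_divide power2_eq_square)
    qed
    with 1 have "tail_density s (1 / w) / w\<^sup>2 = digit_prob k s * tail_density (1 / u) y" by simp
    moreover have "indicator {0..1} (1 / w) = (1::real)"
      using pos[of y] y01 by (simp add: w_def)
    moreover have "z * tail_density s (1 / w) / w\<^sup>2 = digit_prob k s * (z * tail_density (1 / u) y)" for z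
      using calculation(1) by (metis mult.left_commute times_divide_eq_right)
    ultimately show "?f (1 / (real k + y)) / (real k + y)\<^sup>2
        = digit_prob k s * (F (digit_state n (T (int k) x) y) * tail_density (1 / (real k + s)) y)"
      using fl g by (simp add: u_def w_def)
  qed
  also have "\<dots> = digit_prob k s * weighted_int n (1 / (real k + s)) (T (int k) x) a b"
    unfolding weighted_int_def by simp
  finally show ?thesis .
qed

text \<open>The numbers in (1/(K+1), 1) are, up to a null set, those whose first partial quotient is at most K.\<close>

lemma weighted_int_branches:
  assumes x: "x \<in> X" and s: "0 \<le> s" "s \<le> 1"
  shows "weighted_int (Suc n) s x (1 / (real K + 1)) 1
       = (\<Sum>k=1..K. digit_prob k s * weighted_int n (1 / (real k + s)) (T (int k) x) 0 1)"
proof (induction K)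
  case 0
  show ?case by (simp add: weighted_int_def)
next
  case (Suc K)
  have "weighted_int (Suc n) s x (1 / (real (Suc K) + 1)) 1
      = weighted_int (Suc n) s x (1 / (real (Suc K) + 1)) (1 / (real K + 1)) + weighted_int (Suc n) s x (1 / (real K + 1)) 1"
    using x s by (intro weighted_int_add) (auto simp: field_simps)
  also have "weighted_int (Suc n) s x (1 / (real (Suc K) + 1)) (1 / (real K + 1))
      = digit_prob (Suc K) s * weighted_int n (1 / (real (Suc K) + s)) (T (int (Suc K)) x) 0 1"
    using weighted_int_branch[OF x s, of "Suc K" 0 1 n] by (simp add: add.commute)
  finally show ?case using Suc.IH by (simp add: add.commute)
qed

end

section \<open>The Cesaro means and their harmonic limits\<close>

context digit_action begin

text \<open>For n = 0 this is 0, by division by zero.\<close>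

definition cesaro :: "nat \<Rightarrow> real \<Rightarrow> 'x \<Rightarrow> real" where
  "cesaro n s x = (\<Sum>i<n. weighted_int i s x 0 1) / real n"

lemma cesaro_bound:
  assumes "x \<in> X" "0 \<le> s" "s \<le> 1"
  shows "\<bar>cesaro n s x\<bar> \<le> 2 * F_bound"
proof (cases "n = 0")
  case False
  have "\<bar>\<Sum>i<n. weighted_int i s x 0 1\<bar> \<le> (\<Sum>i<n. 2 * F_bound)"
    using weighted_int_bound[OF assms, of 0 1] by (intro order_trans[OF sum_abs] sum_mono) simp
  then show ?thesis using False by (simp add: cesaro_def field_simps)
qed (use F_bound_nonneg in \<open>simp add: cesaro_def\<close>)

lemma cesaro_lipschitz:
  assumes "x \<in> X" "0 \<le> s" "s \<le> 1" "0 \<le> t" "t \<le> 1"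
  shows "\<bar>cesaro n s x - cesaro n t x\<bar> \<le> 4 * F_bound * \<bar>s - t\<bar>"
proof (cases "n = 0")
  case False
  have "\<bar>\<Sum>i<n. weighted_int i s x 0 1 - weighted_int i t x 0 1\<bar> \<le> (\<Sum>i<n. 4 * F_bound * \<bar>s - t\<bar>)"
    using weighted_int_lipschitz[OF assms] by (intro order_trans[OF sum_abs] sum_mono) simp
  then have "\<bar>\<Sum>i<n. weighted_int i s x 0 1 - weighted_int i t x 0 1\<bar> / real n \<le> 4 * F_bound * \<bar>s - t\<bar>"
    using False by (simp add: field_simps)
  then show ?thesis
    by (simp only: cesaro_def sum_subtractf diff_divide_distrib[symmetric] abs_divide abs_of_nat)
qed (use F_bound_nonneg in \<open>simp add: cesaro_def\<close>)

lemma sum_cesaro: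
  assumes "0 \<le> s" "s \<le> 1"
  shows "(\<Sum>x\<in>X. cesaro n s x) = 0"
  unfolding cesaro_def sum_divide_distrib[symmetric]
  by (subst sum.swap) (simp add: sum_weighted_int assms)

text \<open>The Cesaro means satisfy the mean value equation of the Markov chain up to an error of order 1/n, from
  the shift of the index, and one of order 1/K, from the partial quotients beyond K.\<close>

lemma cesaro_almost_harmonic:
  assumes x: "x \<in> X" and s: "0 \<le> s" "s \<le> 1" and n: "n \<noteq> 0"
  shows "\<bar>cesaro n s x - (\<Sum>k=1..K. digit_prob k s * cesaro n (1 / (real k + s)) (T (int k) x))\<bar>
       \<le> 4 * F_bound / real n + 2 * F_bound / (real K + 1)"
proof -
  let ?P = "\<lambda>i. \<Sum>k=1..K. digit_prob k s * weighted_int i (1 / (real k + s)) (T (int k) x) 0 1"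
  have d: "\<bar>weighted_int (Suc i) s x 0 1 - ?P i\<bar> \<le> 2 * F_bound / (real K + 1)" for i
  proof -
    have "weighted_int (Suc i) s x 0 1 = weighted_int (Suc i) s x 0 (1 / (real K + 1)) + weighted_int (Suc i) s x (1 / (real K + 1)) 1"
      using x s by (intro weighted_int_add) auto
    then have "weighted_int (Suc i) s x 0 1 - ?P i = weighted_int (Suc i) s x 0 (1 / (real K + 1))"
      using weighted_int_branches[OF x s, of i K] by simp
    then show ?thesis using weighted_int_bound[OF x s, of 0 "1 / (real K + 1)" "Suc i"] by simp
  qed
  have tel: "(\<Sum>i<n. weighted_int i s x 0 1 - weighted_int (Suc i) s x 0 1) = weighted_int 0 s x 0 1 - weighted_int n s x 0 1"
    by (rule sum_lessThan_telescope')
  have split: "(\<Sum>i<n. weighted_int i s x 0 1) - (\<Sum>i<n. ?P i)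
      = (\<Sum>i<n. weighted_int i s x 0 1 - weighted_int (Suc i) s x 0 1) + (\<Sum>i<n. weighted_int (Suc i) s x 0 1 - ?P i)"
    by (simp add: sum_subtractf)
  have b1: "\<bar>weighted_int 0 s x 0 1 - weighted_int n s x 0 1\<bar> \<le> 4 * F_bound"
    using weighted_int_bound[OF x s, of 0 1 0] weighted_int_bound[OF x s, of 0 1 n] by simp
  have b2: "\<bar>\<Sum>i<n. weighted_int (Suc i) s x 0 1 - ?P i\<bar> \<le> (\<Sum>i<n. 2 * F_bound / (real K + 1))"
    by (rule order_trans[OF sum_abs], rule sum_mono, rule d)
  have *: "\<bar>(\<Sum>i<n. weighted_int i s x 0 1) - (\<Sum>i<n. ?P i)\<bar> \<le> 4 * F_bound + real n * (2 * F_bound / (real K + 1))"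
    unfolding split tel using order_trans[OF abs_triangle_ineq add_mono[OF b1 b2]]
    by (simp only: sum_constant card_lessThan)
  have "(\<Sum>k=1..K. digit_prob k s * cesaro n (1 / (real k + s)) (T (int k) x))
      = (\<Sum>k=1..K. (\<Sum>i<n. digit_prob k s * weighted_int i (1 / (real k + s)) (T (int k) x) 0 1) / real n)"
    by (simp only: cesaro_def sum_distrib_left times_divide_eq_right)
  also have "\<dots> = (\<Sum>i<n. ?P i) / real n"
    unfolding sum_divide_distrib[symmetric] by (subst sum.swap) (rule refl)
  finally have "(\<Sum>k=1..K. digit_prob k s * cesaro n (1 / (real k + s)) (T (int k) x)) = (\<Sum>i<n. ?P i) / real n" .
  then have "cesaro n s x - (\<Sum>k=1..K. digit_prob k s * cesaro n (1 / (real k + s)) (T (int k) x))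
      = ((\<Sum>i<n. weighted_int i s x 0 1) - (\<Sum>i<n. ?P i)) / real n"
    by (simp only: cesaro_def diff_divide_distrib)
  then have "\<bar>cesaro n s x - (\<Sum>k=1..K. digit_prob k s * cesaro n (1 / (real k + s)) (T (int k) x))\<bar>
      = \<bar>(\<Sum>i<n. weighted_int i s x 0 1) - (\<Sum>i<n. ?P i)\<bar> / real n"
    by (simp only: abs_divide abs_of_nat)
  also have "\<dots> \<le> (4 * F_bound + real n * (2 * F_bound / (real K + 1))) / real n"
    using * by (rule divide_right_mono) simp
  also have "\<dots> = 4 * F_bound / real n + 2 * F_bound / (real K + 1)"
    using n by (simp add: add_divide_distrib)
  finally show ?thesis .
qed

lemma T_periodic:
  assumes "x \<in> X"
  obtains m where "m > 0" "(T k ^^ m) x = x"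
proof -
  have inX: "(T k ^^ n) z \<in> X" if "z \<in> X" for n z
    using that by (induction n) (auto intro: T_in_X)
  have inj: "inj_on (T k ^^ n) X" for n
    using bij_betw_funpow[OF bij_T] bij_betw_imp_inj_on by blast
  have "\<not> inj (\<lambda>n. (T k ^^ n) x)"
    using finite_subset[OF _ finite_X, of "range (\<lambda>n. (T k ^^ n) x)"] inX[OF assms]
      finite_imageD[of "\<lambda>n. (T k ^^ n) x" UNIV] by auto
  then obtain i' j' where ij': "i' \<noteq> j'" "(T k ^^ i') x = (T k ^^ j') x"
    by (auto simp: inj_def)
  define i j where "i = min i' j'" and "j = max i' j'"
  have ij: "i < j" "(T k ^^ j) x = (T k ^^ i) x"
    using ij' by (auto simp: i_def j_def min_def max_def)
  have "(T k ^^ i) ((T k ^^ (j - i)) x) = (T k ^^ (i + (j - i))) x"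
    by (simp only: funpow_add comp_apply)
  also have "\<dots> = (T k ^^ i) x" using ij by simp
  finally have "(T k ^^ i) ((T k ^^ (j - i)) x) = (T k ^^ i) x" .
  then have "(T k ^^ (j - i)) x = x"
    using inj_onD[OF inj] inX assms by blast
  then show ?thesis using that[of "j - i"] ij by simp
qed

text \<open>The number with all partial quotients equal to 1, the fixed point of \<open>s \<mapsto> 1 / (1 + s)\<close>.\<close>

definition golden :: real where "golden = (sqrt 5 - 1) / 2"

lemma golden: "0 < golden" "golden < 1" "1 / (1 + golden) = golden"
proof -
  have "2 < sqrt 5" "sqrt 5 < 3" by (auto intro: real_less_rsqrt real_less_lsqrt)
  then show "0 < golden" "golden < 1" by (auto simp: golden_def)
  have "golden * (1 + golden) = 1" by (simp add: golden_def field_simps)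
  then show "1 / (1 + golden) = golden" using \<open>0 < golden\<close> by (simp add: field_simps)
qed

lemma golden_limit:
  assumes "0 \<le> s" "s \<le> 1"
  shows "((\<lambda>s. 1 / (1 + s)) ^^ n) s \<in> {0..1}"
    and "(\<lambda>n. ((\<lambda>s. 1 / (1 + s)) ^^ n) s) \<longlonglongrightarrow> golden"
proof -
  have *: "((\<lambda>s. 1 / (1 + s)) ^^ n) s \<in> {0..1} \<and>
      \<bar>((\<lambda>s. 1 / (1 + s)) ^^ n) s - golden\<bar> \<le> golden ^ n" for n
  proof (induction n)
    case 0
    show ?case using assms golden by auto
  next
    case (Suc n)
    define t where "t = ((\<lambda>s. 1 / (1 + s)) ^^ n) s"
    have t: "0 \<le> t" "t \<le> 1" "\<bar>t - golden\<bar> \<le> golden ^ n" using Suc by (auto simp: t_def)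
    have "1 / (1 + t) - golden = 1 / (1 + t) - 1 / (1 + golden)" using golden(3) by simp
    also have "\<dots> = - (t - golden) * (1 / (1 + t)) * (1 / (1 + golden))"
      using t golden(1) by (simp add: divide_simps)
    finally have "\<bar>1 / (1 + t) - golden\<bar> = \<bar>t - golden\<bar> * (1 / (1 + t)) * golden"
      unfolding golden(3) using t golden by (simp add: abs_mult)
    also have "\<dots> \<le> golden ^ n * 1 * golden"
      using t golden by (intro mult_mono) auto
    finally show ?case using t by (simp add: t_def mult.commute)
  qed
  then show "((\<lambda>s. 1 / (1 + s)) ^^ n) s \<in> {0..1}" by blast
  have "(\<lambda>n. golden ^ n) \<longlonglongrightarrow> 0" using golden by (intro LIMSEQ_realpow_zero) auto
  then have "(\<lambda>n. ((\<lambda>s. 1 / (1 + s)) ^^ n) s - golden) \<longlonglongrightarrow> 0"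
    by (rule Lim_null_comparison[rotated]) (use * in auto)
  then show "(\<lambda>n. ((\<lambda>s. 1 / (1 + s)) ^^ n) s) \<longlonglongrightarrow> golden"
    by (simp add: LIM_zero_iff)
qed

text \<open>Continuous functions on the state space of the Markov chain that are equal to their mean over
  the next step.  The infinite sum over the partial quotients is replaced by its partial sums with an error
  estimate, which is preserved under limits.\<close>

definition harmonic :: "(real \<Rightarrow> 'x \<Rightarrow> real) \<Rightarrow> bool" where
  "harmonic v \<longleftrightarrow> (\<forall>x\<in>X. continuous_on {0..1} (\<lambda>s. v s x)) \<and>
     (\<exists>C. \<forall>x\<in>X. \<forall>s\<in>{0..1}. \<forall>K.
        \<bar>v s x - (\<Sum>k=1..K. digit_prob k s * v (1 / (real k + s)) (T (int k) x))\<bar> \<le> C / (real K + 1))"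

text \<open>Since all step probabilities are positive, a maximum of a harmonic function is also attained
  at all successors.\<close>

lemma harmonic_max_propagates:
  assumes h: "harmonic v" and M: "\<And>s x. s \<in> {0..1} \<Longrightarrow> x \<in> X \<Longrightarrow> v s x \<le> M"
    and x: "x \<in> X" and s: "s \<in> {0..1}" and max: "v s x = M" and j: "1 \<le> j"
  shows "v (1 / (real j + s)) (T (int j) x) = M"
proof -
  obtain C where C: "\<bar>v s x - (\<Sum>k=1..K. digit_prob k s * v (1 / (real k + s)) (T (int k) x))\<bar>
      \<le> C / (real K + 1)" for K
    using h x s unfolding harmonic_def by blast
  let ?w = "\<lambda>k. v (1 / (real k + s)) (T (int k) x)"
  have w: "?w k \<le> M" if "1 \<le> k" for k
    using that s x by (intro M T_in_X) (auto simp: divide_simps)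
  have p: "0 < digit_prob k s" if "1 \<le> k" for k
    using that s by (intro digit_prob_pos) auto
  have "digit_prob j s * (M - ?w j) \<le> (C + 2 * \<bar>M\<bar>) / (real K + 1)" if K: "j \<le> K" for K
  proof -
    have jK: "j \<in> {1..K}" using j K by simp
    have "digit_prob j s * (M - ?w j) \<le> (\<Sum>k=1..K. digit_prob k s * (M - ?w k))"
      by (rule member_le_sum[OF jK]) (use w p in \<open>auto simp: less_imp_le\<close>)
    also have "\<dots> = (\<Sum>k=1..K. digit_prob k s) * M - (\<Sum>k=1..K. digit_prob k s * ?w k)"
      by (simp add: right_diff_distrib sum_subtractf sum_distrib_right)
    also have "\<dots> \<le> (\<Sum>k=1..K. digit_prob k s) * M - (M - C / (real K + 1))"
      using C[of K] max by linarith
    also have "\<dots> = C / (real K + 1) - M * ((1 + s) / (real K + 1 + s))"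
      using s by (subst sum_digit_prob) (auto simp: algebra_simps)
    also have "\<dots> \<le> C / (real K + 1) + \<bar>M\<bar> * ((1 + s) / (real K + 1 + s))"
    proof -
      have "- M * ((1 + s) / (real K + 1 + s)) \<le> \<bar>M\<bar> * ((1 + s) / (real K + 1 + s))"
        using s by (intro mult_right_mono) auto
      then show ?thesis by simp
    qed
    also have "(1 + s) / (real K + 1 + s) \<le> 2 / (real K + 1)"
      using s by (intro frac_le) auto
    finally have "digit_prob j s * (M - ?w j) \<le> C / (real K + 1) + \<bar>M\<bar> * (2 / (real K + 1))"
      by (simp add: mult_left_mono)
    then show ?thesis by (simp add: add_divide_distrib mult.commute)
  qed
  then have "\<forall>\<^sub>F K in sequentially. digit_prob j s * (M - ?w j) \<le> (C + 2 * \<bar>M\<bar>) / (real K + 1)"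
    using eventually_sequentially by blast
  moreover have "(\<lambda>K. (C + 2 * \<bar>M\<bar>) / (real K + 1)) \<longlonglongrightarrow> 0"
    by real_asymp
  ultimately have "digit_prob j s * (M - ?w j) \<le> 0"
    by (intro tendsto_lowerbound) auto
  then have "M \<le> ?w j" using p[OF j] by (simp add: mult_le_0_iff)
  then show ?thesis using w[OF j] by simp
qed

text \<open>The states at which the maximum is attained for some s form an invariant set, so
  they are all states.  From such a point the partial quotients 1, in multiples of a period of the state, lead to
  points with the same state and with s converging to \<^term>\<open>golden\<close>.\<close>

lemma harmonic_max_at_golden:
  assumes h: "harmonic v" and M: "\<And>s x. s \<in> {0..1} \<Longrightarrow> x \<in> X \<Longrightarrow> v s x \<le> M"
    and x0: "x0 \<in> X" and s0: "s0 \<in> {0..1}" and max: "v s0 x0 = M" and x: "x \<in> X"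
  shows "v golden x = M"
proof -
  have propagate: "v (1 / (real j + s)) (T (int j) y) = M"
    if "y \<in> X" "s \<in> {0..1}" "v s y = M" "1 \<le> j" for s y j
    by (rule harmonic_max_propagates[OF h _ that]) (rule M)
  have unit: "1 / (real k + s) \<in> {0..1}" if "s \<in> {0..1}" "1 \<le> k" for k s
    using that by (auto simp: divide_simps)
  let ?A = "{x \<in> X. \<exists>s\<in>{0..1}. v s x = M}"
  have "?A = X"
  proof (rule irreducible)
    show "?A \<noteq> {}" using x0 s0 max by blast
    fix k :: int and y assume k: "1 \<le> k" and "y \<in> ?A"
    then obtain s where s: "y \<in> X" "s \<in> {0..1}" "v s y = M" by blast
    have "v (1 / (real (nat k) + s)) (T (int (nat k)) y) = M"
      using s k by (intro propagate) auto
    then show "T k y \<in> ?A" using k s unit[of s "nat k"] T_in_X by auto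
  qed auto
  then obtain s where s: "s \<in> {0..1}" "v s x = M" using x by blast
  obtain m where m: "m > 0" "(T 1 ^^ m) x = x" using T_periodic[OF x] .
  let ?f = "\<lambda>s::real. 1 / (1 + s)"
  have inX: "(T 1 ^^ n) x \<in> X" for n
    using x by (induction n) (auto intro: T_in_X)
  have all: "v ((?f ^^ n) s) ((T 1 ^^ n) x) = M" for n
  proof (induction n)
    case (Suc n)
    then show ?case
      using propagate[OF inX golden_limit(1), of s n n 1] s by (simp add: add.commute)
  qed (use s in simp)
  have "(T 1 ^^ (m * j)) x = x" for j
    using m(2) by (induction j) (simp_all add: funpow_add)
  then have const: "v ((?f ^^ (m * j)) s) x = M" for j using all by metis
  have "(\<lambda>j. (?f ^^ (m * j)) s) \<longlonglongrightarrow> golden"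
    using LIMSEQ_subseq_LIMSEQ[OF golden_limit(2), of s "\<lambda>j. m * j"] s m
    by (simp add: strict_mono_def o_def)
  then have "(\<lambda>j. v ((?f ^^ (m * j)) s) x) \<longlonglongrightarrow> v golden x"
  proof (rule continuous_on_tendsto_compose[where f = "\<lambda>s. v s x", rotated])
    show "continuous_on {0..1} (\<lambda>s. v s x)" using h x by (simp add: harmonic_def)
    show "golden \<in> {0..1}" using golden by simp
    show "\<forall>\<^sub>F j in sequentially. (?f ^^ (m * j)) s \<in> {0..1}"
      using golden_limit(1) s by (intro always_eventually) auto
  qed
  then show ?thesis unfolding const by (simp add: LIMSEQ_const_iff)
qed

lemma harmonic_uminus: "harmonic v \<Longrightarrow> harmonic (\<lambda>s x. - v s x)"
proof -
  have *: "\<bar>- a - - b\<bar> = \<bar>a - b\<bar>" for a b :: real by simp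
  show "harmonic v \<Longrightarrow> harmonic (\<lambda>s x. - v s x)"
    unfolding harmonic_def mult_minus_right sum_negf * by (auto intro: continuous_on_minus)
qed

lemma harmonic_attains_sup:
  assumes h: "harmonic v"
  obtains M where "\<And>s x. s \<in> {0..1} \<Longrightarrow> x \<in> X \<Longrightarrow> v s x \<le> M" "\<And>x. x \<in> X \<Longrightarrow> v golden x = M"
proof -
  have "\<exists>s\<in>{0..1}. \<forall>t\<in>{0..1}. v t x \<le> v s x" if "x \<in> X" for x
    using h that by (intro continuous_attains_sup) (auto simp: harmonic_def)
  then obtain r where r: "\<And>x. x \<in> X \<Longrightarrow> r x \<in> {0..1}"
      "\<And>x t. x \<in> X \<Longrightarrow> t \<in> {0..1} \<Longrightarrow> v t x \<le> v (r x) x"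
    by metis
  have "finite ((\<lambda>x. v (r x) x) ` X)" "(\<lambda>x. v (r x) x) ` X \<noteq> {}"
    using finite_X X_nonempty by auto
  then have "Max ((\<lambda>x. v (r x) x) ` X) \<in> (\<lambda>x. v (r x) x) ` X" by (rule Max_in)
  then obtain x0 where x0: "x0 \<in> X" "Max ((\<lambda>x. v (r x) x) ` X) = v (r x0) x0" by blast
  have "v s x \<le> v (r x0) x0" if "s \<in> {0..1}" "x \<in> X" for s x
    using r(2)[OF that(2,1)] that finite_X unfolding x0(2)[symmetric]
    by (meson Max_ge finite_imageI imageI order_trans)
  then show ?thesis
    using that[of "v (r x0) x0"] harmonic_max_at_golden[OF h _ x0(1) r(1)[OF x0(1)] refl] by blast
qed

lemma harmonic_eq_0:
  assumes h: "harmonic v" and sum0: "(\<Sum>x\<in>X. v golden x) = 0" and "s \<in> {0..1}" "x \<in> X"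
  shows "v s x = 0"
proof -
  obtain M where M: "\<And>s x. s \<in> {0..1} \<Longrightarrow> x \<in> X \<Longrightarrow> v s x \<le> M" "\<And>x. x \<in> X \<Longrightarrow> v golden x = M"
    using harmonic_attains_sup[OF h] by blast
  obtain N where N: "\<And>s x. s \<in> {0..1} \<Longrightarrow> x \<in> X \<Longrightarrow> - v s x \<le> N" "\<And>x. x \<in> X \<Longrightarrow> - v golden x = N"
    using harmonic_attains_sup[OF harmonic_uminus[OF h]] by blast
  have "real (card X) * M = 0" using sum0 M(2) by simp
  then have "M = 0" using finite_X X_nonempty by simp
  moreover have "N = - M" using M(2) N(2) X_nonempty by fastforce
  ultimately show ?thesis using M(1)[OF assms(3,4)] N(1)[OF assms(3,4)] by simp
qed

end

context digit_action begin

text \<open>A subsequence bounded away from 0 would have a further subsequence with a harmonic limit.  For the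
  Arzela-Ascoli theorem the states are encoded as real numbers at mutual distance at least 1.\<close>

lemma cesaro_tendsto_0:
  assumes s0: "s0 \<in> {0..1}" and x0: "x0 \<in> X"
  shows "(\<lambda>n. cesaro n s0 x0) \<longlonglongrightarrow> 0"
proof (rule ccontr)
  assume "\<not> (\<lambda>n. cesaro n s0 x0) \<longlonglongrightarrow> 0"
  then obtain e where e: "e > 0" and inf: "\<And>N. \<exists>n\<ge>N. e \<le> \<bar>cesaro n s0 x0\<bar>"
    unfolding lim_sequentially dist_real_def by (force simp: not_less)
  define R where "R = {n. e \<le> \<bar>cesaro n s0 x0\<bar>}"
  have "infinite R"
    unfolding infinite_nat_iff_unbounded_le R_def using inf by blast
  then obtain r :: "nat \<Rightarrow> nat" where r: "strict_mono r" "\<And>j. r j \<in> R"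
    using infinite_enumerate by blast
  obtain f :: "'x \<Rightarrow> nat" where f: "inj_on f X"
    using finite_imp_inj_to_nat_seg[OF finite_X] by blast
  define code where "code x = real (f x)" for x
  define dec where "dec = inv_into X code"
  have inj: "inj_on code X" using f by (auto simp: inj_on_def code_def)
  have dec: "dec (code x) = x" if "x \<in> X" for x
    using inv_into_f_f[OF inj that] by (simp add: dec_def)
  let ?S = "{0..1::real} \<times> code ` X"
  let ?F = "\<lambda>j p. cesaro (r j) (fst p) (dec (snd p))"
  obtain g k where g: "continuous_on ?S g" and k: "strict_mono (k :: nat \<Rightarrow> nat)"
    and unif: "\<And>e. 0 < e \<Longrightarrow> \<exists>N. \<forall>n p. n \<ge> N \<and> p \<in> ?S \<longrightarrow> norm (?F (k n) p - g p) < e"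
  proof (rule Arzela_Ascoli[of ?S ?F "2 * F_bound"])
    show "compact ?S" by (intro compact_Times compact_Icc finite_imp_compact finite_imageI finite_X)
    show "norm (?F n p) \<le> 2 * F_bound" if "p \<in> ?S" for n p
      using that cesaro_bound[of _ "fst p" "r n"] dec by auto
    show "\<exists>d>0. \<forall>n q. q \<in> ?S \<and> norm (p - q) < d \<longrightarrow> norm (?F n p - ?F n q) < e"
      if p: "p \<in> ?S" and e: "0 < e" for p and e :: real
    proof (intro exI conjI allI impI)
      \<comment> \<open>Points at distance less than 1 have the same state.\<close>
      define d where "d = min 1 (e / (4 * F_bound + 1))"
      show "0 < d" using e F_bound_nonneg by (simp add: d_def add_nonneg_pos)
      fix n q assume q: "q \<in> ?S \<and> norm (p - q) < d"
      obtain s x where p': "p = (s, code x)" "s \<in> {0..1}" "x \<in> X" using p by auto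
      obtain t y where q': "q = (t, code y)" "t \<in> {0..1}" "y \<in> X" using q by auto
      have "\<bar>code x - code y\<bar> \<le> norm (p - q)"
        using norm_snd_le[of "code x - code y" "s - t"] p' q' by simp
      then have "\<bar>code x - code y\<bar> < 1" using q by (simp add: d_def)
      then have "code x = code y" by (simp add: code_def)
      then have xy: "x = y" using inj p' q' by (auto dest: inj_onD)
      have "\<bar>s - t\<bar> < d" using norm_fst_le[of "s - t" "code x - code y"] p' q' q by simp
      then have "\<bar>s - t\<bar> * (4 * F_bound + 1) < e"
        using F_bound_nonneg by (simp add: d_def pos_less_divide_eq add_nonneg_pos)
      moreover have "norm (?F n p - ?F n q) \<le> 4 * F_bound * \<bar>s - t\<bar>"
        using cesaro_lipschitz[of x s t "r n"] p' q' xy dec by simp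
      moreover have "0 \<le> \<bar>s - t\<bar>" by simp
      ultimately show "norm (?F n p - ?F n q) < e" by (simp add: algebra_simps)
    qed
  qed blast
  define v where "v s x = g (s, code x)" for s x
  have lim: "(\<lambda>j. cesaro (r (k j)) s x) \<longlonglongrightarrow> v s x" if "s \<in> {0..1}" "x \<in> X" for s x
    unfolding LIMSEQ_iff
  proof (intro allI impI)
    fix e :: real assume "0 < e"
    from unif[OF this] obtain N where N: "\<And>n p. n \<ge> N \<Longrightarrow> p \<in> ?S \<Longrightarrow> norm (?F (k n) p - g p) < e"
      by blast
    have "norm (cesaro (r (k n)) s x - v s x) < e" if "n \<ge> N" for n
      using N[OF that, of "(s, code x)"] \<open>s \<in> {0..1}\<close> \<open>x \<in> X\<close> dec by (simp add: v_def)
    then show "\<exists>N. \<forall>n\<ge>N. norm (cesaro (r (k n)) s x - v s x) < e" by blast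
  qed
  have unit: "1 / (real k + s) \<in> {0..1}" if "s \<in> {0..1}" "1 \<le> k" for k s
    using that by (auto simp: divide_simps)
  have rk: "filterlim (\<lambda>j. r (k j)) sequentially sequentially"
    using filterlim_subseq[OF strict_mono_o[OF r(1) k]] by (simp add: o_def)
  have "harmonic v"
    unfolding harmonic_def
  proof (intro conjI ballI exI allI)
    show "continuous_on {0..1} (\<lambda>s. v s x)" if "x \<in> X" for x
      unfolding v_def by (rule continuous_on_compose2[OF g]) (use that in \<open>auto intro!: continuous_intros\<close>)
    fix x s K assume x: "x \<in> X" and s: "s \<in> {0..1::real}"
    let ?E = "\<lambda>w. w s x - (\<Sum>k=1..K. digit_prob k s * w (1 / (real k + s)) (T (int k) x))"
    have 1: "(\<lambda>j. \<bar>?E (cesaro (r (k j)))\<bar>) \<longlonglongrightarrow> \<bar>?E v\<bar>"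
      using x s unit T_in_X by (intro tendsto_intros lim) auto
    have 2: "(\<lambda>j. 4 * F_bound / real (r (k j)) + 2 * F_bound / (real K + 1)) \<longlonglongrightarrow> 0 + 2 * F_bound / (real K + 1)"
      by (intro tendsto_add tendsto_const filterlim_compose[OF lim_const_over_n rk])
    have "\<forall>\<^sub>F j in sequentially. 1 \<le> r (k j)"
      using rk by (simp add: filterlim_at_top)
    then have "\<forall>\<^sub>F j in sequentially. \<bar>?E (cesaro (r (k j)))\<bar> \<le> 4 * F_bound / real (r (k j)) + 2 * F_bound / (real K + 1)"
    proof eventually_elim
      case (elim j)
      then show ?case using cesaro_almost_harmonic[OF x, of s "r (k j)" K] s by simp
    qed
    then have "\<bar>?E v\<bar> \<le> 0 + 2 * F_bound / (real K + 1)"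
      by (rule tendsto_le[OF sequentially_bot 2 1])
    then show "\<bar>?E v\<bar> \<le> 2 * F_bound / (real K + 1)" by simp
  qed
  moreover have "(\<Sum>x\<in>X. v golden x) = 0"
  proof (rule LIMSEQ_unique)
    show "(\<lambda>j. \<Sum>x\<in>X. cesaro (r (k j)) golden x) \<longlonglongrightarrow> (\<Sum>x\<in>X. v golden x)"
      using golden by (intro tendsto_sum lim) auto
    show "(\<lambda>j. \<Sum>x\<in>X. cesaro (r (k j)) golden x) \<longlonglongrightarrow> 0"
      using sum_cesaro[of golden] golden by simp
  qed
  ultimately have "v s0 x0 = 0" by (rule harmonic_eq_0[OF _ _ s0 x0])
  then have "(\<lambda>j. \<bar>cesaro (r (k j)) s0 x0\<bar>) \<longlonglongrightarrow> 0"
    using lim[OF s0 x0] by (simp add: tendsto_rabs_zero)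
  then have "e \<le> 0"
    using r(2) by (intro tendsto_lowerbound[of _ 0 sequentially e]) (auto simp: R_def)
  then show False using e by simp
qed

end

section \<open>Weak convergence of the averages along the digits\<close>

context digit_action begin

text \<open>The Cesaro means of the integrals over [c,1].\<close>

definition cesaro_from :: "nat \<Rightarrow> real \<Rightarrow> 'x \<Rightarrow> real \<Rightarrow> real" where
  "cesaro_from n s x c = (\<Sum>i<n. weighted_int i s x c 1) / real n"

lemma cesaro_from_0: "cesaro_from n s x 0 = cesaro n s x"
  by (simp add: cesaro_from_def cesaro_def)

lemma cesaro_from_bound:
  assumes "x \<in> X" "s \<in> {0..1}" "c \<in> {0..1}"
  shows "\<bar>cesaro_from n s x c\<bar> \<le> 2 * F_bound"
proof (cases "n = 0")
  case False
  have "\<bar>weighted_int i s x c 1\<bar> \<le> 2 * F_bound" for i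
    using weighted_int_bound[of x s c 1 i] assms F_bound_nonneg mult_left_mono[of "1 - c" 1 "2 * F_bound"] by auto
  then have "\<bar>\<Sum>i<n. weighted_int i s x c 1\<bar> \<le> (\<Sum>i<n. 2 * F_bound)"
    by (intro order_trans[OF sum_abs] sum_mono)
  then show ?thesis using False by (simp add: cesaro_from_def field_simps)
qed (use F_bound_nonneg in \<open>simp add: cesaro_from_def\<close>)

text \<open>Let k be the first partial quotient of c and c' the remainder.  The interval [c,1] consists of the
  numbers with first partial quotient less than k, whose contribution tends to 0, and of a part that corresponds to
  [0,c'] in the branch of k, so to the complement of [c',1].\<close>

lemma cesaro_from_recursion:
  assumes x: "x \<in> X" and s: "s \<in> {0..1}" and c: "c \<in> {0<..1}"
  obtains R p s' x' c' where "R \<longlonglongrightarrow> 0" "0 \<le> p" "p \<le> 1 / 2" "s' \<in> {0..1}" "x' \<in> X" "c' \<in> {0..1}"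
    "\<And>n. cesaro_from n s x c = R n - p * cesaro_from n s' x' c'"
proof -
  define k where "k = nat \<lfloor>1 / c\<rfloor>"
  have fl: "1 \<le> \<lfloor>1 / c\<rfloor>" using c by (simp add: le_floor_iff)
  have k1: "1 \<le> k"
  proof -
    have "1 \<le> nat z" if "1 \<le> z" for z :: int using that by simp
    then show ?thesis unfolding k_def using fl by blast
  qed
  have of_nat_nat: "real (nat z) = of_int z" if "1 \<le> z" for z :: int using that by simp
  have kr: "real k = of_int \<lfloor>1 / c\<rfloor>" unfolding k_def by (rule of_nat_nat[OF fl])
  define c' where "c' = 1 / c - real k"
  have c': "c' \<in> {0..1}"
    unfolding c'_def kr using floor_correct[of "1 / c"] by (simp add: algebra_simps)
  have c_eq: "c = 1 / (real k + c')" using c by (simp add: c'_def)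
  let ?s = "1 / (real k + s)" and ?x = "T (int k) x" and ?p = "digit_prob k s"
  have s': "?s \<in> {0..1}" using s k1 by (auto simp: divide_simps)
  have x': "?x \<in> X" using x by (rule T_in_X)
  let ?Q = "\<lambda>n. \<Sum>j=1..k-1. digit_prob j s * cesaro n (1 / (real j + s)) (T (int j) x)"
  let ?E = "\<lambda>n. (weighted_int 0 s x c 1 - weighted_int n s x c 1) / real n"
  have step: "weighted_int (Suc i) s x c 1
      = (\<Sum>j=1..k-1. digit_prob j s * weighted_int i (1 / (real j + s)) (T (int j) x) 0 1)
        + ?p * (weighted_int i ?s ?x 0 1 - weighted_int i ?s ?x c' 1)" for i
  proof -
    have "weighted_int (Suc i) s x c 1 = weighted_int (Suc i) s x c (1 / real k) + weighted_int (Suc i) s x (1 / real k) 1"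
      using x s c c' k1 by (intro weighted_int_add) (auto simp: c_eq intro!: frac_le)
    also have "weighted_int (Suc i) s x c (1 / real k) = ?p * weighted_int i ?s ?x 0 c'"
      using weighted_int_branch[OF x _ _ k1, of s 0 c' i] s c' by (simp add: c_eq)
    also have "weighted_int i ?s ?x 0 c' = weighted_int i ?s ?x 0 1 - weighted_int i ?s ?x c' 1"
      using weighted_int_add[OF x', of ?s 0 c' 1 i] s' c' by simp
    also have "weighted_int (Suc i) s x (1 / real k) 1
        = (\<Sum>j=1..k-1. digit_prob j s * weighted_int i (1 / (real j + s)) (T (int j) x) 0 1)"
      using weighted_int_branches[OF x, of s i "k - 1"] s k1 by (simp add: of_nat_diff)
    finally show ?thesis by simp
  qed
  have cesaro_from: "cesaro_from n s x c = (?E n + ?Q n + ?p * cesaro n ?s ?x) - ?p * cesaro_from n ?s ?x c'" for n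
  proof -
    have "(\<Sum>i<n. weighted_int i s x c 1) = (\<Sum>i<n. weighted_int (Suc i) s x c 1) + (weighted_int 0 s x c 1 - weighted_int n s x c 1)"
      by (induction n) auto
    also have "(\<Sum>i<n. weighted_int (Suc i) s x c 1)
        = (\<Sum>j=1..k-1. digit_prob j s * (\<Sum>i<n. weighted_int i (1 / (real j + s)) (T (int j) x) 0 1))
          + ?p * ((\<Sum>i<n. weighted_int i ?s ?x 0 1) - (\<Sum>i<n. weighted_int i ?s ?x c' 1))"
      unfolding step sum.distrib sum_distrib_left[symmetric] sum_subtractf
      by (subst sum.swap) (simp only: sum_distrib_left)
    finally have eq: "(\<Sum>i<n. weighted_int i s x c 1)
        = (\<Sum>j=1..k-1. digit_prob j s * (\<Sum>i<n. weighted_int i (1 / (real j + s)) (T (int j) x) 0 1))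
          + ?p * ((\<Sum>i<n. weighted_int i ?s ?x 0 1) - (\<Sum>i<n. weighted_int i ?s ?x c' 1)) + (weighted_int 0 s x c 1 - weighted_int n s x c 1)" .
    have Q: "?Q n = (\<Sum>j=1..k-1. digit_prob j s * (\<Sum>i<n. weighted_int i (1 / (real j + s)) (T (int j) x) 0 1)) / real n"
      by (simp only: cesaro_def sum_divide_distrib[symmetric] times_divide_eq_right)
    have arith: "(a + p * (u - w) + d) / m = (d / m + a / m + p * (u / m)) - p * (w / m)"
      for a p u w d m :: real
      by (simp add: add_divide_distrib diff_divide_distrib right_diff_distrib)
    show ?thesis
      unfolding Q unfolding cesaro_def cesaro_from_def eq by (rule arith)
  qed
  have "(\<lambda>n. ?E n) \<longlonglongrightarrow> 0"
  proof (rule Lim_null_comparison)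
    show "(\<lambda>n. 4 * F_bound / real n) \<longlonglongrightarrow> 0" by (rule lim_const_over_n)
    have "\<bar>weighted_int i s x c 1\<bar> \<le> 2 * F_bound" for i
      using weighted_int_bound[of x s c 1 i] x s c F_bound_nonneg mult_left_mono[of "1 - c" 1 "2 * F_bound"] by auto
    from this[of 0] this have "\<bar>weighted_int 0 s x c 1 - weighted_int n s x c 1\<bar> \<le> 4 * F_bound" for n
      by (smt (verit) abs_triangle_ineq4)
    then show "\<forall>\<^sub>F n in sequentially. norm (?E n) \<le> 4 * F_bound / real n"
      by (intro always_eventually allI) (auto intro!: divide_right_mono)
  qed
  moreover have "(\<lambda>n. ?Q n) \<longlonglongrightarrow> (\<Sum>j=1..k-1. digit_prob j s * 0)"
    using s x T_in_X by (intro tendsto_sum tendsto_mult tendsto_const cesaro_tendsto_0) (auto simp: divide_simps)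
  moreover have "(\<lambda>n. ?p * cesaro n ?s ?x) \<longlonglongrightarrow> ?p * 0"
    by (intro tendsto_mult tendsto_const cesaro_tendsto_0 s' x')
  ultimately have "(\<lambda>n. ?E n + ?Q n + ?p * cesaro n ?s ?x) \<longlonglongrightarrow> 0 + (\<Sum>j=1..k-1. digit_prob j s * 0) + ?p * 0"
    by (intro tendsto_add)
  then have "(\<lambda>n. ?E n + ?Q n + ?p * cesaro n ?s ?x) \<longlonglongrightarrow> 0" by simp
  moreover have "0 \<le> ?p" "?p \<le> 1 / 2"
    using digit_prob_pos[OF k1, of s] digit_prob_le_half[OF k1, of s] s by auto
  ultimately show ?thesis using that s' x' c' cesaro_from by blast
qed

text \<open>Iteration of the preceding recursion gains a factor 1/2 each time.\<close>

lemma cesaro_from_eventually: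
  assumes "x \<in> X" "s \<in> {0..1}" "c \<in> {0..1}" "0 < e"
  shows "\<forall>\<^sub>F n in sequentially. \<bar>cesaro_from n s x c\<bar> \<le> 2 * F_bound / 2 ^ m + e"
  using assms
proof (induction m arbitrary: x s c e)
  case 0
  have "\<bar>cesaro_from n s x c\<bar> \<le> 2 * F_bound / 2 ^ 0 + e" for n
    using cesaro_from_bound[OF 0(1-3), of n] 0(4) by simp
  then show ?case by simp
next
  case (Suc m)
  show ?case
  proof (cases "c = 0")
    case True
    have "(\<lambda>n. cesaro n s x) \<longlonglongrightarrow> 0" using Suc.prems by (intro cesaro_tendsto_0)
    then have "\<forall>\<^sub>F n in sequentially. \<bar>cesaro n s x\<bar> < e"
      using Suc.prems(4) by (auto simp: tendsto_iff dist_real_def)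
    then show ?thesis
    proof eventually_elim
      case (elim n)
      have "0 \<le> 2 * F_bound / 2 ^ Suc m" using F_bound_nonneg by simp
      then show ?case using elim True by (simp add: cesaro_from_0)
    qed
  next
    case False
    then have c: "c \<in> {0<..1}" using Suc.prems(3) by auto
    obtain R p s' x' c' where R: "R \<longlonglongrightarrow> 0" and p: "0 \<le> p" "p \<le> 1 / 2"
      and s': "s' \<in> {0..1}" "x' \<in> X" "c' \<in> {0..1}"
      and eq: "\<And>n. cesaro_from n s x c = R n - p * cesaro_from n s' x' c'"
      by (rule cesaro_from_recursion[OF Suc.prems(1,2) c], rule that)
    have "\<forall>\<^sub>F n in sequentially. \<bar>R n\<bar> < e / 2"
      using R Suc.prems(4) by (auto simp: tendsto_iff dist_real_def dest: spec[of _ "e / 2"])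
    moreover have "\<forall>\<^sub>F n in sequentially. \<bar>cesaro_from n s' x' c'\<bar> \<le> 2 * F_bound / 2 ^ m + e"
      using Suc.IH s' Suc.prems(4) by blast
    ultimately show ?thesis
    proof eventually_elim
      case (elim n)
      have "\<bar>p * cesaro_from n s' x' c'\<bar> \<le> 1 / 2 * (2 * F_bound / 2 ^ m + e)"
        unfolding abs_mult using elim p by (intro mult_mono) auto
      also have "\<dots> = 2 * F_bound / 2 ^ Suc m + e / 2" by simp
      finally show ?case using elim eq[of n] by linarith
    qed
  qed
qed

lemma cesaro_from_tendsto_0:
  assumes "x \<in> X" "s \<in> {0..1}" "c \<in> {0..1}"
  shows "(\<lambda>n. cesaro_from n s x c) \<longlonglongrightarrow> 0"
  unfolding tendsto_iff
proof (intro allI impI)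
  fix e :: real assume e: "e > 0"
  have "(\<lambda>m. 2 * F_bound / 2 ^ m) \<longlonglongrightarrow> 0" by (rule LIMSEQ_divide_realpow_zero) simp
  then have "\<forall>\<^sub>F m in sequentially. 2 * F_bound / 2 ^ m < e / 2"
    using e by (intro order_tendstoD) auto
  then obtain m where m: "2 * F_bound / 2 ^ m < e / 2" by (auto simp: eventually_sequentially)
  have "\<forall>\<^sub>F n in sequentially. \<bar>cesaro_from n s x c\<bar> \<le> 2 * F_bound / 2 ^ m + e / 2"
    using assms e by (intro cesaro_from_eventually) auto
  then show "\<forall>\<^sub>F n in sequentially. dist (cesaro_from n s x c) 0 < e"
    by eventually_elim (use m in \<open>simp add: dist_real_def\<close>)
qed

end

abbreviation unit_measure :: "real measure" where
  "unit_measure \<equiv> lebesgue_on {0..1}"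

lemma borel_measurable_unit_measure:
  "f \<in> borel_measurable borel \<Longrightarrow> f \<in> borel_measurable unit_measure"
  by (intro measurable_restrict_space1 measurable_completion) simp

lemma sets_unit_measure_borel: "A \<in> sets borel \<Longrightarrow> A \<inter> {0..1} \<in> sets unit_measure"
  by (auto simp: sets_restrict_space)

lemma finite_unit_measure: "finite_measure unit_measure"
  by (intro finite_measureI) (auto simp: emeasure_restrict_space)

lemma integrable_indicator_scaleR:
  "A \<inter> {0..1} \<in> sets unit_measure \<Longrightarrow> integrable unit_measure (\<lambda>y. indicat_real A y *\<^sub>R (c::complex))"
proof -
  interpret finite_measure unit_measure by (rule finite_unit_measure)
  assume "A \<inter> {0..1} \<in> sets unit_measure"
  then have "integrable unit_measure (\<lambda>y. indicat_real (A \<inter> {0..1}) y *\<^sub>R c)"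
    by (intro integrable_scaleR_left) (simp add: less_top[symmetric])
  then show ?thesis
    by (rule Bochner_Integration.integrable_cong[THEN iffD1, rotated -1]) (auto simp: indicator_def)
qed

context digit_action begin

text \<open>Here the first term of the average belongs to the initial state.\<close>

definition digit_average :: "nat \<Rightarrow> 'x \<Rightarrow> (real \<Rightarrow> complex) \<Rightarrow> complex" where
  "digit_average n x h = (1 / real n) *\<^sub>R (\<Sum>i<n. LINT y|unit_measure. F (digit_state i x y) *\<^sub>R h y)"

text \<open>The functions against which the averages of F along the partial quotients integrate to 0 in the limit.
  They form a closed subspace of the space of integrable functions.\<close>

definition averages_to_0 :: "(real \<Rightarrow> complex) \<Rightarrow> bool" where
  "averages_to_0 h \<longleftrightarrow> integrable unit_measure h \<and> (\<forall>x\<in>X. (\<lambda>n. digit_average n x h) \<longlonglongrightarrow> 0)"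

lemma digit_state_measurable_unit: "x \<in> X \<Longrightarrow> (\<lambda>y. F (digit_state i x y)) \<in> borel_measurable unit_measure"
  by (intro borel_measurable_unit_measure digit_state_measurable)

lemma integrable_F_times:
  assumes "integrable unit_measure h" "x \<in> X"
  shows "integrable unit_measure (\<lambda>y. F (digit_state i x y) *\<^sub>R (h y :: complex))"
proof (rule Bochner_Integration.integrable_bound[where f = "\<lambda>y. F_bound *\<^sub>R h y"])
  show "(\<lambda>y. F (digit_state i x y) *\<^sub>R h y) \<in> borel_measurable unit_measure"
    using assms digit_state_measurable_unit by (intro borel_measurable_scaleR) auto
  show "AE y in unit_measure. norm (F (digit_state i x y) *\<^sub>R h y) \<le> norm (F_bound *\<^sub>R h y)"
    using F_le_bound[OF digit_state_in_X[OF assms(2)]] F_bound_nonneg by (intro AE_I2) (simp add: mult_right_mono)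
qed (use assms in auto)

lemma digit_average_add:
  assumes "integrable unit_measure h" "integrable unit_measure k" "x \<in> X"
  shows "digit_average n x (\<lambda>y. h y + k y) = digit_average n x h + digit_average n x k"
  unfolding digit_average_def scaleR_add_right
  by (subst Bochner_Integration.integral_add) (auto intro!: integrable_F_times assms simp: sum.distrib scaleR_add_right)

lemma digit_average_diff_bound:
  assumes "integrable unit_measure h" "integrable unit_measure k" "x \<in> X"
  shows "norm (digit_average n x h - digit_average n x k) \<le> F_bound * (LINT y|unit_measure. norm (h y - k y))"
proof (cases "n = 0")
  case False
  have d: "norm ((LINT y|unit_measure. F (digit_state i x y) *\<^sub>R h y) - (LINT y|unit_measure. F (digit_state i x y) *\<^sub>R k y))
      \<le> F_bound * (LINT y|unit_measure. norm (h y - k y))" for i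
  proof -
    have "(LINT y|unit_measure. F (digit_state i x y) *\<^sub>R h y) - (LINT y|unit_measure. F (digit_state i x y) *\<^sub>R k y)
        = (LINT y|unit_measure. F (digit_state i x y) *\<^sub>R (h y - k y))"
      using assms by (simp add: scaleR_diff_right integrable_F_times)
    also have "norm \<dots> \<le> (LINT y|unit_measure. norm (F (digit_state i x y) *\<^sub>R (h y - k y)))"
      by (rule integral_norm_bound)
    also have "\<dots> \<le> (LINT y|unit_measure. F_bound * norm (h y - k y))"
    proof (rule integral_mono)
      show "integrable unit_measure (\<lambda>y. norm (F (digit_state i x y) *\<^sub>R (h y - k y)))"
        using assms by (intro integrable_norm integrable_F_times) auto
      show "integrable unit_measure (\<lambda>y. F_bound * norm (h y - k y))" using assms by auto
      show "norm (F (digit_state i x y) *\<^sub>R (h y - k y)) \<le> F_bound * norm (h y - k y)" for y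
        using F_le_bound[OF digit_state_in_X[OF assms(3)]] by (simp add: mult_right_mono)
    qed
    finally show ?thesis by simp
  qed
  have "norm (digit_average n x h - digit_average n x k) = (1 / real n) * norm (\<Sum>i<n.
      (LINT y|unit_measure. F (digit_state i x y) *\<^sub>R h y) - (LINT y|unit_measure. F (digit_state i x y) *\<^sub>R k y))"
    unfolding digit_average_def sum_subtractf scaleR_diff_right[symmetric] by simp
  also have "\<dots> \<le> (1 / real n) * (\<Sum>i<n. F_bound * (LINT y|unit_measure. norm (h y - k y)))"
    using d by (intro mult_left_mono order_trans[OF norm_sum] sum_mono) auto
  finally show ?thesis using False by simp
qed (use F_bound_nonneg in \<open>simp add: digit_average_def\<close>)

lemma averages_to_0_add: "averages_to_0 h \<Longrightarrow> averages_to_0 k \<Longrightarrow> averages_to_0 (\<lambda>y. h y + k y)"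
  unfolding averages_to_0_def by (auto simp: digit_average_add intro: tendsto_add_zero)

lemma averages_to_0_uminus: "averages_to_0 h \<Longrightarrow> averages_to_0 (\<lambda>y. - h y)"
proof -
  have "digit_average n x (\<lambda>y. - h y) = - digit_average n x h" for n x by (simp add: digit_average_def sum_negf)
  then show "averages_to_0 h \<Longrightarrow> averages_to_0 (\<lambda>y. - h y)"
    unfolding averages_to_0_def by (auto intro: tendsto_minus_cancel)
qed

lemma averages_to_0_0: "averages_to_0 (\<lambda>y. 0)"
  by (simp add: averages_to_0_def digit_average_def)

lemma averages_to_0_limit:
  assumes s: "\<And>j::nat. averages_to_0 (s j)" and h: "integrable unit_measure h"
    and lim: "(\<lambda>j. LINT y|unit_measure. norm (s j y - h y)) \<longlonglongrightarrow> 0"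
  shows "averages_to_0 h"
  unfolding averages_to_0_def
proof (intro conjI ballI h)
  fix x assume x: "x \<in> X"
  show "(\<lambda>n. digit_average n x h) \<longlonglongrightarrow> 0"
    unfolding tendsto_iff
  proof (intro allI impI)
    fix e :: real assume e: "e > 0"
    have "(\<lambda>j. F_bound * (LINT y|unit_measure. norm (s j y - h y))) \<longlonglongrightarrow> 0"
      using tendsto_mult_right_zero[OF lim] .
    then have "\<forall>\<^sub>F j in sequentially. F_bound * (LINT y|unit_measure. norm (s j y - h y)) < e / 2"
      using e by (intro order_tendstoD) auto
    then obtain j where j: "F_bound * (LINT y|unit_measure. norm (s j y - h y)) < e / 2"
      by (auto simp: eventually_sequentially)
    have "(\<lambda>n. digit_average n x (s j)) \<longlonglongrightarrow> 0" using s x by (simp add: averages_to_0_def)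
    then have "\<forall>\<^sub>F n in sequentially. norm (digit_average n x (s j)) < e / 2"
      using e by (auto simp: tendsto_iff dest: spec[of _ "e / 2"])
    then show "\<forall>\<^sub>F n in sequentially. dist (digit_average n x h) 0 < e"
    proof eventually_elim
      case (elim n)
      have "norm (digit_average n x (s j) - digit_average n x h) < e / 2"
        using digit_average_diff_bound[OF _ h x, of "s j" n] s j by (auto simp: averages_to_0_def)
      then show ?case using elim norm_triangle_ineq4[of "digit_average n x (s j)" "digit_average n x (s j) - digit_average n x h"] by simp
    qed
  qed
qed

lemma averages_to_0_AE:
  assumes "averages_to_0 h" "integrable unit_measure k" "AE y in unit_measure. h y = k y"
  shows "averages_to_0 k"
proof (rule averages_to_0_limit)
  show "averages_to_0 h" by fact
  have "(LINT y|unit_measure. norm (h y - k y)) = (LINT y|unit_measure. 0)"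
    using assms by (intro integral_cong_AE) (auto simp: averages_to_0_def)
  then show "(\<lambda>j. LINT y|unit_measure. norm (h y - k y)) \<longlonglongrightarrow> 0" by simp
qed fact

lemma averages_to_0_ray: "averages_to_0 (\<lambda>y. indicat_real {a<..} y *\<^sub>R c)"
  unfolding averages_to_0_def
proof (intro conjI ballI)
  show "integrable unit_measure (\<lambda>y. indicat_real {a<..} y *\<^sub>R c)"
    by (intro integrable_indicator_scaleR sets_unit_measure_borel) simp
  fix x assume x: "x \<in> X"
  define a' where "a' = min 1 (max 0 a)"
  have a': "0 \<le> a'" "a' \<le> 1" by (auto simp: a'_def)
  have "(LINT y|unit_measure. F (digit_state i x y) *\<^sub>R (indicat_real {a<..} y *\<^sub>R c)) = weighted_int i 0 x a' 1 *\<^sub>R c" for i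
  proof -
    have "(LINT y|unit_measure. F (digit_state i x y) *\<^sub>R (indicat_real {a<..} y *\<^sub>R c))
        = (LINT y|lebesgue. indicat_real {0..1} y *\<^sub>R (F (digit_state i x y) *\<^sub>R (indicat_real {a<..} y *\<^sub>R c)))"
      by (subst integral_restrict_space) (auto simp: set_lebesgue_integral_def)
    also have "\<dots> = (LINT y|lebesgue. (indicat_real {a'<..<1} y *\<^sub>R F (digit_state i x y)) *\<^sub>R c)"
      by (rule integral_discrete_difference[where X = "{0, 1}"])
         (auto simp: indicator_def a'_def)
    also have "\<dots> = (LINT y|lebesgue. indicat_real {a'<..<1} y *\<^sub>R F (digit_state i x y)) *\<^sub>R c"
    proof (rule integral_scaleR_left)
      have "integrable lborel (\<lambda>y. indicat_real {a'<..<1} y *\<^sub>R F (digit_state i x y))"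
        using weighted_int_integrable[OF x, of 0 a' 1 i] a' by (simp add: set_integrable_def)
      then show "integrable lebesgue (\<lambda>y. indicat_real {a'<..<1} y *\<^sub>R F (digit_state i x y))"
        by (subst integrable_completion) auto
    qed
    also have "(LINT y|lebesgue. indicat_real {a'<..<1} y *\<^sub>R F (digit_state i x y)) = weighted_int i 0 x a' 1"
      using digit_state_measurable[OF x, of i] a'
      by (subst integral_completion) (auto simp: weighted_int_eq set_lebesgue_integral_def)
    finally show ?thesis .
  qed
  note int = this
  have "digit_average n x (\<lambda>y. indicat_real {a<..} y *\<^sub>R c) = cesaro_from n 0 x a' *\<^sub>R c" for n
    unfolding digit_average_def cesaro_from_def int scaleR_sum_left[symmetric] by simp
  moreover have "(\<lambda>n. cesaro_from n 0 x a' *\<^sub>R c) \<longlonglongrightarrow> 0 *\<^sub>R c"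
    using a' x by (intro tendsto_scaleR cesaro_from_tendsto_0 tendsto_const) auto
  ultimately show "(\<lambda>n. digit_average n x (\<lambda>y. indicat_real {a<..} y *\<^sub>R c)) \<longlonglongrightarrow> 0" by simp
qed

lemma averages_to_0_const: "averages_to_0 (\<lambda>y. c)"
  by (rule averages_to_0_AE[OF averages_to_0_ray[of "-1" c]])
     (use finite_unit_measure in \<open>auto simp: finite_measure.integrable_const intro!: AE_I2\<close>)

lemma averages_to_0_indicator_borel:
  assumes "A \<in> sets borel"
  shows "\<forall>c. averages_to_0 (\<lambda>y. indicat_real A y *\<^sub>R c)"
proof -
  have A: "A \<in> sigma_sets UNIV (range greaterThan)"
    using assms unfolding borel_Ioi by simp
  have borel: "D \<in> sets borel" if "D \<in> sigma_sets UNIV (range greaterThan)" for D :: "real set"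
    using that unfolding borel_Ioi by simp
  have stable: "Int_stable (range (greaterThan :: real \<Rightarrow> _))"
  proof -
    have "{a<..} \<inter> {b<..} = {max a b<..}" for a b :: real by auto
    then show ?thesis by (auto simp: Int_stable_def)
  qed
  have sub: "range (greaterThan :: real \<Rightarrow> _) \<subseteq> Pow UNIV" by simp
  from stable sub A show ?thesis
  proof (induction rule: sigma_sets_induct_disjoint)
    case (basic D)
    then show ?case using averages_to_0_ray by auto
  next
    case empty
    show ?case using averages_to_0_0 by simp
  next
    case (compl D)
    show ?case
    proof
      fix c :: complex
      have "(\<lambda>y. indicat_real (UNIV - D) y *\<^sub>R c) = (\<lambda>y. c + - (indicat_real D y *\<^sub>R c))"
        by (auto simp: indicator_def)
      then show "averages_to_0 (\<lambda>y. indicat_real (UNIV - D) y *\<^sub>R c)"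
        using averages_to_0_add[OF averages_to_0_const averages_to_0_uminus[OF compl.IH[rule_format]]] by simp
    qed
  next
    case (union D)
    show ?case
    proof
      fix c :: complex
      have D: "D i \<in> sets borel" for i using union.hyps borel by blast
      have fin: "averages_to_0 (\<lambda>y. indicat_real (\<Union>i<j. D i) y *\<^sub>R c)" for j
      proof (induction j)
        case 0
        show ?case using averages_to_0_0 by simp
      next
        case (Suc j)
        have "D j \<inter> (\<Union>i<j. D i) = {}"
        proof -
          have "D j \<inter> D i = {}" if "i < j" for i
            using union.hyps(1) that unfolding disjoint_family_on_def by (metis UNIV_I less_irrefl)
          then show ?thesis by blast
        qed
        then have "(\<lambda>y. indicat_real (\<Union>i<Suc j. D i) y *\<^sub>R c)
            = (\<lambda>y. indicat_real (\<Union>i<j. D i) y *\<^sub>R c + indicat_real (D j) y *\<^sub>R c)"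
          by (auto simp: indicator_def lessThan_Suc fun_eq_iff)
        then show ?case using averages_to_0_add[OF Suc union.IH[rule_format]] by simp
      qed
      show "averages_to_0 (\<lambda>y. indicat_real (\<Union> (range D)) y *\<^sub>R c)"
      proof (rule averages_to_0_limit[OF fin])
        have U: "\<Union> (range D) \<in> sets borel" using D by auto
        then show "integrable unit_measure (\<lambda>y. indicat_real (\<Union> (range D)) y *\<^sub>R c)"
          by (intro integrable_indicator_scaleR sets_unit_measure_borel)
        have "(\<lambda>j. LINT y|unit_measure. norm (indicat_real (\<Union>i<j. D i) y *\<^sub>R c - indicat_real (\<Union> (range D)) y *\<^sub>R c))
            \<longlonglongrightarrow> (LINT y|unit_measure. 0)"
        proof (rule integral_dominated_convergence[where w = "\<lambda>y. norm c"])
          show "integrable unit_measure (\<lambda>y. norm c)"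
            using finite_unit_measure by (simp add: finite_measure.integrable_const)
          show "(\<lambda>y. norm (indicat_real (\<Union>i<j. D i) y *\<^sub>R c - indicat_real (\<Union> (range D)) y *\<^sub>R c))
              \<in> borel_measurable unit_measure" for j
          proof -
            have "(\<Union>i<j. D i) \<in> sets borel" using D by auto
            then have m: "indicat_real (\<Union>i<j. D i) \<in> borel_measurable borel"
                "indicat_real (\<Union> (range D)) \<in> borel_measurable borel"
              using U by (auto intro: borel_measurable_indicator)
            have "(\<lambda>y. indicat_real (\<Union>i<j. D i) y *\<^sub>R c) \<in> borel_measurable borel"
                "(\<lambda>y. indicat_real (\<Union> (range D)) y *\<^sub>R c) \<in> borel_measurable borel"
              by (rule borel_measurable_scaleR[OF m(1)], simp, rule borel_measurable_scaleR[OF m(2)], simp)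
            then show ?thesis
              by (intro borel_measurable_unit_measure measurable_compose[OF borel_measurable_diff borel_measurable_norm])
          qed
          show "AE y in unit_measure. norm (norm (indicat_real (\<Union>i<j. D i) y *\<^sub>R c
              - indicat_real (\<Union> (range D)) y *\<^sub>R c)) \<le> norm c" for j
            by (intro AE_I2) (auto simp: indicator_def)
          show "AE y in unit_measure. (\<lambda>j. norm (indicat_real (\<Union>i<j. D i) y *\<^sub>R c
              - indicat_real (\<Union> (range D)) y *\<^sub>R c)) \<longlonglongrightarrow> 0"
          proof (intro AE_I2)
            fix y
            have "\<forall>\<^sub>F j in sequentially. norm (indicat_real (\<Union>i<j. D i) y *\<^sub>R c
              - indicat_real (\<Union> (range D)) y *\<^sub>R c) = 0"
            proof (cases "y \<in> \<Union> (range D)")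
              case True
              then obtain i where "y \<in> D i" by blast
              then have "y \<in> (\<Union>i<j. D i)" if "j > i" for j using that by blast
              then show ?thesis using True by (auto simp: eventually_sequentially intro!: exI[of _ "Suc i"])
            qed (auto simp: indicator_def)
            then show "(\<lambda>j. norm (indicat_real (\<Union>i<j. D i) y *\<^sub>R c
              - indicat_real (\<Union> (range D)) y *\<^sub>R c)) \<longlonglongrightarrow> 0"
              by (rule tendsto_eventually)
          qed
        qed auto
        then show "(\<lambda>j. LINT y|unit_measure. norm (indicat_real (\<Union>i<j. D i) y *\<^sub>R c
            - indicat_real (\<Union> (range D)) y *\<^sub>R c)) \<longlonglongrightarrow> 0" by simp
      qed
    qed
  qed
qed

lemma averages_to_0_indicator:
  assumes "A \<in> sets unit_measure"
  shows "averages_to_0 (\<lambda>y. indicat_real A y *\<^sub>R c)"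
proof -
  have "A \<in> sets lebesgue" "A \<subseteq> {0..1}"
    using assms by (auto simp: sets_restrict_space)
  then obtain S N N' where A: "A = S \<union> N" "N \<subseteq> N'" "N' \<in> null_sets lborel" "S \<in> sets lborel"
    by (elim sets_completionE) auto
  have "averages_to_0 (\<lambda>y. indicat_real S y *\<^sub>R c)" using averages_to_0_indicator_borel A by auto
  then show ?thesis
  proof (rule averages_to_0_AE)
    show "integrable unit_measure (\<lambda>y. indicat_real A y *\<^sub>R c)"
      using assms \<open>A \<subseteq> {0..1}\<close> by (intro integrable_indicator_scaleR) (simp add: Int_absorb2)
    have "AE y in lebesgue. y \<notin> N'"
      using A(3) by (intro AE_completion AE_not_in)
    then have "AE y in unit_measure. y \<notin> N'"
      by (subst AE_restrict_space_iff) auto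
    then show "AE y in unit_measure. indicat_real S y *\<^sub>R c = indicat_real A y *\<^sub>R c"
      by eventually_elim (use A in \<open>auto simp: indicator_def\<close>)
  qed
qed

theorem averages_to_0_integrable:
  assumes "integrable unit_measure h"
  shows "averages_to_0 h"
  using assms
proof (induction rule: integrable_induct)
  case (base A c)
  then show ?case by (intro averages_to_0_indicator)
next
  case (add f g)
  then show ?case by (intro averages_to_0_add)
next
  case (lim f s)
  show ?case
  proof (rule averages_to_0_limit[OF lim.IH lim.hyps(4)])
    have "(\<lambda>j. LINT y|unit_measure. norm (s j y - f y)) \<longlonglongrightarrow> (LINT y|unit_measure. 0)"
    proof (rule integral_dominated_convergence[where w = "\<lambda>y. 3 * norm (f y)"])
      show "AE y in unit_measure. norm (norm (s j y - f y)) \<le> 3 * norm (f y)" for j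
      proof (intro AE_I2)
        fix y assume "y \<in> space unit_measure"
        then show "norm (norm (s j y - f y)) \<le> 3 * norm (f y)"
          using lim.hyps(3)[of y j] norm_triangle_ineq4[of "s j y" "f y"] by simp
      qed
      show "AE y in unit_measure. (\<lambda>j. norm (s j y - f y)) \<longlonglongrightarrow> 0"
        using lim.hyps(2) by (intro AE_I2 tendsto_norm_zero) (simp add: LIM_zero)
    qed (use lim in auto)
    then show "(\<lambda>j. LINT y|unit_measure. norm (s j y - f y)) \<longlonglongrightarrow> 0" by simp
  qed
qed

end

context digit_action
begin

lemma digit_state_last: "digit_state (Suc n) x y = T (cf_digit (Suc n) y) (digit_state n x y)"
proof (induction n arbitrary: x y)
  case 0
  show ?case by (simp add: cf_digit_def)
next
  case (Suc n)
  have "cf_digit (Suc n) (gauss_map y) = cf_digit (Suc (Suc n)) y"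
    by (simp add: cf_digit_def funpow_swap1)
  then show ?case using Suc.IH[of "T \<lfloor>1 / y\<rfloor> x" "gauss_map y"] by simp
qed

lemma F_average_weakly_0:
  assumes h: "integrable unit_measure h" and x: "x \<in> X"
  shows "(\<lambda>n. (1 / real n) *\<^sub>R (\<Sum>i=1..n. LINT y|unit_measure. F (digit_state i x y) *\<^sub>R (h y :: complex))) \<longlonglongrightarrow> 0"
proof -
  let ?a = "\<lambda>i. LINT y|unit_measure. F (digit_state i x y) *\<^sub>R h y"
  define K where "K = F_bound * (LINT y|unit_measure. norm (h y))"
  have bound: "norm (?a i) \<le> K" for i
  proof -
    have "norm (?a i) \<le> (LINT y|unit_measure. norm (F (digit_state i x y) *\<^sub>R h y))"
      by (rule integral_norm_bound)
    also have "\<dots> \<le> (LINT y|unit_measure. F_bound * norm (h y))"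
      using F_le_bound[OF digit_state_in_X[OF x]]
      by (intro integral_mono integrable_norm integrable_F_times h x integrable_mult_right)
         (auto simp: mult_right_mono)
    finally show ?thesis by (simp add: K_def)
  qed
  have "(\<lambda>n. (1 / real n) *\<^sub>R (?a n - ?a 0)) \<longlonglongrightarrow> 0"
  proof (rule Lim_null_comparison)
    show "(\<lambda>n. (2 * K) / real n) \<longlonglongrightarrow> 0" by (rule lim_const_over_n)
    have "norm (?a n - ?a 0) \<le> 2 * K" for n
      using norm_triangle_ineq4[of "?a n" "?a 0"] bound[of n] bound[of 0] by linarith
    then show "\<forall>\<^sub>F n in sequentially. norm ((1 / real n) *\<^sub>R (?a n - ?a 0)) \<le> (2 * K) / real n"
      by (intro always_eventually allI) (simp add: divide_right_mono)
  qed
  moreover have "(\<lambda>n. digit_average n x h) \<longlonglongrightarrow> 0"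
    using averages_to_0_integrable[OF h] x by (simp add: averages_to_0_def)
  ultimately have "(\<lambda>n. digit_average n x h + (1 / real n) *\<^sub>R (?a n - ?a 0)) \<longlonglongrightarrow> 0"
    by (rule tendsto_add_zero[rotated])
  moreover have "(\<Sum>i=1..n. ?a i) = (\<Sum>i<n. ?a i) + (?a n - ?a 0)" for n
    by (induction n) (simp_all del: digit_state.simps)
  ultimately show ?thesis by (simp only: digit_average_def scaleR_add_right)
qed

end

section \<open>Integer and real matrices of size two\<close>

lemma mat2_nth [simp]:
  "mat2 a b c d $ 1 $ 1 = a" "mat2 a b c d $ 1 $ 2 = b"
  "mat2 a b c d $ 2 $ 1 = c" "mat2 a b c d $ 2 $ 2 = d"
  by (simp_all add: mat2_def)

lemma mat2_eqI:
  fixes A B :: "'a^2^2"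
  assumes "A$1$1 = B$1$1" "A$1$2 = B$1$2" "A$2$1 = B$2$1" "A$2$2 = B$2$2"
  shows "A = B"
  using assms by (simp add: vec_eq_iff forall_2)

lemma matrix_mult_nth2:
  fixes A B :: "('a::semiring_1)^2^2"
  shows "(A ** B) $ i $ j = A $ i $ 1 * B $ 1 $ j + A $ i $ 2 * B $ 2 $ j"
  by (simp add: matrix_matrix_mult_def sum_2)

lemma mat_one_nth2 [simp]:
  "(mat 1 :: ('a::semiring_1)^2^2) $ 1 $ 1 = 1" "(mat 1 :: ('a::semiring_1)^2^2) $ 1 $ 2 = 0"
  "(mat 1 :: ('a::semiring_1)^2^2) $ 2 $ 1 = 0" "(mat 1 :: ('a::semiring_1)^2^2) $ 2 $ 2 = 1"
  by (simp_all add: mat_def)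

lemma minus_matrix_mult:
  fixes A B :: "('a::ring_1)^2^2"
  shows "(- A) ** B = - (A ** B)" "A ** (- B) = - (A ** B)"
  by (rule mat2_eqI; simp add: matrix_mult_nth2)+

lemma det_uminus2: "det (- (A :: ('a::comm_ring_1)^2^2)) = det A"
  by (simp add: det_2)

text \<open>The adjugate, which is the inverse of a matrix with determinant 1.\<close>

definition adjugate2 :: "('a::comm_ring_1)^2^2 \<Rightarrow> 'a^2^2" where
  "adjugate2 A = mat2 (A$2$2) (- A$1$2) (- A$2$1) (A$1$1)"

lemma adjugate2:
  "det A = 1 \<Longrightarrow> A ** adjugate2 A = mat 1" "det A = 1 \<Longrightarrow> adjugate2 A ** A = mat 1" "det (adjugate2 A) = det A"
  by (rule mat2_eqI; simp add: matrix_mult_nth2 adjugate2_def det_2 algebra_simps)+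
     (simp add: adjugate2_def det_2 algebra_simps)

text \<open>The action of SL(2,R) on the upper half-plane, where no point at infinity is needed.\<close>

definition real_moebius :: "real^2^2 \<Rightarrow> complex \<Rightarrow> complex" where
  "real_moebius \<sigma> z = (of_real (\<sigma>$1$1) * z + of_real (\<sigma>$1$2)) / (of_real (\<sigma>$2$1) * z + of_real (\<sigma>$2$2))"

lemma real_moebius_den:
  fixes \<sigma> :: "real^2^2"
  assumes "det \<sigma> = 1" "Im z > 0"
  shows "of_real (\<sigma>$2$1) * z + of_real (\<sigma>$2$2) \<noteq> 0"
proof
  assume 0: "of_real (\<sigma>$2$1) * z + of_real (\<sigma>$2$2) = 0"
  then have "\<sigma>$2$1 * Im z = 0" by (auto simp: complex_eq_iff)
  then have c: "\<sigma>$2$1 = 0" using assms by simp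
  then have "\<sigma>$2$2 = 0" using 0 by simp
  then show False using c assms(1) by (simp add: det_2)
qed

lemma real_moebius_Im:
  assumes "det \<sigma> = 1" "Im z > 0"
  shows "Im (real_moebius \<sigma> z) = Im z / (cmod (of_real (\<sigma>$2$1) * z + of_real (\<sigma>$2$2)))\<^sup>2"
proof -
  have "Im (real_moebius \<sigma> z) = det \<sigma> * Im z / (cmod (of_real (\<sigma>$2$1) * z + of_real (\<sigma>$2$2)))\<^sup>2"
    unfolding real_moebius_def Im_divide cmod_power2 by (simp add: det_2 algebra_simps)
  then show ?thesis using assms by simp
qed

lemma real_moebius_Im_pos:
  assumes "det \<sigma> = 1" "Im z > 0"
  shows "Im (real_moebius \<sigma> z) > 0"
  unfolding real_moebius_Im[OF assms] using assms real_moebius_den[OF assms] by simp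

lemma real_moebius_mult:
  assumes "det \<sigma> = 1" "det \<tau> = 1" "Im z > 0"
  shows "real_moebius (\<sigma> ** \<tau>) z = real_moebius \<sigma> (real_moebius \<tau> z)"
proof -
  define w where "w = of_real (\<tau>$2$1) * z + of_real (\<tau>$2$2)"
  have w: "w \<noteq> 0" unfolding w_def using real_moebius_den assms by blast
  have t: "real_moebius \<tau> z = (of_real (\<tau>$1$1) * z + of_real (\<tau>$1$2)) / w"
    by (simp add: real_moebius_def w_def)
  have "of_real ((\<sigma> ** \<tau>)$i$1) * z + of_real ((\<sigma> ** \<tau>)$i$2)
      = (of_real (\<sigma>$i$1) * real_moebius \<tau> z + of_real (\<sigma>$i$2)) * w" for i
    unfolding t using w by (simp add: matrix_mult_nth2 field_simps) (simp add: w_def algebra_simps)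
  then show ?thesis
    using w unfolding real_moebius_def[of "\<sigma> ** \<tau>"] real_moebius_def[of \<sigma>] by simp
qed

lemma real_moebius_mat_1 [simp]: "real_moebius (mat 1) z = z"
  by (simp add: real_moebius_def)

lemma real_moebius_has_field_derivative:
  assumes "det \<sigma> = 1" "Im z > 0"
  shows "(real_moebius \<sigma> has_field_derivative 1 / (of_real (\<sigma>$2$1) * z + of_real (\<sigma>$2$2))\<^sup>2) (at z)"
proof -
  define w where "w = of_real (\<sigma>$2$1) * z + of_real (\<sigma>$2$2)"
  have w: "w \<noteq> 0" unfolding w_def using real_moebius_den assms by blast
  have d: "complex_of_real (\<sigma>$1$1) * of_real (\<sigma>$2$2) - of_real (\<sigma>$1$2) * of_real (\<sigma>$2$1) = 1"
    using assms(1) unfolding det_2 by (metis of_real_1 of_real_diff of_real_mult)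
  have "(of_real (\<sigma>$1$1) * w - (of_real (\<sigma>$1$1) * z + of_real (\<sigma>$1$2)) * of_real (\<sigma>$2$1)) / (w * w)
     = 1 / w\<^sup>2"
    using d by (simp add: w_def power2_eq_square algebra_simps)
  moreover have "((\<lambda>z. (of_real (\<sigma>$1$1) * z + of_real (\<sigma>$1$2)) / (of_real (\<sigma>$2$1) * z + of_real (\<sigma>$2$2)))
     has_field_derivative
     (of_real (\<sigma>$1$1) * w - (of_real (\<sigma>$1$1) * z + of_real (\<sigma>$1$2)) * of_real (\<sigma>$2$1)) / (w * w)) (at z)"
    using w unfolding w_def by (auto intro!: derivative_eq_intros)
  ultimately show ?thesis unfolding real_moebius_def[abs_def] w_def by simp
qed

abbreviation real_mat :: "int^2^2 \<Rightarrow> real^2^2" where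
  "real_mat A \<equiv> map_matrix real_of_int A"

lemma real_mat_nth [simp]: "real_mat A $ i $ j = real_of_int (A $ i $ j)"
  by (simp add: map_matrix_def)

lemma det_real_mat [simp]: "det (real_mat A) = real_of_int (det A)"
  by (simp add: det_2)

lemma real_mat_mult: "real_mat (A ** B) = real_mat A ** real_mat B"
  by (rule mat2_eqI) (simp_all add: matrix_mult_nth2)

lemma real_mat_1: "real_mat (mat 1) = mat 1"
  by (rule mat2_eqI) simp_all

lemma act_Some:
  assumes "det A = 1" "Im z > 0"
  shows "act A (Some z) = Some (real_moebius (real_mat A) z)"
proof -
  have "complex_of_int (A$2$1) * z + complex_of_int (A$2$2) \<noteq> 0"
    using real_moebius_den[of "real_mat A" z] assms by (simp only: det_real_mat real_mat_nth of_real_of_int_eq of_int_1 simp_thms)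
  then show ?thesis by (simp add: act_def real_moebius_def map_matrix_def)
qed

lemma moebius_real_Some:
  fixes \<sigma> :: "real^2^2"
  assumes "det \<sigma> = 1" "Im z > 0"
  shows "moebius (map_matrix of_real \<sigma>) (Some z) = Some (real_moebius \<sigma> z)"
  using real_moebius_den[of \<sigma> z] assms by (simp add: real_moebius_def map_matrix_def)

section \<open>Cosets of a subgroup of the modular group\<close>

lemma SL2Z_simps [simp]:
  "carrier SL2Z = {A. det A = 1}" "mult SL2Z = (**)" "one SL2Z = mat 1"
  by (simp_all add: SL2Z_def)

lemma group_SL2Z: "group SL2Z"
proof (rule groupI)
  show "\<exists>B\<in>carrier SL2Z. B \<otimes>\<^bsub>SL2Z\<^esub> A = \<one>\<^bsub>SL2Z\<^esub>" if "A \<in> carrier SL2Z" for A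
    using that by (intro bexI[of _ "adjugate2 A"]) (auto simp: adjugate2)
qed (auto simp: det_mul matrix_mul_assoc)

lemma sign_r_coset: "{mat 1, - mat 1} #>\<^bsub>SL2Z\<^esub> A = {A, - A}"
  by (auto simp: r_coset_def minus_matrix_mult)

lemma sign_l_coset: "A <#\<^bsub>SL2Z\<^esub> {mat 1, - mat 1} = {A, - A}"
  by (auto simp: l_coset_def minus_matrix_mult)

lemma sign_normal: "{mat 1, - mat 1} \<lhd> SL2Z"
proof -
  interpret group SL2Z by (rule group_SL2Z)
  have "subgroup {mat 1, - mat 1} SL2Z"
  proof (rule subgroupI)
    show "inv\<^bsub>SL2Z\<^esub> A \<in> {mat 1, - mat 1}" if "A \<in> {mat 1, - mat 1}" for A
    proof -
      have "inv\<^bsub>SL2Z\<^esub> A = A"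
        using that by (intro inv_equality) (auto simp: minus_matrix_mult det_uminus2)
      then show ?thesis using that by simp
    qed
  qed (auto simp: minus_matrix_mult det_uminus2)
  then show ?thesis
    by (rule normalI) (simp add: sign_r_coset sign_l_coset)
qed

lemma group_PSL2Z: "group PSL2Z"
  unfolding PSL2Z_def by (rule normal.factorgroup_is_group[OF sign_normal])

lemma PSL2Z_mult:
  "det A = 1 \<Longrightarrow> det B = 1 \<Longrightarrow> {A, - A} \<otimes>\<^bsub>PSL2Z\<^esub> {B, - B} = {A ** B, - (A ** B)}"
  using normal.rcos_sum[OF sign_normal, of A B] by (simp add: PSL2Z_def FactGroup_def sign_r_coset)

lemma PSL2Z_one: "\<one>\<^bsub>PSL2Z\<^esub> = {mat 1, - mat 1}"
  by (simp add: PSL2Z_def FactGroup_def)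

lemma PSL2Z_carrier: "det A = 1 \<Longrightarrow> {A, - A} \<in> carrier PSL2Z"
  unfolding PSL2Z_def FactGroup_def RCOSETS_def by (auto simp: sign_r_coset)

lemma mem_SL2Z_preimage: "A \<in> SL2Z_preimage G0 \<longleftrightarrow> det A = 1 \<and> {A, - A} \<in> G0"
  by (simp add: SL2Z_preimage_def sign_r_coset)

text \<open>A subgroup of PSL(2,Z); its preimage in SL(2,Z) is denoted by \<open>\<Gamma>\<close>.\<close>

locale psl_subgroup =
  fixes G0 :: "(int^2^2) set set"
  assumes subgroup_G0: "subgroup G0 PSL2Z"
begin

abbreviation "\<Gamma> \<equiv> SL2Z_preimage G0"

lemma Gamma_det: "A \<in> \<Gamma> \<Longrightarrow> det A = 1"
  by (simp add: mem_SL2Z_preimage)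

lemma Gamma_one: "mat 1 \<in> \<Gamma>"
  using subgroup.one_closed[OF subgroup_G0] by (simp add: mem_SL2Z_preimage PSL2Z_one)

lemma Gamma_mult: "A \<in> \<Gamma> \<Longrightarrow> B \<in> \<Gamma> \<Longrightarrow> A ** B \<in> \<Gamma>"
  using subgroup.m_closed[OF subgroup_G0, of "{A, - A}" "{B, - B}"]
  by (simp add: mem_SL2Z_preimage PSL2Z_mult det_mul)

lemma Gamma_uminus: "A \<in> \<Gamma> \<Longrightarrow> - A \<in> \<Gamma>"
  by (simp add: mem_SL2Z_preimage det_uminus2 insert_commute)

lemma Gamma_adjugate2: "A \<in> \<Gamma> \<Longrightarrow> adjugate2 A \<in> \<Gamma>"
proof -
  assume A: "A \<in> \<Gamma>"
  then have d: "det A = 1" "det (adjugate2 A) = 1" by (simp_all add: Gamma_det adjugate2)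
  have "inv\<^bsub>PSL2Z\<^esub> {A, - A} = {adjugate2 A, - adjugate2 A}"
    by (rule group.inv_equality[OF group_PSL2Z])
       (simp_all add: PSL2Z_mult PSL2Z_one PSL2Z_carrier d adjugate2)
  then show "adjugate2 A \<in> \<Gamma>"
    using A subgroup.m_inv_closed[OF subgroup_G0, of "{A, - A}"] d by (simp add: mem_SL2Z_preimage)
qed

text \<open>The coset \<open>\<Gamma> g\<close>, for integer matrices g of any determinant.\<close>

definition coset :: "int^2^2 \<Rightarrow> (int^2^2) set" where
  "coset g = (\<lambda>A. A ** g) ` \<Gamma>"

lemma coset_self: "g \<in> coset g"
  unfolding coset_def using Gamma_one by (intro image_eqI[of _ _ "mat 1"]) auto

lemma coset_eq: "A \<in> \<Gamma> \<Longrightarrow> coset (A ** g) = coset g"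
proof (intro equalityI subsetI)
  assume A: "A \<in> \<Gamma>"
  show "h \<in> coset g" if "h \<in> coset (A ** g)" for h
    using that A Gamma_mult unfolding coset_def by (auto simp: matrix_mul_assoc)
  show "h \<in> coset (A ** g)" if "h \<in> coset g" for h
  proof -
    from that obtain B where B: "B \<in> \<Gamma>" "h = B ** g" by (auto simp: coset_def)
    have "(B ** adjugate2 A) ** (A ** g) = B ** (adjugate2 A ** A) ** g" by (simp add: matrix_mul_assoc)
    also have "\<dots> = h" using A B by (simp add: adjugate2 Gamma_det)
    finally show ?thesis unfolding coset_def using A B Gamma_mult Gamma_adjugate2 by (metis imageI)
  qed
qed

lemma coset_times: "(\<lambda>h. h ** m) ` coset g = coset (g ** m)"
  by (auto simp: coset_def image_image matrix_mul_assoc)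

lemma finite_SL2Z_cosets:
  assumes "finite (rcosets\<^bsub>PSL2Z\<^esub> G0)"
  shows "finite (coset ` {g. det g = 1})"
proof (rule finite_surj)
  show "finite (rcosets\<^bsub>PSL2Z\<^esub> G0)" by fact
  show "coset ` {g. det g = 1} \<subseteq> (\<Union>) ` (rcosets\<^bsub>PSL2Z\<^esub> G0)"
  proof (clarsimp)
    fix g :: "int^2^2" assume g: "det g = 1"
    have sub: "C \<in> G0 \<Longrightarrow> \<exists>A. det A = 1 \<and> C = {A, - A}" for C
      using subgroup.subset[OF subgroup_G0] unfolding PSL2Z_def FactGroup_def RCOSETS_def
      by (auto simp: sign_r_coset)
    have "coset g = \<Union> (G0 #>\<^bsub>PSL2Z\<^esub> {g, - g})"
    proof (intro equalityI subsetI)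
      fix h assume "h \<in> coset g"
      then obtain A where A: "A \<in> \<Gamma>" "h = A ** g" by (auto simp: coset_def)
      then have "{A, - A} \<otimes>\<^bsub>PSL2Z\<^esub> {g, - g} \<in> G0 #>\<^bsub>PSL2Z\<^esub> {g, - g}"
        by (auto simp: r_coset_def mem_SL2Z_preimage)
      then show "h \<in> \<Union> (G0 #>\<^bsub>PSL2Z\<^esub> {g, - g})"
        using A g by (auto simp: PSL2Z_mult Gamma_det)
    next
      fix h assume "h \<in> \<Union> (G0 #>\<^bsub>PSL2Z\<^esub> {g, - g})"
      then obtain C where C: "C \<in> G0" "h \<in> C \<otimes>\<^bsub>PSL2Z\<^esub> {g, - g}" by (auto simp: r_coset_def)
      obtain A where A: "det A = 1" "C = {A, - A}" using sub[OF C(1)] by blast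
      then have "A \<in> \<Gamma>" using C by (simp add: mem_SL2Z_preimage)
      moreover have "h = A ** g \<or> h = (- A) ** g"
        using C(2) A g by (auto simp: PSL2Z_mult minus_matrix_mult)
      ultimately show "h \<in> coset g" using Gamma_uminus by (auto simp: coset_def)
    qed
    then show "coset g \<in> (\<Union>) ` (rcosets\<^bsub>PSL2Z\<^esub> G0)"
      using PSL2Z_carrier[OF g] by (auto simp: RCOSETS_def)
  qed
qed

end

section \<open>Proper discontinuity and elliptic points\<close>

text \<open>The points of the upper half-plane with a nontrivial stabilizer in PSL(2,Z).\<close>

definition elliptic_points :: "complex set" where
  "elliptic_points = {z. Im z > 0 \<and> (\<exists>A::int^2^2. det A = 1 \<and> A \<noteq> mat 1 \<and> A \<noteq> - mat 1 \<and> real_moebius (real_mat A) z = z)}"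

lemma fixed_point_quadratic:
  assumes "det A = 1" "Im z > 0" "real_moebius (real_mat A) z = z"
  shows "of_int (A$2$1) * z\<^sup>2 + (of_int (A$2$2) - of_int (A$1$1)) * z - of_int (A$1$2) = 0"
proof -
  have "complex_of_int (A$2$1) * z + of_int (A$2$2) \<noteq> 0"
    using real_moebius_den[of "real_mat A" z] assms by (simp only: det_real_mat real_mat_nth of_real_of_int_eq of_int_1 simp_thms)
  then show ?thesis
    using assms(3) unfolding real_moebius_def by (simp add: field_simps power2_eq_square)
qed

lemma elliptic_fixed_point_unique:
  fixes A :: "int^2^2"
  assumes A: "det A = 1" "A \<noteq> mat 1" "A \<noteq> - mat 1"
    and z: "Im z > 0" "real_moebius (real_mat A) z = z" and w: "Im w > 0" "real_moebius (real_mat A) w = w"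
  shows "z = w"
proof (rule ccontr)
  assume neq: "z \<noteq> w"
  let ?a = "A$1$1" and ?b = "A$1$2" and ?c = "A$2$1" and ?d = "A$2$2"
  note qz = fixed_point_quadratic[OF A(1) z] and qw = fixed_point_quadratic[OF A(1) w]
  have "(z - w) * (of_int ?c * (z + w) + (of_int ?d - of_int ?a)) = 0"
    using qz qw by (simp add: power2_eq_square algebra_simps)
  then have "of_int ?c * (z + w) + (of_int ?d - of_int ?a) = 0" using neq by simp
  then have lin: "of_int ?c * (z + w) = of_int (?a - ?d)" by (simp add: algebra_simps)
  have "Im (of_int ?c * (z + w)) = of_int ?c * (Im z + Im w)" by simp
  then have "of_int ?c * (Im z + Im w) = 0" unfolding lin by simp
  then have c: "?c = 0" using z(1) w(1) by simp
  then have ad: "?a = ?d" using lin by simp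
  then have b: "?b = 0" using qz c by simp
  have "?a * ?a = 1" using A(1) c ad by (simp add: det_2)
  then have "?a = 1 \<or> ?a = - 1" by (simp add: zmult_eq_1_iff) 
  then have "A = mat 1 \<or> A = - mat 1"
    using b c ad by (auto intro!: mat2_eqI)
  then show False using A by blast
qed

lemma countable_elliptic_points: "countable elliptic_points"
proof -
  let ?S = "\<lambda>A::int^2^2. {z. Im z > 0 \<and> det A = 1 \<and> A \<noteq> mat 1 \<and> A \<noteq> - mat 1 \<and> real_moebius (real_mat A) z = z}"
  have "countable (?S A)" for A
  proof (cases "?S A = {}")
    case False
    then obtain z where "z \<in> ?S A" by blast
    then have "?S A \<subseteq> {z}" using elliptic_fixed_point_unique by blast
    then show ?thesis by (rule countable_subset) simp
  next
    case True
    then show ?thesis by (simp only: countable_empty)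
  qed
  then have "countable (\<Union>A. ?S A)" by (intro countable_UN) auto
  moreover have "elliptic_points = (\<Union>A. ?S A)" by (auto simp: elliptic_points_def)
  ultimately show ?thesis by simp
qed

lemma finite_bounded_int_matrices: "finite {A :: int^2^2. \<forall>i j. \<bar>A$i$j\<bar> \<le> M}"
proof (rule finite_surj)
  show "finite ({-M..M} \<times> {-M..M} \<times> {-M..M} \<times> {-M..M})" by simp
  show "{A :: int^2^2. \<forall>i j. \<bar>A$i$j\<bar> \<le> M}
      \<subseteq> (\<lambda>(a, b, c, d). mat2 a b c d) ` ({-M..M} \<times> {-M..M} \<times> {-M..M} \<times> {-M..M})"
  proof
    fix A :: "int^2^2" assume "A \<in> {A. \<forall>i j. \<bar>A$i$j\<bar> \<le> M}"
    then have "\<bar>A$i$j\<bar> \<le> M" for i j by simp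
    moreover have "A = mat2 (A$1$1) (A$1$2) (A$2$1) (A$2$2)" by (rule mat2_eqI) simp_all
    ultimately show "A \<in> (\<lambda>(a, b, c, d). mat2 a b c d) ` ({-M..M} \<times> {-M..M} \<times> {-M..M} \<times> {-M..M})"
      by (intro image_eqI[of _ _ "(A$1$1, A$1$2, A$2$1, A$2$2)"]) (auto simp: abs_le_iff minus_le_iff)
  qed
qed

text \<open>If z and its image are near z0 then their imaginary parts have the same size, which bounds
  \<open>cz + d\<close>, hence c and d, and then also \<open>az + b\<close>, hence a and b.\<close>

lemma finite_matrices_near:
  assumes z0: "Im z0 > 0"
  shows "finite {A :: int^2^2. det A = 1 \<and>
    (\<exists>z. cmod (z - z0) \<le> Im z0 / 2 \<and> cmod (real_moebius (real_mat A) z - z0) \<le> Im z0 / 2)}" (is "finite ?S")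
proof -
  define y where "y = Im z0"
  define R where "R = cmod z0 + y"
  define M where "M = \<lceil>max (2 + (4 / y) * R) (2 * R + (4 * R / y) * R + 4 * R / y + 4 / y)\<rceil>"
  have y: "y > 0" and R: "R > 0" using z0 by (auto simp: y_def R_def intro: add_nonneg_pos)
  have near: "y / 2 \<le> Im z" "Im z \<le> 3 * y / 2" "cmod z \<le> R" if "cmod (z - z0) \<le> y / 2" for z
  proof -
    have "\<bar>Im z - y\<bar> \<le> y / 2" using abs_Im_le_cmod[of "z - z0"] that by (simp add: y_def)
    then show "y / 2 \<le> Im z" "Im z \<le> 3 * y / 2" by linarith+
    show "cmod z \<le> R" using norm_triangle_ineq[of z0 "z - z0"] that y by (simp add: R_def)
  qed
  have lin: "\<bar>real_of_int m\<bar> \<le> K * 2 / y \<and> \<bar>real_of_int n\<bar> \<le> K + K * 2 / y * R"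
    if z: "y / 2 \<le> Im z" "cmod z \<le> R" and K: "cmod (of_int m * z + of_int n) \<le> K" for m n z K
  proof -
    have "\<bar>real_of_int m\<bar> * Im z = \<bar>Im (of_int m * z + of_int n)\<bar>"
      using z y by (simp add: abs_mult)
    also have "\<dots> \<le> K" using abs_Im_le_cmod K order_trans by blast
    finally have "\<bar>real_of_int m\<bar> * (y / 2) \<le> K"
      using mult_left_mono[OF z(1), of "\<bar>real_of_int m\<bar>"] by linarith
    then have m: "\<bar>real_of_int m\<bar> \<le> K * 2 / y" using y by (simp add: field_simps)
    have "\<bar>real_of_int n\<bar> = cmod ((of_int m * z + of_int n) - of_int m * z)" by simp
    also have "\<dots> \<le> K + \<bar>real_of_int m\<bar> * cmod z"
      using norm_triangle_ineq4[of "of_int m * z + of_int n" "of_int m * z"] K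
      by (simp add: norm_mult del: add_diff_cancel_left')
    also have "\<bar>real_of_int m\<bar> * cmod z \<le> K * 2 / y * R"
      using m z R by (intro mult_mono) auto
    finally show ?thesis using m by simp
  qed
  have "?S \<subseteq> {A :: int^2^2. \<forall>i j. \<bar>A$i$j\<bar> \<le> M}"
  proof
    fix A :: "int^2^2" assume "A \<in> ?S"
    then obtain z where A: "det A = 1" and z: "cmod (z - z0) \<le> y / 2"
      and Az: "cmod (real_moebius (real_mat A) z - z0) \<le> y / 2" by (auto simp: y_def)
    let ?den = "of_int (A$2$1) * z + complex_of_int (A$2$2)"
    let ?num = "of_int (A$1$1) * z + complex_of_int (A$1$2)"
    have Imz: "Im z > 0" using near(1)[OF z] y by simp
    have den: "?den \<noteq> 0"
      using real_moebius_den[of "real_mat A" z] A Imz by (simp only: det_real_mat real_mat_nth of_real_of_int_eq of_int_1 simp_thms)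
    have mob: "real_moebius (real_mat A) z = ?num / ?den" by (simp add: real_moebius_def)
    have "Im (real_moebius (real_mat A) z) = Im z / (cmod ?den)\<^sup>2"
      using real_moebius_Im[of "real_mat A" z] A Imz by simp
    then have "(cmod ?den)\<^sup>2 * Im (real_moebius (real_mat A) z) = Im z" using den by simp
    moreover have "(cmod ?den)\<^sup>2 * (y / 2) \<le> (cmod ?den)\<^sup>2 * Im (real_moebius (real_mat A) z)"
      using near(1)[OF Az] by (intro mult_left_mono) auto
    ultimately have "(cmod ?den)\<^sup>2 * (y / 2) \<le> 3 * y / 2" using near(2)[OF z] by linarith
    then have "(cmod ?den)\<^sup>2 \<le> 3" using y by (simp add: field_simps)
    then have "(cmod ?den)\<^sup>2 \<le> 2\<^sup>2" by simp
    then have d2: "cmod ?den \<le> 2" by (rule power2_le_imp_le) simp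
    have "?num = real_moebius (real_mat A) z * ?den" using den mob by simp
    then have "cmod ?num = cmod (real_moebius (real_mat A) z) * cmod ?den" by (simp add: norm_mult)
    also have "\<dots> \<le> R * 2" using near(3)[OF Az] d2 R by (intro mult_mono) auto
    finally have n2: "cmod ?num \<le> 2 * R" by simp
    have c: "\<bar>real_of_int (A$2$1)\<bar> \<le> 4 / y" and d: "\<bar>real_of_int (A$2$2)\<bar> \<le> 2 + 4 / y * R"
      using lin[OF near(1,3)[OF z] d2] by auto
    have a: "\<bar>real_of_int (A$1$1)\<bar> \<le> 4 * R / y" and b: "\<bar>real_of_int (A$1$2)\<bar> \<le> 2 * R + 4 * R / y * R"
      using lin[OF near(1,3)[OF z] n2] by (auto simp: mult.commute)
    define u where "u = 4 * R / y" define v where "v = 4 / y"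
    have uv: "u > 0" "v > 0" using y R by (auto simp: u_def v_def)
    have uR: "u * R > 0" "v * R > 0" using uv R by auto
    have M1: "2 + v * R \<le> real_of_int M" "2 * R + u * R + u + v \<le> real_of_int M"
      unfolding M_def u_def v_def by linarith+
    have "\<bar>real_of_int (A$i$j)\<bar> \<le> real_of_int M" for i j
      using exhaust_2[of i] exhaust_2[of j] a b c d M1 uv uR R unfolding u_def[symmetric] v_def[symmetric]
      by (elim disjE) simp_all
    then have "\<bar>A$i$j\<bar> \<le> M" for i j
      by (metis of_int_abs of_int_le_iff)
    then show "A \<in> {A. \<forall>i j. \<bar>A$i$j\<bar> \<le> M}" by simp
  qed
  then show ?thesis by (rule finite_subset) (rule finite_bounded_int_matrices)
qed

lemma properly_discontinuous:
  assumes z0: "Im z0 > 0"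
  obtains \<delta> where "\<delta> > 0" "\<And>A :: int^2^2. \<And>z. det A = 1 \<Longrightarrow> real_moebius (real_mat A) z0 \<noteq> z0 \<Longrightarrow>
    cmod (z - z0) < \<delta> \<Longrightarrow> cmod (real_moebius (real_mat A) z - z0) \<ge> \<delta>"
proof -
  define S where "S = {A :: int^2^2. det A = 1 \<and>
    (\<exists>z. cmod (z - z0) \<le> Im z0 / 2 \<and> cmod (real_moebius (real_mat A) z - z0) \<le> Im z0 / 2)}"
  define S' where "S' = {A \<in> S. real_moebius (real_mat A) z0 \<noteq> z0}"
  have "finite S" unfolding S_def by (rule finite_matrices_near[OF z0])
  then have fin: "finite S'" by (simp add: S'_def)
  have "\<exists>\<delta>>0. \<forall>z. cmod (z - z0) < \<delta> \<longrightarrow> cmod (real_moebius (real_mat A) z - z0) \<ge> \<delta>" if "A \<in> S'" for A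
  proof -
    have A: "det A = 1" "real_moebius (real_mat A) z0 \<noteq> z0" using that by (auto simp: S'_def S_def)
    have "isCont (real_moebius (real_mat A)) z0"
      using real_moebius_has_field_derivative[of "real_mat A" z0] A z0 by (intro DERIV_isCont) auto
    moreover define e where "e = cmod (real_moebius (real_mat A) z0 - z0) / 2"
    have e: "e > 0" using A by (simp add: e_def)
    ultimately obtain d where d: "d > 0" "\<And>z. cmod (z - z0) < d \<Longrightarrow> cmod (real_moebius (real_mat A) z - real_moebius (real_mat A) z0) < e"
      unfolding continuous_at_eps_delta dist_norm by blast
    show ?thesis
    proof (intro exI[of _ "min d e"] conjI allI impI)
      show "0 < min d e" using d e by simp
      fix z assume "cmod (z - z0) < min d e"
      then have "cmod (real_moebius (real_mat A) z - real_moebius (real_mat A) z0) < e" using d by simp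
      moreover have "2 * e \<le> cmod (real_moebius (real_mat A) z - z0) + cmod (real_moebius (real_mat A) z - real_moebius (real_mat A) z0)"
        using norm_triangle_ineq4[of "real_moebius (real_mat A) z - z0" "real_moebius (real_mat A) z - real_moebius (real_mat A) z0"]
        by (simp add: e_def)
      ultimately show "min d e \<le> cmod (real_moebius (real_mat A) z - z0)" by linarith
    qed
  qed
  then obtain \<delta> where \<delta>: "\<And>A. A \<in> S' \<Longrightarrow> \<delta> A > 0"
    "\<And>A z. A \<in> S' \<Longrightarrow> cmod (z - z0) < \<delta> A \<Longrightarrow> cmod (real_moebius (real_mat A) z - z0) \<ge> \<delta> A"
    by metis
  define m where "m = Min (insert (Im z0 / 2) (\<delta> ` S'))"
  have m: "m \<le> Im z0 / 2" "\<And>A. A \<in> S' \<Longrightarrow> m \<le> \<delta> A"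
    unfolding m_def by (rule Min_le; use fin in auto)+
  have mpos: "m > 0" unfolding m_def using fin \<delta>(1) z0 by (subst Min_gr_iff) auto
  show ?thesis
  proof (rule that[OF mpos])
    fix A :: "int^2^2" and z assume A: "det A = 1" "real_moebius (real_mat A) z0 \<noteq> z0" and z: "cmod (z - z0) < m"
    show "m \<le> cmod (real_moebius (real_mat A) z - z0)"
    proof (cases "A \<in> S")
      case True
      then have "A \<in> S'" using A by (simp add: S'_def)
      from \<delta>(2)[OF this, of z] m(2)[OF this] z show ?thesis by linarith
    next
      case False
      have "cmod (z - z0) \<le> Im z0 / 2" using z m(1) by linarith
      then have "\<not> cmod (real_moebius (real_mat A) z - z0) \<le> Im z0 / 2"
        using False A unfolding S_def by blast
      then show ?thesis using m(1) by linarith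
    qed
  qed
qed

lemma hyperbolic_disc_small:
  assumes "Im z0 > 0" "Im z > 0" "r \<le> 1 / 5" "cmod ((z - z0) / (z - cnj z0)) < r"
  shows "cmod (z - z0) < 3 * r * Im z0"
proof -
  have ne: "z - cnj z0 \<noteq> 0" using assms(1,2) by (auto simp: complex_eq_iff)
  have r: "r > 0" using assms(4) by (meson norm_ge_zero order_le_less_trans)
  have "cmod (z - z0) < r * cmod (z - cnj z0)"
    using assms(4) ne by (simp add: norm_divide divide_less_eq)
  also have "cmod (z - cnj z0) \<le> cmod (z - z0) + cmod (z0 - cnj z0)"
    using norm_triangle_ineq[of "z - z0" "z0 - cnj z0"] by simp
  also have "cmod (z0 - cnj z0) = 2 * Im z0"
    using assms(1) by (simp add: complex_diff_cnj norm_mult)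
  finally have "cmod (z - z0) < r * (cmod (z - z0) + 2 * Im z0)" using r by (simp add: mult_left_mono)
  moreover have "r * cmod (z - z0) \<le> 1 / 5 * cmod (z - z0)"
    using assms(3) by (intro mult_right_mono) auto
  ultimately have "4 / 5 * cmod (z - z0) < 2 * (r * Im z0)" by (simp add: algebra_simps)
  moreover have "r * Im z0 > 0" using r assms(1) by simp
  ultimately show ?thesis by linarith
qed

section \<open>The pullback of a differential is automorphic\<close>

lemma act_mat_1: "act (mat 1) y = y"
  by (cases y) (simp_all add: act_def map_matrix_def)

context psl_subgroup
begin

abbreviation "proj z \<equiv> orbit_map G0 (Some z)"

abbreviation "atlas \<equiv> modular_curve_atlas G0"

lemma proj_invariant:
  assumes A: "A \<in> \<Gamma>" and z: "Im z > 0"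
  shows "proj (real_moebius (real_mat A) z) = proj z"
proof -
  have *: "act B (Some (real_moebius (real_mat A) z)) = act (B ** A) (Some z)" if "B \<in> \<Gamma>" for B
    using that A z by (simp add: act_Some real_moebius_Im_pos Gamma_det det_mul real_mat_mult real_moebius_mult)
  have "proj (real_moebius (real_mat A) z) = (\<lambda>B. act (B ** A) (Some z)) ` \<Gamma>"
    unfolding orbit_map_def using * by (intro image_cong) auto
  also have "\<dots> = (\<lambda>C. act C (Some z)) ` coset A"
    by (simp add: coset_def image_image)
  also have "coset A = \<Gamma>"
    using coset_eq[OF A, of "mat 1"] by (simp add: coset_def)
  finally show ?thesis by (simp add: orbit_map_def)
qed

lemma orbit_eqE:
  assumes "orbit_map G0 y = orbit_map G0 x"
  obtains B where "B \<in> \<Gamma>" "y = act B x"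
proof -
  have "y \<in> orbit_map G0 y"
    unfolding orbit_map_def using Gamma_one act_mat_1 by (metis imageI)
  then show ?thesis using that unfolding assms by (auto simp: orbit_map_def)
qed

text \<open>Near a point z with image in the domain of a chart the coordinate is the given function t on N composed with
  an element of \<open>\<Gamma>\<close> that maps z into N.\<close>

lemma chart_from_differentiable:
  assumes C: "chart_from G0 x N t C" and z: "Im z > 0" "proj z \<in> fst C"
    and N: "\<And>y. Im y > 0 \<Longrightarrow> Some y \<in> N \<Longrightarrow>
      (\<forall>\<^sub>F w in nhds y. Some w \<in> N) \<and> (\<lambda>w. t (Some w)) field_differentiable at y"
  shows "(\<lambda>w. snd C (proj w)) field_differentiable at z"
proof -
  obtain y where y: "y \<in> N" "orbit_map G0 y = proj z"
    using C z(2) unfolding chart_from_def by auto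
  obtain B where B: "B \<in> \<Gamma>" "y = act B (Some z)" using orbit_eqE[OF y(2)] .
  let ?g = "real_moebius (real_mat B)"
  have dB: "det (real_mat B) = 1" using B by (simp add: Gamma_det)
  have y_eq: "y = Some (?g z)" using B z by (simp add: act_Some Gamma_det)
  have Im: "Im (?g z) > 0" by (rule real_moebius_Im_pos[OF dB z(1)])
  obtain g' where g': "(?g has_field_derivative g') (at z)"
    using real_moebius_has_field_derivative[OF dB z(1)] by blast
  have ev: "\<forall>\<^sub>F w in nhds (?g z). Some w \<in> N"
    and diff: "(\<lambda>w. t (Some w)) field_differentiable at (?g z)"
    using N[OF Im] y(1) y_eq by auto
  have "isCont ?g z" using g' by (rule DERIV_isCont)
  then have "filterlim ?g (nhds (?g z)) (nhds z)" by (simp add: continuous_at_imp_continuous_at_within isCont_def tendsto_at_iff_tendsto_nhds)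
  then have ev1: "\<forall>\<^sub>F w in nhds z. Some (?g w) \<in> N"
    using ev by (rule eventually_compose_filterlim[rotated])
  have ev2: "\<forall>\<^sub>F w in nhds z. Im w > 0"
    using z(1) by (intro eventually_nhds_in_open[of "{w. Im w > 0}", simplified] open_halfspace_Im_gt)
  have "\<forall>\<^sub>F w in nhds z. w \<in> UNIV \<longrightarrow> snd C (proj w) = t (Some (?g w))"
    using ev1 ev2
  proof eventually_elim
    case (elim w)
    then have "snd C (proj (?g w)) = t (Some (?g w))" using C by (simp add: chart_from_def)
    then show ?case using proj_invariant[OF B(1) elim(2)] by simp
  qed
  moreover obtain D where "((\<lambda>w. t (Some w)) has_field_derivative D) (at (?g z))"
    using diff by (auto simp: field_differentiable_def)
  then have "((\<lambda>w. t (Some (?g w))) has_field_derivative D * g') (at z)"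
    using g' by (rule DERIV_chain2)
  ultimately have "((\<lambda>w. snd C (proj w)) has_field_derivative D * g') (at z)"
    by (subst has_field_derivative_cong_ev[OF refl _ refl refl]) auto
  then show ?thesis by (auto simp: field_differentiable_def)
qed

lemma atlas_differentiable:
  assumes C: "C \<in> atlas" and z: "Im z > 0" "proj z \<in> fst C"
  shows "(\<lambda>w. snd C (proj w)) field_differentiable at z"
  using C unfolding modular_curve_atlas_def
proof
  assume "C \<in> interior_charts G0"
  then obtain z0 r where z0: "Im z0 > 0" and r: "r > 0" and C: "chart_from G0 (Some z0)
       {Some z | z. Im z > 0 \<and> cmod ((z - z0) / (z - cnj z0)) < r}
       (\<lambda>y. ((the y - z0) / (the y - cnj z0)) ^ stabilizer_order G0 z0) C"
    unfolding interior_charts_def by blast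
  show ?thesis
  proof (rule chart_from_differentiable[OF C z])
    fix y assume Im: "Im y > 0" and y: "Some y \<in> {Some z | z. Im z > 0 \<and> cmod ((z - z0) / (z - cnj z0)) < r}"
    have ne: "y - cnj z0 \<noteq> 0" using Im z0 by (auto simp: complex_eq_iff)
    have "\<forall>\<^sub>F w in nhds y. Im w > 0"
      using Im by (intro eventually_nhds_in_open[of "{w. Im w > 0}", simplified] open_halfspace_Im_gt)
    moreover have "((\<lambda>w. cmod ((w - z0) / (w - cnj z0))) \<longlongrightarrow> cmod ((y - z0) / (y - cnj z0))) (nhds y)"
      using ne by (intro tendsto_intros filterlim_ident) auto
    then have "\<forall>\<^sub>F w in nhds y. cmod ((w - z0) / (w - cnj z0)) < r"
      using y by (intro order_tendstoD) auto
    ultimately have "\<forall>\<^sub>F w in nhds y. Some w \<in> {Some z | z. Im z > 0 \<and> cmod ((z - z0) / (z - cnj z0)) < r}"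
      by eventually_elim auto
    moreover have "(\<lambda>w. ((the (Some w) - z0) / (the (Some w) - cnj z0)) ^ stabilizer_order G0 z0)
        field_differentiable at y"
      using ne by (auto intro!: derivative_intros)
    ultimately show "(\<forall>\<^sub>F w in nhds y. Some w \<in> {Some z | z. Im z > 0 \<and> cmod ((z - z0) / (z - cnj z0)) < r}) \<and>
      (\<lambda>w. ((the (Some w) - z0) / (the (Some w) - cnj z0)) ^ stabilizer_order G0 z0) field_differentiable at y" ..
  qed
next
  assume "C \<in> cusp_charts G0"
  then obtain \<sigma> r t where \<sigma>: "\<sigma> \<in> carrier SL2Z" and r: "r > 0"
    and t: "\<And>z. Im z > r \<Longrightarrow> t (act \<sigma> (Some z)) = exp (2 * of_real pi * \<i> * z / of_nat (cusp_width G0 \<sigma>))"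
    and C: "chart_from G0 (act \<sigma> None) (act \<sigma> ` insert None {Some z | z. Im z > r}) t C"
    unfolding cusp_charts_def by blast
  have det: "det \<sigma> = 1" using \<sigma> by simp
  let ?N = "act \<sigma> ` insert None {Some z | z. Im z > r}"
  let ?h = "real_moebius (real_mat (adjugate2 \<sigma>))"
  have det': "det (real_mat (adjugate2 \<sigma>)) = 1" using det by (simp add: adjugate2)
  have inv: "act \<sigma> (Some (?h w)) = Some w" if "Im w > 0" for w
    using that det det'
    by (simp add: act_Some real_moebius_Im_pos adjugate2 flip: real_moebius_mult real_mat_mult) (simp add: real_mat_1)
  show ?thesis
  proof (rule chart_from_differentiable[OF C z])
    fix y assume Im: "Im y > 0" and y: "Some y \<in> ?N"
    have "Some y \<noteq> act \<sigma> None"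
      using Im by (auto simp: act_def map_matrix_def complex_eq_iff)
    then obtain z1 where z1: "Im z1 > r" "Some y = act \<sigma> (Some z1)" using y by auto
    have y_eq: "y = real_moebius (real_mat \<sigma>) z1" using z1 r det by (simp add: act_Some)
    have hy: "?h y = z1"
      unfolding y_eq using z1 r det det'
      by (simp add: adjugate2 flip: real_moebius_mult real_mat_mult) (simp add: real_mat_1)
    have dh: "(?h has_field_derivative 1 / (of_real (real_mat (adjugate2 \<sigma>)$2$1) * y + of_real (real_mat (adjugate2 \<sigma>)$2$2))\<^sup>2) (at y)"
      by (rule real_moebius_has_field_derivative[OF det' Im])
    have "(?h \<longlongrightarrow> ?h y) (nhds y)"
      using DERIV_isCont[OF dh] by (simp add: isCont_def tendsto_at_iff_tendsto_nhds)
    then have "((\<lambda>w. Im (?h w)) \<longlongrightarrow> Im z1) (nhds y)"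
      unfolding hy by (intro tendsto_Im)
    then have ev1: "\<forall>\<^sub>F w in nhds y. Im (?h w) > r" using z1 by (intro order_tendstoD) auto
    have ev2: "\<forall>\<^sub>F w in nhds y. Im w > 0"
      using Im by (intro eventually_nhds_in_open[of "{w. Im w > 0}", simplified] open_halfspace_Im_gt)
    have "\<forall>\<^sub>F w in nhds y. Some w \<in> ?N"
      using ev1 ev2
    proof eventually_elim
      case (elim w)
      then show ?case using inv[of w] by (intro image_eqI[of _ _ "Some (?h w)"]) auto
    qed
    moreover have "(\<lambda>w. t (Some w)) field_differentiable at y"
    proof -
      let ?E = "\<lambda>w. exp (2 * of_real pi * \<i> * ?h w / of_nat (cusp_width G0 \<sigma>))"
      define k where "k = 2 * of_real pi * \<i> / of_nat (cusp_width G0 \<sigma>)"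
      have E: "?E = (\<lambda>w. exp (k * ?h w))" by (simp add: k_def)
      have "\<forall>\<^sub>F w in nhds y. w \<in> UNIV \<longrightarrow> t (Some w) = ?E w"
        using ev1 ev2
      proof eventually_elim
        case (elim w)
        then show ?case using t[of "?h w"] inv[of w] by simp
      qed
      moreover have "\<exists>D. (?E has_field_derivative D) (at y)"
        unfolding E by (rule exI, rule DERIV_chain2[OF DERIV_exp DERIV_cmult[OF dh]])
      ultimately show ?thesis
        unfolding field_differentiable_def
        by (subst has_field_derivative_cong_ev[OF refl _ refl refl]) auto
    qed
    ultimately show "(\<forall>\<^sub>F w in nhds y. Some w \<in> ?N) \<and> (\<lambda>w. t (Some w)) field_differentiable at y" ..
  qed
qed

text \<open>A sufficiently small disc around z0 meets each orbit at most once.  So the coordinate is well defined on its image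
  whatever the exponent is.\<close>

lemma chart_at_nonelliptic:
  assumes z0: "Im z0 > 0" "z0 \<notin> elliptic_points"
  shows "\<exists>C\<in>atlas. proj z0 \<in> fst C"
proof -
  obtain \<delta> where \<delta>: "\<delta> > 0" "\<And>A :: int^2^2. \<And>z. det A = 1 \<Longrightarrow> real_moebius (real_mat A) z0 \<noteq> z0 \<Longrightarrow>
    cmod (z - z0) < \<delta> \<Longrightarrow> cmod (real_moebius (real_mat A) z - z0) \<ge> \<delta>"
    using properly_discontinuous[OF z0(1)] by blast
  \<comment> \<open>A hyperbolic disc of this radius lies in the Euclidean disc of radius \<open>\<delta>\<close>.\<close>
  define r where "r = min (1 / 5) (\<delta> / (3 * Im z0))"
  have r: "r > 0" "r \<le> 1 / 5" using \<delta> z0 by (auto simp: r_def)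
  have r3: "3 * r * Im z0 \<le> \<delta>" using z0 by (simp add: r_def min_def field_simps)
  let ?N = "{Some z | z. Im z > 0 \<and> cmod ((z - z0) / (z - cnj z0)) < r}"
  let ?t = "\<lambda>y. ((the y - z0) / (the y - cnj z0)) ^ stabilizer_order G0 z0"
  have stab: "A = mat 1 \<or> A = - mat 1"
    if A: "A \<in> \<Gamma>" and y: "y \<in> ?N" "act A y \<in> ?N" for A y
  proof -
    obtain z where z: "y = Some z" "Im z > 0" "cmod ((z - z0) / (z - cnj z0)) < r" using y by blast
    have "act A y = Some (real_moebius (real_mat A) z)" using z A by (simp add: act_Some Gamma_det)
    then have w: "Im (real_moebius (real_mat A) z) > 0"
        "cmod ((real_moebius (real_mat A) z - z0) / (real_moebius (real_mat A) z - cnj z0)) < r" using y(2) by auto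
    have "cmod (z - z0) < \<delta>" "cmod (real_moebius (real_mat A) z - z0) < \<delta>"
      using hyperbolic_disc_small[OF z0(1) z(2) r(2) z(3)] hyperbolic_disc_small[OF z0(1) w(1) r(2) w(2)] r3
      by linarith+
    then have "real_moebius (real_mat A) z0 = z0" using \<delta>(2)[OF Gamma_det[OF A]] by force
    then show ?thesis using z0 Gamma_det[OF A] by (auto simp: elliptic_points_def)
  qed
  have act_sign: "act A y = y" if "A = mat 1 \<or> A = - mat 1" for A y
    using that by (cases y) (auto simp: act_def map_matrix_def)
  have inj: "y = y'" if *: "y \<in> ?N" "y' \<in> ?N" "orbit_map G0 y = orbit_map G0 y'" for y y'
  proof -
    obtain B where B: "B \<in> \<Gamma>" "y = act B y'" using orbit_eqE[OF *(3)] .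
    then have "B = mat 1 \<or> B = - mat 1" using stab[OF B(1) *(2)] *(1) by simp
    then show ?thesis using B(2) act_sign by simp
  qed
  define c where "c u = (if u \<in> orbit_map G0 ` ?N then ?t (THE y. y \<in> ?N \<and> orbit_map G0 y = u) else 0)" for u
  have c: "c (orbit_map G0 y) = ?t y" if y: "y \<in> ?N" for y
  proof -
    have "(THE y'. y' \<in> ?N \<and> orbit_map G0 y' = orbit_map G0 y) = y"
      by (rule the_equality) (use y inj in blast)+
    then show ?thesis using y by (simp only: c_def imageI if_True)
  qed
  have "chart_from G0 (Some z0) ?N ?t (orbit_map G0 ` ?N, c)"
    unfolding chart_from_def
  proof (intro conjI ballI impI allI)
    show "act A (Some z0) = Some z0" if "A \<in> \<Gamma>" "y \<in> ?N" "act A y \<in> ?N" for A y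
      using stab[OF that] act_sign by blast
    show "snd (orbit_map G0 ` ?N, c) (orbit_map G0 y) = ?t y" if "y \<in> ?N" for y
      using c[OF that] by simp
    show "snd (orbit_map G0 ` ?N, c) u = 0" if "u \<notin> fst (orbit_map G0 ` ?N, c)" for u
      using that by (auto simp: c_def)
  qed simp
  then have "(orbit_map G0 ` ?N, c) \<in> interior_charts G0"
    unfolding interior_charts_def using z0(1) r(1) by blast
  moreover have "Some z0 \<in> ?N" using z0(1) r(1) by simp
  then have "proj z0 \<in> fst (orbit_map G0 ` ?N, c)" by (simp only: fst_conv imageI)
  ultimately show ?thesis unfolding modular_curve_atlas_def by blast
qed

text \<open>The coefficient f of the pullback f(z) dz of a differential to the upper half-plane.\<close>

definition pullback :: "(complex option set) differential \<Rightarrow> complex \<Rightarrow> complex" where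
  "pullback \<omega> = pullback_coeff atlas proj \<omega>"

text \<open>The definition of the pullback chooses a chart by a choice operator that depends only on the orbit, so the same
  chart is chosen at z and at its image, and the chain rule gives the transformation law.\<close>

lemma pullback_automorphic:
  assumes A: "A \<in> \<Gamma>" and z: "Im z > 0" "z \<notin> elliptic_points"
  shows "pullback \<omega> (real_moebius (real_mat A) z) / (of_int (A$2$1) * z + of_int (A$2$2))\<^sup>2 = pullback \<omega> z"
proof -
  let ?g = "real_moebius (real_mat A)"
  have det: "det (real_mat A) = 1" using A by (simp add: Gamma_det)
  define C where "C = (SOME C. C \<in> atlas \<and> proj z \<in> fst C)"
  have C: "C \<in> atlas" "proj z \<in> fst C"
    using someI_ex[OF chart_at_nonelliptic[OF z, unfolded Bex_def]] by (simp_all add: C_def)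
  have pz: "proj (?g z) = proj z" by (rule proj_invariant[OF A z(1)])
  have Im: "Im (?g z) > 0" by (rule real_moebius_Im_pos[OF det z(1)])
  obtain D where D: "((\<lambda>w. snd C (proj w)) has_field_derivative D) (at (?g z))"
    using atlas_differentiable[OF C(1) Im] C(2) pz by (auto simp: field_differentiable_def)
  let ?g' = "1 / (of_int (A$2$1) * z + of_int (A$2$2))\<^sup>2 :: complex"
  have "(?g has_field_derivative ?g') (at z)"
    using real_moebius_has_field_derivative[OF det z(1)] by simp
  then have "((\<lambda>w. snd C (proj (?g w))) has_field_derivative D * ?g') (at z)"
    by (rule DERIV_chain2[where f = "\<lambda>w. snd C (proj w)" and g = ?g and x = z, OF D])
  moreover have "\<forall>\<^sub>F w in nhds z. Im w > 0"
    using z(1) by (intro eventually_nhds_in_open[of "{w. Im w > 0}", simplified] open_halfspace_Im_gt)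
  then have "\<forall>\<^sub>F w in nhds z. w \<in> UNIV \<longrightarrow> snd C (proj (?g w)) = snd C (proj w)"
    by eventually_elim (simp add: proj_invariant[OF A])
  ultimately have "((\<lambda>w. snd C (proj w)) has_field_derivative D * ?g') (at z)"
    by (subst (asm) has_field_derivative_cong_ev[OF refl _ refl refl]) auto
  then have dz: "deriv (\<lambda>w. snd C (proj w)) z = D * ?g'" by (rule DERIV_imp_deriv)
  have dgz: "deriv (\<lambda>w. snd C (proj w)) (?g z) = D" by (rule DERIV_imp_deriv[OF D])
  have "pullback \<omega> z = \<omega> C (snd C (proj z)) * (D * ?g')"
    unfolding pullback_def pullback_coeff_def C_def[symmetric] dz[symmetric] by (simp add: case_prod_beta)
  moreover have "pullback \<omega> (?g z) = \<omega> C (snd C (proj z)) * D"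
    unfolding pullback_def pullback_coeff_def pz C_def[symmetric] dgz[symmetric] by (simp add: case_prod_beta)
  ultimately show ?thesis by simp
qed

end

section \<open>Integrals along geodesics between cusps\<close>

text \<open>The oriented geodesic \<open>s \<mapsto> \<sigma>(i exp s)\<close> and its derivative.\<close>

definition geodesic_curve :: "real^2^2 \<Rightarrow> real \<Rightarrow> complex" where
  "geodesic_curve \<sigma> s = real_moebius \<sigma> (\<i> * of_real (exp s))"

definition geodesic_velocity :: "real^2^2 \<Rightarrow> real \<Rightarrow> complex" where
  "geodesic_velocity \<sigma> s = 1 / (of_real (\<sigma>$2$1) * (\<i> * of_real (exp s)) + of_real (\<sigma>$2$2))\<^sup>2 * (\<i> * of_real (exp s))"

text \<open>The integral along the whole geodesic, which is 0 by convention if it does not converge absolutely.\<close>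

definition full_geodesic_integral :: "(complex \<Rightarrow> complex) \<Rightarrow> real^2^2 \<Rightarrow> complex" where
  "full_geodesic_integral f \<sigma> = (LINT s|lborel. f (geodesic_curve \<sigma> s) * geodesic_velocity \<sigma> s)"

lemma axis_Im: "Im (\<i> * of_real (exp s)) > 0"
  by simp

lemma geodesic_curve_has_vector_derivative:
  assumes "det \<sigma> = 1"
  shows "(geodesic_curve \<sigma> has_vector_derivative geodesic_velocity \<sigma> s) (at s)"
proof -
  have "((\<lambda>s. \<i> * complex_of_real (exp s)) has_vector_derivative \<i> * of_real (exp s)) (at s)"
    by (auto intro!: derivative_eq_intros has_vector_derivative_mult_right has_vector_derivative_of_real
        simp flip: has_real_derivative_iff_has_vector_derivative)
  from field_vector_diff_chain_at[OF this real_moebius_has_field_derivative[OF assms axis_Im]]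
  show ?thesis unfolding geodesic_curve_def[abs_def] geodesic_velocity_def o_def by (simp add: mult.commute)
qed

lemma imaginary_axis_simps [simp]:
  "imaginary_axis (ereal r) = Some (\<i> * of_real (exp r))"
  "imaginary_axis \<infinity> = None" "imaginary_axis (- \<infinity>) = Some 0"
  by (simp_all add: imaginary_axis_def)

lemma geodesic_point_ereal:
  "det \<sigma> = 1 \<Longrightarrow> geodesic_point \<sigma> (ereal s) = Some (geodesic_curve \<sigma> s)"
  unfolding geodesic_point_def geodesic_curve_def by (simp add: moebius_real_Some del: moebius.simps)

lemma geodesic_point_infinity:
  "geodesic_point \<sigma> \<infinity> = (if \<sigma>$2$1 = 0 then None else Some (of_real (\<sigma>$1$1 / \<sigma>$2$1)))"
  "geodesic_point \<sigma> (- \<infinity>) = (if \<sigma>$2$2 = 0 then None else Some (of_real (\<sigma>$1$2 / \<sigma>$2$2)))"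
  by (simp_all add: geodesic_point_def map_matrix_def)

lemma geodesic_curve_Im: "det \<sigma> = 1 \<Longrightarrow> Im (geodesic_curve \<sigma> s) > 0"
  unfolding geodesic_curve_def using real_moebius_Im_pos axis_Im by blast

lemma same_endpoints_cross:
  fixes a b c d :: real
  assumes "(if b = 0 then None else Some (complex_of_real (a / b)))
         = (if d = 0 then None else Some (complex_of_real (c / d)))"
  shows "a * d = c * b"
  using assms by (auto split: if_splits simp: field_simps simp flip: of_real_divide)

text \<open>Two matrices with the same images of 0 and of \<open>\<infinity>\<close> differ by a diagonal matrix, which shifts the
  parameter of the geodesic.\<close>

lemma full_geodesic_integral_same_endpoints:
  assumes \<sigma>: "det \<sigma> = 1" and \<tau>: "det \<tau> = 1"
    and "geodesic_point \<sigma> (- \<infinity>) = geodesic_point \<tau> (- \<infinity>)" "geodesic_point \<sigma> \<infinity> = geodesic_point \<tau> \<infinity>"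
  shows "full_geodesic_integral f \<tau> = full_geodesic_integral f \<sigma>"
proof -
  have x1: "\<sigma>$1$1 * \<tau>$2$1 = \<tau>$1$1 * \<sigma>$2$1" and x2: "\<sigma>$1$2 * \<tau>$2$2 = \<tau>$1$2 * \<sigma>$2$2"
    using assms(3,4)[unfolded geodesic_point_infinity] by (auto dest: same_endpoints_cross)
  \<comment> \<open>The ratios of the first and of the second columns, written as determinants so that no entry
     has to be inverted.\<close>
  define l where "l = \<tau>$1$1 * \<sigma>$2$2 - \<tau>$2$1 * \<sigma>$1$2"
  define m where "m = \<sigma>$1$1 * \<tau>$2$2 - \<sigma>$2$1 * \<tau>$1$2"
  have ds: "\<sigma>$1$1 * \<sigma>$2$2 - \<sigma>$1$2 * \<sigma>$2$1 = 1" using \<sigma> by (simp add: det_2)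
  have dt: "\<tau>$1$1 * \<tau>$2$2 - \<tau>$1$2 * \<tau>$2$1 = 1" using \<tau> by (simp add: det_2)
  have t11: "\<tau>$1$1 = l * \<sigma>$1$1" unfolding l_def using ds x1 by algebra
  have t21: "\<tau>$2$1 = l * \<sigma>$2$1" unfolding l_def using ds x1 by algebra
  have t12: "\<tau>$1$2 = m * \<sigma>$1$2" unfolding m_def using ds x2 by algebra
  have t22: "\<tau>$2$2 = m * \<sigma>$2$2" unfolding m_def using ds x2 by algebra
  have lm: "l * m = 1" using dt ds unfolding t11 t21 t12 t22 by algebra
  then have l0: "l \<noteq> 0" by auto
  have m_eq: "m = 1 / l" using lm l0 by (simp add: field_simps)
  define c where "c = ln (l\<^sup>2)"
  have ec: "exp (s + c) = l\<^sup>2 * exp s" for s using l0 by (simp add: c_def exp_add)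
  have lin: "of_real (l * u) * (\<i> * of_real (exp s)) + complex_of_real (m * v)
      = (of_real u * (\<i> * of_real (exp (s + c))) + of_real v) / of_real l" for u v s
    unfolding ec m_eq using l0 by (simp add: field_simps power2_eq_square)
  have geodesic_curve: "geodesic_curve \<tau> s = geodesic_curve \<sigma> (s + c)" for s
    unfolding geodesic_curve_def real_moebius_def t11 t12 t21 t22 lin using l0 by simp
  have geodesic_velocity: "geodesic_velocity \<tau> s = geodesic_velocity \<sigma> (s + c)" for s
    unfolding geodesic_velocity_def t21 t22 lin using l0 by (simp add: ec power_divide)
  have "full_geodesic_integral f \<sigma> = (LINT s|lborel. f (geodesic_curve \<sigma> (c + 1 * s)) * geodesic_velocity \<sigma> (c + 1 * s))"
    unfolding full_geodesic_integral_def using lborel_integral_real_affine[of 1 "\<lambda>s. f (geodesic_curve \<sigma> s) * geodesic_velocity \<sigma> s" c] by simp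
  also have "\<dots> = full_geodesic_integral f \<tau>" unfolding full_geodesic_integral_def geodesic_curve geodesic_velocity by (simp add: add.commute)
  finally show ?thesis by simp
qed

lemma geodesic_integral_eq_full:
  assumes \<sigma>: "det \<sigma> = 1"
  shows "geodesic_integral f (geodesic_point \<sigma> (- \<infinity>)) (geodesic_point \<sigma> \<infinity>) = full_geodesic_integral f \<sigma>"
proof -
  let ?\<alpha> = "geodesic_point \<sigma> (- \<infinity>)" and ?\<beta> = "geodesic_point \<sigma> \<infinity>"
  obtain \<tau> a b where some: "(SOME g. geodesic_arc ?\<alpha> ?\<beta> g) = (\<tau>, a, b)" by (metis prod_cases3)
  have "geodesic_arc ?\<alpha> ?\<beta> (\<sigma>, - \<infinity>, \<infinity>)" using \<sigma> by (simp add: geodesic_arc_def)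
  then have "geodesic_arc ?\<alpha> ?\<beta> (\<tau>, a, b)" unfolding some[symmetric] by (rule someI)
  then have \<tau>: "det \<tau> = 1" and ab: "a \<le> b" and a: "geodesic_point \<tau> a = ?\<alpha>" and b: "geodesic_point \<tau> b = ?\<beta>"
    by (auto simp: geodesic_arc_def)
  have cusp: "geodesic_point \<tau> (ereal r) \<noteq> geodesic_point \<sigma> e" if "\<bar>e\<bar> = \<infinity>" for r e
    using geodesic_curve_Im[OF \<tau>, of r] that unfolding geodesic_point_ereal[OF \<tau>]
    by (cases e) (auto simp: geodesic_point_infinity)
  have neq: "?\<alpha> \<noteq> ?\<beta>"
  proof
    assume "?\<alpha> = ?\<beta>"
    then have "\<sigma>$1$2 * \<sigma>$2$1 = \<sigma>$1$1 * \<sigma>$2$2"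
      unfolding geodesic_point_infinity by (rule same_endpoints_cross)
    then show False using \<sigma> by (simp add: det_2)
  qed
  have ai: "a = - \<infinity> \<and> b = \<infinity>"
    using a b ab neq cusp[of "- \<infinity>"] cusp[of \<infinity>] by (cases a; cases b) auto
  have "geodesic_integral f ?\<alpha> ?\<beta>
      = (LBINT s=-\<infinity>..\<infinity>. f (the (geodesic_point \<tau> (ereal s)))
          * vector_derivative (\<lambda>s. the (geodesic_point \<tau> (ereal s))) (at s))"
    unfolding geodesic_integral_def some using ai by simp
  also have "\<dots> = (LBINT s=-\<infinity>..\<infinity>. f (geodesic_curve \<tau> s) * geodesic_velocity \<tau> s)"
    using vector_derivative_at[OF geodesic_curve_has_vector_derivative[OF \<tau>]]
    by (simp add: geodesic_point_ereal[OF \<tau>])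
  also have "\<dots> = full_geodesic_integral f \<tau>"
    by (simp add: interval_lebesgue_integral_def full_geodesic_integral_def set_lebesgue_integral_def)
  also have "\<dots> = full_geodesic_integral f \<sigma>"
    using a b ai by (intro full_geodesic_integral_same_endpoints[OF \<sigma> \<tau>]) auto
  finally show ?thesis .
qed

text \<open>For g of determinant 1 or -1 this is a matrix of determinant 1 that maps 0 to \<open>g \<infinity>\<close> and
  \<open>\<infinity>\<close> to g 0.\<close>

definition geodesic_matrix :: "int^2^2 \<Rightarrow> real^2^2" where
  "geodesic_matrix g = real_mat (mat2 (g$1$2) (- det g * g$1$1) (g$2$2) (- det g * g$2$1))"

text \<open>The integral of f(z) dz over the modular symbol \<open>{g \<infinity>, g 0}\<close>.\<close>

definition cusp_symbol :: "(complex \<Rightarrow> complex) \<Rightarrow> int^2^2 \<Rightarrow> complex" where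
  "cusp_symbol f g = geodesic_integral f (act g None) (act g (Some 0))"

lemma det_geodesic_matrix:
  assumes "det g = 1 \<or> det g = - 1"
  shows "det (geodesic_matrix g) = 1"
proof -
  have "det (mat2 (g$1$2) (- det g * g$1$1) (g$2$2) (- det g * g$2$1)) = det g * det g"
    by (simp add: det_2 algebra_simps)
  also have "\<dots> = 1" using assms by auto
  finally show ?thesis by (simp add: geodesic_matrix_def)
qed

lemma cusp_symbol_eq_full:
  assumes g: "det g = 1 \<or> det g = - 1"
  shows "cusp_symbol f g = full_geodesic_integral f (geodesic_matrix g)"
proof -
  have "act g None = geodesic_point (geodesic_matrix g) (- \<infinity>)"
    using g unfolding geodesic_point_infinity by (auto simp: act_def map_matrix_def geodesic_matrix_def)
  moreover have "act g (Some 0) = geodesic_point (geodesic_matrix g) \<infinity>"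
    using g unfolding geodesic_point_infinity by (auto simp: act_def map_matrix_def geodesic_matrix_def)
  ultimately show ?thesis
    unfolding cusp_symbol_def using geodesic_integral_eq_full[OF det_geodesic_matrix[OF g]] by simp
qed

text \<open>This matrix exchanges 0 and \<open>\<infinity>\<close>, so it reverses the geodesic.\<close>

definition swap_matrix :: "int^2^2" where "swap_matrix = mat2 0 1 1 0"

lemma det_swap_matrix: "det swap_matrix = - 1"
  by (simp add: swap_matrix_def det_2)

lemma cusp_symbol_swap:
  assumes g: "det g = 1 \<or> det g = - 1"
  shows "cusp_symbol f (g ** swap_matrix) = - cusp_symbol f g"
proof -
  let ?\<sigma> = "geodesic_matrix g" and ?\<tau> = "geodesic_matrix (g ** swap_matrix)"
  have dg: "det (g ** swap_matrix) = - det g" by (simp add: det_mul det_swap_matrix)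
  have g': "det (g ** swap_matrix) = 1 \<or> det (g ** swap_matrix) = - 1" unfolding dg using g by auto
  define d :: complex where "d = of_int (det g)"
  have d: "d * d = 1" using g by (auto simp: d_def)
  have lin: "of_real (?\<tau>$i$1) * (\<i> * of_real (exp s)) + of_real (?\<tau>$i$2)
      = (of_real (?\<sigma>$i$1) * (\<i> * of_real (exp (- s))) + of_real (?\<sigma>$i$2)) * (- d * \<i> * of_real (exp s))"
    if "i = 1 \<or> i = 2" for i s
  proof -
    have e: "complex_of_real (exp (- s)) * of_real (exp s) = 1"
      by (simp flip: of_real_mult exp_add)
    have \<tau>: "of_real (?\<tau>$i$1) = (of_int (g$i$1) :: complex)" "of_real (?\<tau>$i$2) = d * of_int (g$i$2)"
      using that unfolding geodesic_matrix_def dg by (auto simp: matrix_mult_nth2 swap_matrix_def d_def)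
    have \<sigma>: "of_real (?\<sigma>$i$1) = (of_int (g$i$2) :: complex)" "of_real (?\<sigma>$i$2) = - d * of_int (g$i$1)"
      using that by (auto simp: geodesic_matrix_def d_def)
    have "\<i> * \<i> = -1" by simp
    then show ?thesis unfolding \<sigma> \<tau> using d e by algebra
  qed
  have d0: "d \<noteq> 0" using d by auto
  have geodesic_curve: "geodesic_curve ?\<tau> s = geodesic_curve ?\<sigma> (- s)" for s
    unfolding geodesic_curve_def real_moebius_def by (subst (1 2) lin) (use d0 in auto)
  have geodesic_velocity: "geodesic_velocity ?\<tau> s = - geodesic_velocity ?\<sigma> (- s)" for s
  proof -
    have e: "complex_of_real (exp (- s)) * of_real (exp s) = 1"
      by (simp flip: of_real_mult exp_add)
    have "(- d * \<i> * complex_of_real (exp s))\<^sup>2 = - (of_real (exp s))\<^sup>2"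
    proof -
      have "\<i> * \<i> = -1" by simp
      then show ?thesis unfolding power2_eq_square using d by algebra
    qed
    then have "geodesic_velocity ?\<tau> s = 1 / ((of_real (?\<sigma>$2$1) * (\<i> * of_real (exp (- s))) + of_real (?\<sigma>$2$2))\<^sup>2
        * - (of_real (exp s))\<^sup>2) * (\<i> * of_real (exp s))"
      unfolding geodesic_velocity_def by (subst lin) (auto simp: power_mult_distrib)
    also have "\<dots> = - (1 / (of_real (?\<sigma>$2$1) * (\<i> * of_real (exp (- s))) + of_real (?\<sigma>$2$2))\<^sup>2
        * (\<i> * (1 / of_real (exp s))))"
      by (simp add: power2_eq_square)
    also have "1 / of_real (exp s) = complex_of_real (exp (- s))"
      by (simp add: exp_minus divide_inverse)
    finally show ?thesis by (simp add: geodesic_velocity_def)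
  qed
  have "full_geodesic_integral f ?\<sigma> = (LINT s|lborel. f (geodesic_curve ?\<sigma> (0 + -1 * s)) * geodesic_velocity ?\<sigma> (0 + -1 * s))"
    unfolding full_geodesic_integral_def using lborel_integral_real_affine[of "-1" "\<lambda>s. f (geodesic_curve ?\<sigma> s) * geodesic_velocity ?\<sigma> s" 0] by simp
  also have "\<dots> = - full_geodesic_integral f ?\<tau>" unfolding full_geodesic_integral_def geodesic_curve geodesic_velocity by simp
  finally show ?thesis unfolding cusp_symbol_eq_full[OF g] cusp_symbol_eq_full[OF g'] by simp
qed

lemma geodesic_curve_inj: "det \<sigma> = 1 \<Longrightarrow> inj (geodesic_curve \<sigma>)"
proof (rule injI)
  fix s t assume \<sigma>: "det \<sigma> = 1" and eq: "geodesic_curve \<sigma> s = geodesic_curve \<sigma> t"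
  have "real_moebius (adjugate2 \<sigma>) (geodesic_curve \<sigma> u) = \<i> * of_real (exp u)" for u
    unfolding geodesic_curve_def using \<sigma> adjugate2[of \<sigma>] by (subst real_moebius_mult[symmetric]) auto
  then have "\<i> * complex_of_real (exp s) = \<i> * of_real (exp t)" using eq by metis
  then show "s = t" by simp
qed

context psl_subgroup
begin

text \<open>Countably many exceptional parameters can be ignored even when nothing is known about the measurability
  of the integrand.\<close>

lemma full_geodesic_integral_invariant:
  assumes A: "A \<in> \<Gamma>" and \<sigma>: "det \<sigma> = 1"
  shows "full_geodesic_integral (pullback \<omega>) (real_mat A ** \<sigma>) = full_geodesic_integral (pullback \<omega>) \<sigma>"
  unfolding full_geodesic_integral_def
proof (rule integral_discrete_difference[where X = "geodesic_curve \<sigma> -` elliptic_points"])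
  let ?A = "real_mat A"
  have dA: "det ?A = 1" using A by (simp add: Gamma_det)
  then have dA\<sigma>: "det (?A ** \<sigma>) = 1" using \<sigma> by (simp add: det_mul)
  have "countable (geodesic_curve \<sigma> ` (geodesic_curve \<sigma> -` elliptic_points))"
    by (rule countable_subset[OF _ countable_elliptic_points]) auto
  then show "countable (geodesic_curve \<sigma> -` elliptic_points)"
    by (rule countable_image_inj_on) (use geodesic_curve_inj[OF \<sigma>] in \<open>auto intro: inj_on_subset\<close>)
  fix s assume "s \<notin> geodesic_curve \<sigma> -` elliptic_points"
  then have ne: "geodesic_curve \<sigma> s \<notin> elliptic_points" by simp
  have geodesic_curve: "geodesic_curve (?A ** \<sigma>) u = real_moebius ?A (geodesic_curve \<sigma> u)" for u
    unfolding geodesic_curve_def by (rule real_moebius_mult[OF dA \<sigma> axis_Im])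
  let ?w = "of_int (A$2$1) * geodesic_curve \<sigma> s + of_int (A$2$2) :: complex"
  have "((real_moebius ?A \<circ> geodesic_curve \<sigma>) has_vector_derivative geodesic_velocity \<sigma> s * (1 / ?w\<^sup>2)) (at s)"
    using field_vector_diff_chain_at[OF geodesic_curve_has_vector_derivative[OF \<sigma>]
        real_moebius_has_field_derivative[OF dA geodesic_curve_Im[OF \<sigma>]]] by simp
  moreover have "real_moebius ?A \<circ> geodesic_curve \<sigma> = geodesic_curve (?A ** \<sigma>)" by (auto simp: geodesic_curve)
  ultimately have "geodesic_velocity (?A ** \<sigma>) s = geodesic_velocity \<sigma> s * (1 / ?w\<^sup>2)"
    using geodesic_curve_has_vector_derivative[OF dA\<sigma>] vector_derivative_unique_at by metis
  then show "pullback \<omega> (geodesic_curve (?A ** \<sigma>) s) * geodesic_velocity (?A ** \<sigma>) s = pullback \<omega> (geodesic_curve \<sigma> s) * geodesic_velocity \<sigma> s"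
    using pullback_automorphic[OF A geodesic_curve_Im[OF \<sigma>] ne, of \<omega>, symmetric] unfolding geodesic_curve by simp
qed auto

lemma cusp_symbol_invariant:
  assumes A: "A \<in> \<Gamma>" and g: "det g = 1 \<or> det g = - 1"
  shows "cusp_symbol (pullback \<omega>) (A ** g) = cusp_symbol (pullback \<omega>) g"
proof -
  have dA: "det (A ** g) = det g" using A by (simp add: det_mul Gamma_det)
  have "geodesic_matrix (A ** g) = real_mat A ** geodesic_matrix g"
    unfolding geodesic_matrix_def dA real_mat_mult[symmetric]
    by (intro arg_cong[of _ _ real_mat] mat2_eqI) (simp_all add: matrix_mult_nth2 algebra_simps)
  then show ?thesis
    using full_geodesic_integral_invariant[OF A det_geodesic_matrix[OF g]] cusp_symbol_eq_full g dA by simp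
qed

end

section \<open>Convergents as matrices\<close>

lemma gauss_map_irrational:
  assumes "y \<notin> \<rat>" "0 < y" "y < 1"
  shows "gauss_map y \<notin> \<rat> \<and> 0 < gauss_map y \<and> gauss_map y < 1"
proof -
  have "1 / y \<notin> \<rat>"
  proof
    assume "1 / y \<in> \<rat>"
    then have "1 / (1 / y) \<in> \<rat>" by (rule Rats_divide[OF Rats_1])
    then show False using assms by simp
  qed
  then have "1 / y - of_int \<lfloor>1 / y\<rfloor> \<notin> \<rat>"
    using Rats_add[of "1 / y - of_int \<lfloor>1 / y\<rfloor>" "of_int \<lfloor>1 / y\<rfloor>"] by auto
  then have irr: "gauss_map y \<notin> \<rat>" by (simp add: gauss_map_def frac_def)
  then have "gauss_map y \<noteq> 0" by (metis Rats_0)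
  then show ?thesis
    using irr frac_ge_0[of "1 / y"] frac_lt_1[of "1 / y"] unfolding gauss_map_def by linarith
qed

lemma cf_digit_pos:
  assumes y: "y \<notin> \<rat>" "0 < y" "y < 1"
  shows "1 \<le> cf_digit n y"
proof -
  have "(gauss_map ^^ m) y \<notin> \<rat> \<and> 0 < (gauss_map ^^ m) y \<and> (gauss_map ^^ m) y < 1" for m
    by (induction m) (use y gauss_map_irrational in auto)
  from this[of "n - 1"] show ?thesis by (simp add: cf_digit_def le_floor_iff)
qed

text \<open>The factor contributed by a partial quotient k.\<close>

definition digit_matrix :: "int \<Rightarrow> int^2^2" where
  "digit_matrix k = mat2 0 1 1 k"

primrec cf_matrix :: "nat \<Rightarrow> real \<Rightarrow> int^2^2" where
  "cf_matrix 0 y = mat 1"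
| "cf_matrix (Suc n) y = cf_matrix n y ** digit_matrix (cf_digit (Suc n) y)"

lemma det_digit_matrix: "det (digit_matrix k) = - 1"
  by (simp add: digit_matrix_def det_2)

lemma det_cf_matrix: "det (cf_matrix n y) = 1 \<or> det (cf_matrix n y) = - 1"
  by (induction n) (auto simp: det_mul det_digit_matrix)

text \<open>The columns are the last two convergents.  For n = 0 the matrix is the identity, with first column (1, 0).\<close>

lemma cf_matrix_Suc:
  "cf_matrix (Suc n) y = mat2 (cf_p n y) (cf_p (Suc n) y) (cf_q n y) (cf_q (Suc n) y)"
proof (induction n)
  case 0
  show ?case by (simp add: digit_matrix_def)
next
  case (Suc n)
  show ?case
    unfolding cf_matrix.simps(2)[of "Suc n"] Suc.IH
    by (rule mat2_eqI) (simp_all add: matrix_mult_nth2 digit_matrix_def)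
qed

lemma cf_q_pos:
  assumes "y \<notin> \<rat>" "0 < y" "y < 1"
  shows "1 \<le> cf_q n y"
proof -
  have "1 \<le> cf_q n y \<and> 1 \<le> cf_q (Suc n) y"
  proof (induction n)
    case 0
    show ?case using cf_digit_pos[OF assms, of 1] by simp
  next
    case (Suc n)
    have "1 * 1 \<le> cf_digit (Suc (Suc n)) y * cf_q (Suc n) y"
      using Suc cf_digit_pos[OF assms, of "Suc (Suc n)"] by (intro mult_mono) auto
    then show ?case using Suc by simp
  qed
  then show ?thesis ..
qed

lemma act_cf_matrix:
  assumes "y \<notin> \<rat>" "0 < y" "y < 1" "1 \<le> i"
  shows "act (cf_matrix i y) None = convergent_point (i - 1) y"
    and "act (cf_matrix i y) (Some 0) = convergent_point i y"
proof -
  obtain n where i: "i = Suc n" using assms(4) by (cases i) auto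
  have q: "cf_q n y \<noteq> 0" "cf_q (Suc n) y \<noteq> 0"
    using cf_q_pos[OF assms(1-3), of n] cf_q_pos[OF assms(1-3), of "Suc n"] by auto
  show "act (cf_matrix i y) None = convergent_point (i - 1) y"
    "act (cf_matrix i y) (Some 0) = convergent_point i y"
    unfolding i cf_matrix_Suc using q
    by (simp_all add: act_def map_matrix_def convergent_point_def del: cf_p.simps cf_q.simps)
qed

section \<open>The modular symbols of convergents as a function of the state\<close>

locale finite_index_subgroup = psl_subgroup +
  assumes finite_index: "finite (rcosets\<^bsub>PSL2Z\<^esub> G0)"
begin

text \<open>A partial quotient acts on cosets by right multiplication.  Values of k below 1 do not occur
  for irrational numbers; replacing them by 1 makes every k act on the orbit below.\<close>

definition digit_step :: "int \<Rightarrow> (int^2^2) set \<Rightarrow> (int^2^2) set" where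
  "digit_step k C = (\<lambda>h. h ** digit_matrix (max 1 k)) ` C"

text \<open>The states that occur, namely the cosets reached from \<open>\<Gamma>\<close> itself.\<close>

inductive_set digit_orbit :: "(int^2^2) set set" where
  base: "coset (mat 1) \<in> digit_orbit"
| step: "C \<in> digit_orbit \<Longrightarrow> digit_step k C \<in> digit_orbit"

lemma digit_step_coset: "digit_step k (coset g) = coset (g ** digit_matrix (max 1 k))"
  unfolding digit_step_def by (rule coset_times)

lemma inj_digit_step: "inj (digit_step k)"
proof -
  have "digit_matrix m ** mat2 (- m) 1 1 0 = mat 1" for m
    by (rule mat2_eqI) (simp_all add: matrix_mult_nth2 digit_matrix_def)
  then have "h ** digit_matrix m ** mat2 (- m) 1 1 0 = h" for h m
    by (metis matrix_mul_assoc matrix_mul_rid)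
  then have inj: "inj (\<lambda>h. h ** digit_matrix m)" for m by (metis injI)
  show ?thesis
    unfolding digit_step_def by (rule injI) (rule iffD1[OF inj_image_eq_iff[OF inj]])
qed

lemma digit_orbit_coset:
  assumes "C \<in> digit_orbit"
  obtains g where "det g = 1 \<or> det g = - 1" "C = coset g"
  using assms
proof (induction arbitrary: thesis)
  case base
  then show ?case by (metis det_I)
next
  case (step C k)
  obtain g where g: "det g = 1 \<or> det g = - 1" "C = coset g" using step.IH by blast
  show ?case
    by (rule step.prems[of "g ** digit_matrix (max 1 k)"]) (use g in \<open>auto simp: det_mul det_digit_matrix digit_step_coset\<close>)
qed

lemma finite_digit_orbit: "finite digit_orbit"
proof -
  have "digit_orbit \<subseteq> coset ` {g. det g = 1} \<union> (`) (\<lambda>h. h ** swap_matrix) ` coset ` {g. det g = 1}"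
  proof
    fix C assume "C \<in> digit_orbit"
    then obtain g where g: "det g = 1 \<or> det g = - 1" "C = coset g" by (rule digit_orbit_coset)
    have "swap_matrix ** swap_matrix = mat 1" by (rule mat2_eqI) (simp_all add: matrix_mult_nth2 swap_matrix_def)
    then have "g ** swap_matrix ** swap_matrix = g" by (metis matrix_mul_assoc matrix_mul_rid)
    then have "C = (\<lambda>h. h ** swap_matrix) ` coset (g ** swap_matrix)" by (simp add: coset_times g)
    moreover have "det (g ** swap_matrix) = 1" if "det g = - 1" using that by (simp add: det_mul det_swap_matrix)
    ultimately show "C \<in> coset ` {g. det g = 1} \<union> (`) (\<lambda>h. h ** swap_matrix) ` coset ` {g. det g = 1}"
      using g by blast
  qed
  then show ?thesis
    by (rule finite_subset) (intro finite_UnI finite_imageI finite_SL2Z_cosets finite_index)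
qed

lemma bij_digit_step: "bij_betw (digit_step k) digit_orbit digit_orbit"
proof -
  have "inj_on (digit_step k) digit_orbit" using inj_digit_step by (rule inj_on_subset) simp
  moreover have "digit_step k ` digit_orbit \<subseteq> digit_orbit" using digit_orbit.step by blast
  ultimately show ?thesis using finite_digit_orbit by (simp add: bij_betw_def endo_inj_surj)
qed

text \<open>The steps are injective on a finite set, so they map an invariant set A onto itself.  Then they also preserve the complement
  of A in the orbit, which therefore cannot contain the coset from which the orbit starts.\<close>

lemma digit_orbit_irreducible:
  assumes A: "A \<subseteq> digit_orbit" "A \<noteq> {}" and step: "\<And>k C. 1 \<le> k \<Longrightarrow> C \<in> A \<Longrightarrow> digit_step k C \<in> A"
  shows "A = digit_orbit"
proof -
  have step': "digit_step k C \<in> A" if "C \<in> A" for k C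
    using step[of "max 1 k" C] that by (simp add: digit_step_def)
  have surj: "digit_step k ` A = A" for k
    using step' inj_on_subset[OF inj_digit_step] finite_subset[OF A(1) finite_digit_orbit]
    by (intro endo_inj_surj) auto
  have "coset (mat 1) \<in> A"
  proof (rule ccontr)
    assume "coset (mat 1) \<notin> A"
    have "C \<in> digit_orbit - A" if "C \<in> digit_orbit" for C
      using that
    proof induction
      case base
      show ?case using \<open>coset (mat 1) \<notin> A\<close> digit_orbit.base by blast
    next
      case (step C k)
      have "digit_step k C \<notin> A"
      proof
        assume "digit_step k C \<in> A"
        then obtain D where "D \<in> A" "digit_step k C = digit_step k D" using surj by (metis imageE)
        then show False using inj_digit_step step.IH by (auto dest: injD)
      qed
      then show ?case using step digit_orbit.step by blast
    qed
    then show False using A by blast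
  qed
  note base = this
  have "C \<in> A" if "C \<in> digit_orbit" for C
    using that
  proof induction
    case base
    show ?case by fact
  next
    case (step C k)
    then show ?case using step' by blast
  qed
  then show ?thesis using A by blast
qed

text \<open>The inverse of a step again preserves the orbit, and the matrix that exchanges 0 and \<open>\<infinity>\<close> is
  a product of the matrices of the partial quotients 1 and 2 and their inverses.\<close>

lemma digit_orbit_swap:
  assumes "C \<in> digit_orbit"
  shows "(\<lambda>h. h ** swap_matrix) ` C \<in> digit_orbit"
proof -
  obtain g where g: "C = coset g" using digit_orbit_coset[OF assms] by metis
  have "digit_step 1 C \<in> digit_step 2 ` digit_orbit" using assms digit_orbit.step bij_digit_step[of 2] by (auto simp: bij_betw_def)
  then obtain D where D: "D \<in> digit_orbit" "digit_step 1 C = digit_step 2 D" by blast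
  obtain h where h: "D = coset h" using digit_orbit_coset[OF D(1)] by metis
  \<comment> \<open>The inverse of the matrix of 2 multiplied by the matrix of 1.\<close>
  let ?m = "mat2 1 (- 1) 0 1"
  have m: "digit_matrix 1 ** ?m = swap_matrix" "digit_matrix 2 ** ?m = digit_matrix 1"
    by (rule mat2_eqI; simp add: matrix_mult_nth2 digit_matrix_def swap_matrix_def)+
  have "coset (g ** digit_matrix 1) = coset (h ** digit_matrix 2)" using D(2) by (simp add: g h digit_step_coset)
  then have "coset (g ** digit_matrix 1 ** ?m) = coset (h ** digit_matrix 2 ** ?m)"
    unfolding coset_times[symmetric] by simp
  then have "coset (g ** swap_matrix) = coset (h ** digit_matrix 1)"
    by (simp add: m flip: matrix_mul_assoc)
  then have "(\<lambda>h. h ** swap_matrix) ` C = digit_step 1 D" by (simp add: g h digit_step_coset coset_times)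
  then show ?thesis using D(1) digit_orbit.step by simp
qed

text \<open>The value of the symbol \<open>{g \<infinity>, g 0}\<close> on a differential, as a function of the coset
  \<open>\<Gamma> g\<close>.\<close>

definition coset_symbol :: "(complex option set) differential \<Rightarrow> (int^2^2) set \<Rightarrow> complex" where
  "coset_symbol \<omega> C = cusp_symbol (pullback \<omega>) (SOME g. (det g = 1 \<or> det g = - 1) \<and> C = coset g)"

lemma coset_symbol_coset:
  assumes g: "det g = 1 \<or> det g = - 1"
  shows "coset_symbol \<omega> (coset g) = cusp_symbol (pullback \<omega>) g"
proof -
  define h where "h = (SOME h. (det h = 1 \<or> det h = - 1) \<and> coset g = coset h)"
  have "(det h = 1 \<or> det h = - 1) \<and> coset g = coset h"
    unfolding h_def by (rule someI[of _ g]) (use g in simp)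
  then have "h \<in> coset g" using coset_self by simp
  then obtain A where "A \<in> \<Gamma>" "h = A ** g" by (auto simp: coset_def)
  then show ?thesis using cusp_symbol_invariant[OF _ g] by (simp add: coset_symbol_def flip: h_def)
qed

lemma sum_coset_symbol: "(\<Sum>C\<in>digit_orbit. coset_symbol \<omega> C) = 0"
proof -
  let ?s = "\<lambda>C. (\<lambda>h. h ** swap_matrix) ` C"
  have "swap_matrix ** swap_matrix = mat 1" by (rule mat2_eqI) (simp_all add: matrix_mult_nth2 swap_matrix_def)
  then have ss: "h ** swap_matrix ** swap_matrix = h" for h by (metis matrix_mul_assoc matrix_mul_rid)
  have inv: "?s (?s C) = C" for C by (simp add: image_image ss)
  have "coset_symbol \<omega> (?s C) = - coset_symbol \<omega> C" if C: "C \<in> digit_orbit" for C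
  proof -
    obtain g where g: "det g = 1 \<or> det g = - 1" "C = coset g" using C by (rule digit_orbit_coset)
    then have "det (g ** swap_matrix) = 1 \<or> det (g ** swap_matrix) = - 1" by (auto simp: det_mul det_swap_matrix)
    then show ?thesis using g by (simp add: coset_times coset_symbol_coset cusp_symbol_swap)
  qed
  moreover have "(\<Sum>C\<in>digit_orbit. coset_symbol \<omega> C) = (\<Sum>C\<in>digit_orbit. coset_symbol \<omega> (?s C))"
    by (rule sum.reindex_bij_witness[of _ ?s ?s]) (auto simp: inv digit_orbit_swap)
  ultimately have "(\<Sum>C\<in>digit_orbit. coset_symbol \<omega> C) = - (\<Sum>C\<in>digit_orbit. coset_symbol \<omega> C)"
    by (simp add: sum_negf)
  then show ?thesis by simp
qed

lemma digit_action_symbol: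
  "digit_action digit_orbit digit_step (\<lambda>C. Re (coset_symbol \<omega> C))" "digit_action digit_orbit digit_step (\<lambda>C. Im (coset_symbol \<omega> C))"
proof -
  have "(\<Sum>C\<in>digit_orbit. Re (coset_symbol \<omega> C)) = 0" "(\<Sum>C\<in>digit_orbit. Im (coset_symbol \<omega> C)) = 0"
    using sum_coset_symbol[of \<omega>] by (metis Re_sum zero_complex.sel(1), metis Im_sum zero_complex.sel(2))
  then show "digit_action digit_orbit digit_step (\<lambda>C. Re (coset_symbol \<omega> C))" "digit_action digit_orbit digit_step (\<lambda>C. Im (coset_symbol \<omega> C))"
    by (unfold_locales; use finite_digit_orbit digit_orbit.base bij_digit_step digit_orbit_irreducible in blast)+
qed

abbreviation coset_state :: "nat \<Rightarrow> real \<Rightarrow> (int^2^2) set" where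
  "coset_state n y \<equiv> digit_action.digit_state digit_step n (coset (mat 1)) y"

lemma coset_state_eq:
  assumes "y \<notin> \<rat>" "0 < y" "y < 1"
  shows "coset_state n y = coset (cf_matrix n y)"
proof (induction n)
  case 0
  show ?case by (simp add: digit_action.digit_state.simps[OF digit_action_symbol(1)])
next
  case (Suc n)
  have "max 1 (cf_digit (Suc n) y) = cf_digit (Suc n) y" using cf_digit_pos[OF assms] by simp
  then show ?case
    unfolding digit_action.digit_state_last[OF digit_action_symbol(1)] Suc.IH digit_step_coset by simp
qed

lemma modular_symbol_eq_coset_symbol:
  assumes "\<omega> \<in> modular_differentials G0" "y \<notin> \<rat>" "0 < y" "y < 1" "1 \<le> i"
  shows "modular_symbol G0 (convergent_point (i - 1) y) (convergent_point i y) \<omega> = coset_symbol \<omega> (coset_state i y)"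
  unfolding coset_state_eq[OF assms(2-4)] coset_symbol_coset[OF det_cf_matrix] cusp_symbol_def
    act_cf_matrix[OF assms(2-5)] modular_symbol_def pullback_def using assms(1) by simp

lemma coset_symbol_measurable:
  "(\<lambda>y. coset_symbol \<omega> (coset_state i y)) \<in> borel_measurable unit_measure"
  unfolding borel_measurable_complex_iff
  using digit_action.digit_state_measurable_unit[OF digit_action_symbol(1) digit_orbit.base]
    digit_action.digit_state_measurable_unit[OF digit_action_symbol(2) digit_orbit.base] by blast

lemma coset_symbol_bounded:
  obtains K where "\<And>i y. norm (coset_symbol \<omega> (coset_state i y)) \<le> K" "0 \<le> K"
proof
  show "norm (coset_symbol \<omega> (coset_state i y)) \<le> (\<Sum>C\<in>digit_orbit. norm (coset_symbol \<omega> C))" for i y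
    using digit_action.digit_state_in_X[OF digit_action_symbol(1) digit_orbit.base] finite_digit_orbit
    by (intro member_le_sum) auto
qed (auto intro: sum_nonneg)

definition coset_state_average :: "(complex option set) differential \<Rightarrow> nat \<Rightarrow> real \<Rightarrow> complex" where
  "coset_state_average \<omega> n y = (1 / of_nat n) * (\<Sum>i=1..n. coset_symbol \<omega> (coset_state i y))"

lemma symbol_average_eq_state_average:
  assumes "\<omega> \<in> modular_differentials G0" "y \<in> {0..1}" "y \<notin> \<rat>"
  shows "symbol_average G0 n y \<omega> = coset_state_average \<omega> n y"
proof -
  have "y \<noteq> 0" "y \<noteq> 1" using assms(3) by auto
  then have "0 < y" "y < 1" using assms(2) by auto
  then show ?thesis
    unfolding symbol_average_def coset_state_average_def
    using modular_symbol_eq_coset_symbol[OF assms(1,3)] by simp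
qed

lemma null_singleton_unit_measure:
  assumes "y \<in> {0..1} \<inter> \<rat>"
  shows "{y} \<in> sets unit_measure" "emeasure unit_measure {y} = 0"
proof -
  show "{y} \<in> sets unit_measure" using assms by (auto simp: sets_restrict_space image_iff intro!: bexI[of _ "{y}"])
  show "emeasure unit_measure {y} = 0"
    using assms by (subst emeasure_restrict_space) auto
qed

lemma countable_unit_rationals: "countable ({0..1} \<inter> \<rat> :: real set)"
  using countable_rat by (rule countable_subset[rotated]) auto

lemma integral_symbol_average_eq:
  assumes "\<omega> \<in> modular_differentials G0"
  shows "(LINT y|unit_measure. symbol_average G0 n y \<omega> * h y) = (LINT y|unit_measure. coset_state_average \<omega> n y * h y)"
  by (rule integral_discrete_difference[OF countable_unit_rationals])
     (use null_singleton_unit_measure symbol_average_eq_state_average[OF assms] in auto)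

lemma symbol_average_L2:
  assumes \<omega>: "\<omega> \<in> modular_differentials G0"
  shows "(\<lambda>y. symbol_average G0 n y \<omega>) \<in> L2_unit"
proof -
  have meas: "coset_state_average \<omega> n \<in> borel_measurable unit_measure"
    unfolding coset_state_average_def[abs_def]
    by (intro borel_measurable_times borel_measurable_const borel_measurable_sum coset_symbol_measurable)
  obtain K where K: "\<And>i y. norm (coset_symbol \<omega> (coset_state i y)) \<le> K" "0 \<le> K"
    using coset_symbol_bounded by blast
  have bound: "norm (coset_state_average \<omega> n y) \<le> K" for y
  proof (cases "n = 0")
    case False
    have "norm (\<Sum>i=1..n. coset_symbol \<omega> (coset_state i y)) \<le> (\<Sum>i=1..n. K)"
      using K by (intro order_trans[OF norm_sum] sum_mono)
    then show ?thesis using False by (simp add: coset_state_average_def norm_mult norm_divide field_simps)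
  qed (use K in \<open>simp add: coset_state_average_def\<close>)
  have "integrable unit_measure (\<lambda>y. (norm (coset_state_average \<omega> n y))\<^sup>2)"
  proof (rule finite_measure.integrable_const_bound[OF finite_unit_measure])
    show "AE y in unit_measure. norm ((norm (coset_state_average \<omega> n y))\<^sup>2) \<le> K\<^sup>2"
      using bound by (intro AE_I2) (simp add: power_mono)
    show "(\<lambda>y. (norm (coset_state_average \<omega> n y))\<^sup>2) \<in> borel_measurable unit_measure"
      using meas by measurable
  qed
  then have "integrable unit_measure (\<lambda>y. (norm (symbol_average G0 n y \<omega>))\<^sup>2)"
    by (rule integrable_discrete_difference[OF countable_unit_rationals, THEN iffD1, rotated -1])
       (use null_singleton_unit_measure symbol_average_eq_state_average[OF \<omega>] in auto)
  moreover have "(\<lambda>y. symbol_average G0 n y \<omega>) \<in> borel_measurable unit_measure"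
    by (rule measurable_discrete_difference[OF meas countable_unit_rationals])
       (use null_singleton_unit_measure symbol_average_eq_state_average[OF \<omega>] in auto)
  ultimately show ?thesis by (simp add: L2_unit_def)
qed

lemma L2_unit_integrable:
  assumes "h \<in> (L2_unit :: (real \<Rightarrow> complex) set)"
  shows "integrable unit_measure h"
proof (rule Bochner_Integration.integrable_bound)
  show "integrable unit_measure (\<lambda>y. 1 + (norm (h y))\<^sup>2)"
    using assms finite_measure.integrable_const[OF finite_unit_measure, of "1::real"]
    unfolding L2_unit_def by (intro Bochner_Integration.integrable_add) auto
  show "h \<in> borel_measurable unit_measure" using assms by (simp add: L2_unit_def)
  have "u \<le> 1 + u\<^sup>2" for u :: real
    using zero_le_power2[of "u - 1 / 2"] by (simp add: power2_eq_square algebra_simps)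
  then show "AE y in unit_measure. norm (h y) \<le> norm (1 + (norm (h y))\<^sup>2)"
    by (intro AE_I2) (simp add: abs_of_nonneg)
qed

text \<open>The convergence for real-valued functions of the state applies to the real and the imaginary part
  of the symbol.\<close>

lemma symbol_average_weakly_0:
  assumes \<omega>: "\<omega> \<in> modular_differentials G0" and h: "integrable unit_measure h"
  shows "(\<lambda>n. LINT y|unit_measure. symbol_average G0 n y \<omega> * h y) \<longlonglongrightarrow> 0"
proof -
  let ?re = "\<lambda>i y. Re (coset_symbol \<omega> (coset_state i y))" and ?im = "\<lambda>i y. Im (coset_symbol \<omega> (coset_state i y))"
  let ?R = "\<lambda>i. LINT y|unit_measure. ?re i y *\<^sub>R h y" and ?I = "\<lambda>i. LINT y|unit_measure. ?im i y *\<^sub>R h y"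
  have int: "integrable unit_measure (\<lambda>y. ?re i y *\<^sub>R h y)" "integrable unit_measure (\<lambda>y. ?im i y *\<^sub>R h y)" for i
    using digit_action.integrable_F_times[OF digit_action_symbol(1) h digit_orbit.base]
      digit_action.integrable_F_times[OF digit_action_symbol(2) h digit_orbit.base] by blast+
  have split: "coset_symbol \<omega> (coset_state i y) * h y = ?re i y *\<^sub>R h y + \<i> * (?im i y *\<^sub>R h y)" for i y
    by (simp add: complex_eq_iff)
  have int2: "integrable unit_measure (\<lambda>y. coset_symbol \<omega> (coset_state i y) * h y)" for i
    unfolding split by (intro Bochner_Integration.integrable_add integrable_mult_right int)
  have i_eq: "(LINT y|unit_measure. coset_symbol \<omega> (coset_state i y) * h y) = ?R i + \<i> * ?I i" for i
    unfolding split Bochner_Integration.integral_add[OF int(1) integrable_mult_right[OF int(2)]]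
      integral_mult_right_zero by (rule refl)
  have "(LINT y|unit_measure. coset_state_average \<omega> n y * h y)
      = (1 / real n) *\<^sub>R (\<Sum>i=1..n. ?R i) + \<i> * ((1 / real n) *\<^sub>R (\<Sum>i=1..n. ?I i))" for n
  proof -
    have "(LINT y|unit_measure. coset_state_average \<omega> n y * h y)
        = (LINT y|unit_measure. (1 / of_nat n) * (\<Sum>i=1..n. coset_symbol \<omega> (coset_state i y) * h y))"
      by (simp only: coset_state_average_def mult.assoc sum_distrib_right)
    also have "\<dots> = (1 / of_nat n) * (\<Sum>i=1..n. LINT y|unit_measure. coset_symbol \<omega> (coset_state i y) * h y)"
      using int2 by (subst integral_mult_right_zero, subst Bochner_Integration.integral_sum) auto
    also have "\<dots> = (1 / real n) *\<^sub>R (\<Sum>i=1..n. ?R i) + \<i> * ((1 / real n) *\<^sub>R (\<Sum>i=1..n. ?I i))"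
      unfolding i_eq sum.distrib sum_distrib_left[symmetric]
      by (simp add: scaleR_conv_of_real algebra_simps)
    finally show ?thesis .
  qed
  moreover have "(\<lambda>n. (1 / real n) *\<^sub>R (\<Sum>i=1..n. ?R i) + \<i> * ((1 / real n) *\<^sub>R (\<Sum>i=1..n. ?I i)))
      \<longlonglongrightarrow> 0 + \<i> * 0"
    by (intro tendsto_add tendsto_mult tendsto_const
        digit_action.F_average_weakly_0[OF digit_action_symbol(1) h digit_orbit.base]
        digit_action.F_average_weakly_0[OF digit_action_symbol(2) h digit_orbit.base])
  ultimately show ?thesis unfolding integral_symbol_average_eq[OF \<omega>] by simp
qed

lemma set_integral_symbol_average:
  assumes "E \<subseteq> {0..1}"
  shows "(1 / of_nat n) * (LINT y:E|lebesgue. (\<Sum>i=1..n.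
           modular_symbol G0 (convergent_point (i - 1) y) (convergent_point i y) \<omega>))
    = (LINT y|unit_measure. symbol_average G0 n y \<omega> * indicat_real E y)"
proof -
  let ?s = "\<lambda>y. \<Sum>i=1..n. modular_symbol G0 (convergent_point (i - 1) y) (convergent_point i y) \<omega>"
  have "(LINT y|unit_measure. symbol_average G0 n y \<omega> * indicat_real E y)
      = (LINT y|lebesgue. indicat_real {0..1} y *\<^sub>R (symbol_average G0 n y \<omega> * indicat_real E y))"
    by (subst integral_restrict_space) (auto simp: set_lebesgue_integral_def)
  also have "\<dots> = (LINT y|lebesgue. (1 / of_nat n) * (indicat_real E y *\<^sub>R ?s y))"
    using assms by (intro Bochner_Integration.integral_cong) (auto simp: indicator_def symbol_average_def)
  also have "\<dots> = (1 / of_nat n) * (LINT y:E|lebesgue. ?s y)"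
    unfolding set_lebesgue_integral_def by (rule integral_mult_right_zero)
  finally show ?thesis by simp
qed

end

theorem theorem0p2p1:
  fixes G0 :: "(int^2^2) set set"
  assumes "subgroup G0 PSL2Z"
    and "finite (rcosets\<^bsub>PSL2Z\<^esub> G0)"
    and "\<forall>t\<in>P0 G0. Red_orbit t = P0 G0"
  shows "weakly_L2_to_zero (modular_differentials G0) (symbol_average G0) \<and>
    (\<forall>E. E \<in> sets lebesgue \<longrightarrow> E \<subseteq> {0..1} \<longrightarrow>
      (\<forall>\<omega>\<in>modular_differentials G0.
        (\<lambda>n. (1 / of_nat n) * (LINT \<beta>:E|lebesgue. (\<Sum>i=1..n.
           modular_symbol G0 (convergent_point (i - 1) \<beta>) (convergent_point i \<beta>) \<omega>)))
        \<longlonglongrightarrow> 0))"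
proof -
  interpret finite_index_subgroup G0
    by (intro finite_index_subgroup.intro psl_subgroup.intro finite_index_subgroup_axioms.intro assms(1,2))
  show ?thesis
  proof (intro conjI allI impI ballI)
    show "weakly_L2_to_zero (modular_differentials G0) (symbol_average G0)"
      unfolding weakly_L2_to_zero_def
      using symbol_average_L2 symbol_average_weakly_0 L2_unit_integrable by blast
    fix E \<omega>
    assume E: "E \<in> sets lebesgue" "E \<subseteq> {0..1::real}" and \<omega>: "\<omega> \<in> modular_differentials G0"
    have "E \<inter> {0..1} \<in> sets unit_measure"
      using E by (simp add: sets_restrict_space_iff Int_absorb2)
    then have "integrable unit_measure (\<lambda>y. indicat_real E y *\<^sub>R (1::complex))"
      by (rule integrable_indicator_scaleR)
    then have "integrable unit_measure (\<lambda>y. complex_of_real (indicat_real E y))"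
      by (simp add: scaleR_conv_of_real)
    from symbol_average_weakly_0[OF \<omega> this]
    show "(\<lambda>n. (1 / of_nat n) * (LINT \<beta>:E|lebesgue. (\<Sum>i=1..n.
        modular_symbol G0 (convergent_point (i - 1) \<beta>) (convergent_point i \<beta>) \<omega>))) \<longlonglongrightarrow> 0"
      unfolding set_integral_symbol_average[OF E(2)] .
  qed
qed

end
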